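(* Let $\alpha=(A,(A_i)_{i\in I_\alpha})$ and $\beta=(B,(B_i)_{i\in I_\beta})$ be two coset incidence systems of finite rank that are compatible on $L=I_\alpha\cap I_\beta$, and let $C=A_{I_\alpha\setminus L}\cong B_{I_\beta\setminus L}$. The group $G=A*_C B$ is flag-transitive on $\alpha*_L\beta$ if and only if $A$ and $B$ are flag-transitive on $\alpha$ and $\beta$, respectively. Additionally, if $G=A*_C B$ is flag-transitive on $\alpha*_L\beta$, then: (a) $\alpha*_L\beta$ is a coset geometry; (b) $\alpha*_L\beta$ is residually connected if and only if both $\alpha$ and $\beta$ are residually connected; (c) $\alpha*_L\beta$ is firm (respectively thin, respectively thick) if and only if $\alpha$ and $\beta$ are both firm (respectively thin, respectively thick).
   Context: A coset incidence system $(G,(G_i)_{i\in I})$ consists of a group $G$ and a family of subgroups $G_i\le G$ indexed by a type set $I$. It denotes the incidence system whose elements of type $i$ are the left cosets $gG_i$, $g\in G$ (cosets of different types are regarded as different elements), two elements being incident iff their intersection is non-empty. Its rank is $|I|$. For $J\subseteq I$, $G_J=\bigcap_{j\in J}G_j$, with $G_\emptyset=G$ (parabolic subgroups). A flag is a set of pairwise incident elements; its type is the set of types of its elements; a chamber is a flag of type $I$; the corank of a flag $F$ is $|I|-|F|$. The system is a (coset) geometry if every maximal flag is a chamber. The residue of a flag $F$ is the incidence system of all elements incident to every element of $F$ and not in $F$; for a geometry it has rank $|I|-|F|$. A geometry is residually connected if every residue of rank at least two (including that of the empty flag) has connected incidence graph (so rank 1 geometries are residually connected). It is firm, thin, thick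 if every residue of a flag of corank one contains, respectively, at least two, exactly two, more than two elements. $G$ acts by left multiplication; $G$ is flag-transitive if for every $J\subseteq I$ it is transitive on the flags of type $J$. Compatibility: with $L=I_\alpha\cap I_\beta$, $\alpha$ and $\beta$ are compatible on $L$ if there is a fixed isomorphism $\varphi: A_{I_\alpha\setminus L}\to B_{I_\beta\setminus L}$ such that for all $J\subseteq L$, $\varphi$ maps $A_{I_\alpha\setminus(L\setminus J)}$ onto $B_{I_\beta\setminus(L\setminus J)}$. Write $C$ for $A_{I_\alpha\setminus L}$ identified with $B_{I_\beta\setminus L}$ via $\varphi$, and $G=A*_C B$ for the amalgamated product along $\varphi$. Amalgamated product: $\alpha*_L\beta=(G,(G_i)_{i\in I})$ with $I=I_\alpha\cup I_\beta$ and $G_i=\langle A_{\{i\}\cap I_\alpha},B_{\{i\}\cap I_\beta}\rangle\le G$ (so $A_\emptyset=A$, $B_\emptyset=B$). *)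

theory Defs
  imports "HOL-Algebra.Generated_Groups" "HOL-Algebra.Left_Coset"
begin

section \<open>Incidence systems\<close>

record ('x, 'i) incidence_system =
  elements :: "'x set"
  types :: "'i set"
  type_of :: "'x \<Rightarrow> 'i"
  incident :: "'x \<Rightarrow> 'x \<Rightarrow> bool"

definition rank :: "('x, 'i) incidence_system \<Rightarrow> nat" where
  "rank X = card (types X)"

definition flag :: "('x, 'i) incidence_system \<Rightarrow> 'x set \<Rightarrow> bool" where
  "flag X F \<longleftrightarrow> F \<subseteq> elements X \<and> pairwise (incident X) F"

definition flag_type :: "('x, 'i) incidence_system \<Rightarrow> 'x set \<Rightarrow> 'i set" where
  "flag_type X F = type_of X ` F"

definition chamber :: "('x, 'i) incidence_system \<Rightarrow> 'x set \<Rightarrow> bool" where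
  "chamber X F \<longleftrightarrow> flag X F \<and> flag_type X F = types X"

definition maximal_flag :: "('x, 'i) incidence_system \<Rightarrow> 'x set \<Rightarrow> bool" where
  "maximal_flag X F \<longleftrightarrow> flag X F \<and> (\<forall>F'. flag X F' \<and> F \<subseteq> F' \<longrightarrow> F' = F)"

definition corank :: "('x, 'i) incidence_system \<Rightarrow> 'x set \<Rightarrow> nat" where
  "corank X F = rank X - card F"

definition geometry :: "('x, 'i) incidence_system \<Rightarrow> bool" where
  "geometry X \<longleftrightarrow> (\<forall>F. maximal_flag X F \<longrightarrow> chamber X F)"

definition residue :: "('x, 'i) incidence_system \<Rightarrow> 'x set \<Rightarrow> ('x, 'i) incidence_system" where
  "residue X F = X\<lparr>elements := {x \<in> elements X - F. \<forall>y\<in>F. incident X x y},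
                  types := types X - flag_type X F\<rparr>"

definition connected_incidence_graph :: "('x, 'i) incidence_system \<Rightarrow> bool" where
  "connected_incidence_graph X \<longleftrightarrow>
     (\<forall>x\<in>elements X. \<forall>y\<in>elements X.
        (x, y) \<in> {(u, v). u \<in> elements X \<and> v \<in> elements X \<and> incident X u v}\<^sup>*)"

text \<open>The following notions are meant for geometries; there the residue of a flag \<open>F\<close> has all types
  outside the type of \<open>F\<close>. They do not themselves require \<^term>\<open>geometry X\<close>.\<close>

definition residually_connected :: "('x, 'i) incidence_system \<Rightarrow> bool" where
  "residually_connected X \<longleftrightarrow>
     (\<forall>F. flag X F \<and> 2 \<le> rank (residue X F) \<longrightarrow> connected_incidence_graph (residue X F))"

text \<open>Residues may be infinite, and \<^const>\<open>card\<close> is 0 on infinite sets; hence the separate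
  disjunct in the definitions of firm and thick.\<close>

definition firm :: "('x, 'i) incidence_system \<Rightarrow> bool" where
  "firm X \<longleftrightarrow> (\<forall>F. flag X F \<and> corank X F = 1 \<longrightarrow>
     infinite (elements (residue X F)) \<or> 2 \<le> card (elements (residue X F)))"

definition thin :: "('x, 'i) incidence_system \<Rightarrow> bool" where
  "thin X \<longleftrightarrow> (\<forall>F. flag X F \<and> corank X F = 1 \<longrightarrow> card (elements (residue X F)) = 2)"

definition thick :: "('x, 'i) incidence_system \<Rightarrow> bool" where
  "thick X \<longleftrightarrow> (\<forall>F. flag X F \<and> corank X F = 1 \<longrightarrow>
     infinite (elements (residue X F)) \<or> 2 < card (elements (residue X F)))"


section \<open>Coset incidence systems\<close>

record ('g, 'i) coset_system =
  grp :: "'g monoid"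
  index :: "'i set"
  sub :: "'i \<Rightarrow> 'g set"

definition coset_incidence_system :: "('g, 'i) coset_system \<Rightarrow> bool" where
  "coset_incidence_system \<alpha> \<longleftrightarrow>
     group (grp \<alpha>) \<and> (\<forall>i\<in>index \<alpha>. subgroup (sub \<alpha> i) (grp \<alpha>))"

text \<open>An element is a coset tagged with its type, so that equal cosets of different types are
  different elements.\<close>

definition incidence :: "('g, 'i) coset_system \<Rightarrow> ('i \<times> 'g set, 'i) incidence_system" where
  "incidence \<alpha> =
     \<lparr>elements = (SIGMA i:index \<alpha>. lcosets\<^bsub>grp \<alpha>\<^esub> (sub \<alpha> i)),
      types = index \<alpha>,
      type_of = fst,
      incident = (\<lambda>x y. snd x \<inter> snd y \<noteq> {})\<rparr>"

definition coset_geometry :: "('g, 'i) coset_system \<Rightarrow> bool" where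
  "coset_geometry \<alpha> \<longleftrightarrow> coset_incidence_system \<alpha> \<and> geometry (incidence \<alpha>)"

definition left_mult :: "('g, 'i) coset_system \<Rightarrow> 'g \<Rightarrow> 'i \<times> 'g set \<Rightarrow> 'i \<times> 'g set" where
  "left_mult \<alpha> g x = (fst x, g <#\<^bsub>grp \<alpha>\<^esub> snd x)"

definition flag_transitive :: "('g, 'i) coset_system \<Rightarrow> bool" where
  "flag_transitive \<alpha> \<longleftrightarrow>
     (\<forall>J\<subseteq>index \<alpha>. \<forall>F F'.
        flag (incidence \<alpha>) F \<and> flag_type (incidence \<alpha>) F = J \<and>
        flag (incidence \<alpha>) F' \<and> flag_type (incidence \<alpha>) F' = J \<longrightarrow>
        (\<exists>g\<in>carrier (grp \<alpha>). left_mult \<alpha> g ` F = F'))"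

text \<open>Intersecting with the carrier makes the parabolic of the empty set the whole group.\<close>

definition parabolic :: "('g, 'i) coset_system \<Rightarrow> 'i set \<Rightarrow> 'g set" where
  "parabolic \<alpha> J = carrier (grp \<alpha>) \<inter> (\<Inter>j\<in>J. sub \<alpha> j)"


section \<open>Amalgamated products of groups\<close>

text \<open>The amalgamated product of \<open>A\<close> and \<open>B\<close> along \<open>\<phi>\<close>, a map from \<open>C \<subseteq> A\<close> to \<open>B\<close>, consists of
  words over the disjoint union of \<open>A\<close> and \<open>B\<close> modulo the congruence generated by the
  multiplications of \<open>A\<close> and \<open>B\<close> and by \<open>c = \<phi> c\<close> for \<open>c \<in> C\<close>.\<close>

definition amalgam_words :: "'a monoid \<Rightarrow> 'b monoid \<Rightarrow> ('a + 'b) list set" where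
  "amalgam_words A B = lists (carrier A <+> carrier B)"

inductive_set amalgam_rel ::
  "'a monoid \<Rightarrow> 'b monoid \<Rightarrow> 'a set \<Rightarrow> ('a \<Rightarrow> 'b) \<Rightarrow> (('a + 'b) list \<times> ('a + 'b) list) set"
  for A B C \<phi> where
  refl: "w \<in> amalgam_words A B \<Longrightarrow> (w, w) \<in> amalgam_rel A B C \<phi>"
| sym: "(v, w) \<in> amalgam_rel A B C \<phi> \<Longrightarrow> (w, v) \<in> amalgam_rel A B C \<phi>"
| trans: "(u, v) \<in> amalgam_rel A B C \<phi> \<Longrightarrow> (v, w) \<in> amalgam_rel A B C \<phi> \<Longrightarrow>
    (u, w) \<in> amalgam_rel A B C \<phi>"
| append: "(v, v') \<in> amalgam_rel A B C \<phi> \<Longrightarrow> (w, w') \<in> amalgam_rel A B C \<phi> \<Longrightarrow>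
    (v @ w, v' @ w') \<in> amalgam_rel A B C \<phi>"
| one_left: "([Inl \<one>\<^bsub>A\<^esub>], []) \<in> amalgam_rel A B C \<phi>"
| one_right: "([Inr \<one>\<^bsub>B\<^esub>], []) \<in> amalgam_rel A B C \<phi>"
| mult_left: "x \<in> carrier A \<Longrightarrow> y \<in> carrier A \<Longrightarrow>
    ([Inl x, Inl y], [Inl (x \<otimes>\<^bsub>A\<^esub> y)]) \<in> amalgam_rel A B C \<phi>"
| mult_right: "x \<in> carrier B \<Longrightarrow> y \<in> carrier B \<Longrightarrow>
    ([Inr x, Inr y], [Inr (x \<otimes>\<^bsub>B\<^esub> y)]) \<in> amalgam_rel A B C \<phi>"
| amalg: "c \<in> C \<Longrightarrow> ([Inl c], [Inr (\<phi> c)]) \<in> amalgam_rel A B C \<phi>"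

definition amalgamated_product ::
  "'a monoid \<Rightarrow> 'b monoid \<Rightarrow> 'a set \<Rightarrow> ('a \<Rightarrow> 'b) \<Rightarrow> ('a + 'b) list set monoid" where
  "amalgamated_product A B C \<phi> =
     \<lparr>carrier = amalgam_words A B // amalgam_rel A B C \<phi>,
      mult = (\<lambda>X Y. \<Union>v\<in>X. \<Union>w\<in>Y. amalgam_rel A B C \<phi> `` {v @ w}),
      one = amalgam_rel A B C \<phi> `` {[]}\<rparr>"

definition amalgam_left ::
  "'a monoid \<Rightarrow> 'b monoid \<Rightarrow> 'a set \<Rightarrow> ('a \<Rightarrow> 'b) \<Rightarrow> 'a \<Rightarrow> ('a + 'b) list set" where
  "amalgam_left A B C \<phi> a = amalgam_rel A B C \<phi> `` {[Inl a]}"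

definition amalgam_right ::
  "'a monoid \<Rightarrow> 'b monoid \<Rightarrow> 'a set \<Rightarrow> ('a \<Rightarrow> 'b) \<Rightarrow> 'b \<Rightarrow> ('a + 'b) list set" where
  "amalgam_right A B C \<phi> b = amalgam_rel A B C \<phi> `` {[Inr b]}"

lemma amalgam_words_simps [simp]:
  "[] \<in> amalgam_words A B"
  "Inl a # w \<in> amalgam_words A B \<longleftrightarrow> a \<in> carrier A \<and> w \<in> amalgam_words A B"
  "Inr b # w \<in> amalgam_words A B \<longleftrightarrow> b \<in> carrier B \<and> w \<in> amalgam_words A B"
  "v @ w \<in> amalgam_words A B \<longleftrightarrow> v \<in> amalgam_words A B \<and> w \<in> amalgam_words A B"
  by (auto simp: amalgam_words_def)

lemma amalgam_rel_words:
  assumes "group A" "group B" "C \<subseteq> carrier A" "\<phi> ` C \<subseteq> carrier B"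
    and "(v, w) \<in> amalgam_rel A B C \<phi>"
  shows "v \<in> amalgam_words A B \<and> w \<in> amalgam_words A B"
  using assms(5)
proof (induction rule: amalgam_rel.induct)
  case (amalg c)
  then show ?case using assms(3,4) by (auto simp: amalgam_words_def)
qed (use assms(1,2) in \<open>auto simp: amalgam_words_def group.is_monoid monoid.one_closed monoid.m_closed\<close>)

lemma equiv_amalgam_rel:
  assumes "group A" "group B" "C \<subseteq> carrier A" "\<phi> ` C \<subseteq> carrier B"
  shows "equiv (amalgam_words A B) (amalgam_rel A B C \<phi>)"
proof (rule equivI)
  show "amalgam_rel A B C \<phi> \<subseteq> amalgam_words A B \<times> amalgam_words A B"
    using amalgam_rel_words[OF assms] by auto
  show "refl_on (amalgam_words A B) (amalgam_rel A B C \<phi>)"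
    by (auto intro!: refl_onI amalgam_rel.refl)
  show "sym_on UNIV (amalgam_rel A B C \<phi>)"
    by (rule symI) (rule amalgam_rel.sym)
  show "trans_on UNIV (amalgam_rel A B C \<phi>)"
    by (rule transI) (rule amalgam_rel.trans)
qed

lemma amalgamated_product_mult:
  assumes "group A" "group B" "C \<subseteq> carrier A" "\<phi> ` C \<subseteq> carrier B"
    and v: "v \<in> amalgam_words A B" and w: "w \<in> amalgam_words A B"
  shows "amalgam_rel A B C \<phi> `` {v} \<otimes>\<^bsub>amalgamated_product A B C \<phi>\<^esub> amalgam_rel A B C \<phi> `` {w} =
    amalgam_rel A B C \<phi> `` {v @ w}"
proof -
  let ?R = "amalgam_rel A B C \<phi>"
  have eq: "?R `` {v' @ w'} = ?R `` {v @ w}" if "(v, v') \<in> ?R" "(w, w') \<in> ?R" for v' w'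
    by (rule equiv_class_eq[OF equiv_amalgam_rel[OF assms(1-4)]
          amalgam_rel.append[OF that], symmetric])
  have "v \<in> ?R `` {v}" "w \<in> ?R `` {w}"
    using v w by (auto intro: amalgam_rel.refl)
  then have "(\<Union>v'\<in>?R `` {v}. \<Union>w'\<in>?R `` {w}. ?R `` {v' @ w'}) =
      (\<Union>v'\<in>?R `` {v}. \<Union>w'\<in>?R `` {w}. ?R `` {v @ w})"
    by (intro SUP_cong refl eq) simp_all
  also have "\<dots> = ?R `` {v @ w}"
    using \<open>v \<in> ?R `` {v}\<close> \<open>w \<in> ?R `` {w}\<close> by blast
  finally show ?thesis by (simp add: amalgamated_product_def)
qed

lemma group_amalgamated_product:
  assumes "group A" "group B" "C \<subseteq> carrier A" "\<phi> ` C \<subseteq> carrier B"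
  shows "group (amalgamated_product A B C \<phi>)" (is "group ?G")
proof -
  interpret A: group A by fact
  interpret B: group B by fact
  let ?R = "amalgam_rel A B C \<phi>" and ?W = "amalgam_words A B"
  note mult = amalgamated_product_mult[OF assms]
  have one: "\<one>\<^bsub>?G\<^esub> = ?R `` {[]}" and carr: "carrier ?G = ?W // ?R"
    by (simp_all add: amalgamated_product_def)
  have app: "v @ w \<in> ?W" if "v \<in> ?W" "w \<in> ?W" for v w
    using that by (auto simp: amalgam_words_def)
  have nil: "[] \<in> ?W" by (simp add: amalgam_words_def)
  have inv: "\<exists>v\<in>?W. (v @ w, []) \<in> ?R" if "w \<in> ?W" for w
    using that unfolding amalgam_words_def
  proof (induction w rule: lists.induct)
    case Nil
    show ?case using nil by (auto intro!: bexI[of _ "[]"] amalgam_rel.refl simp: amalgam_words_def)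
  next
    case (Cons z w)
    then obtain v where v: "v \<in> ?W" "(v @ w, []) \<in> ?R" and w: "w \<in> ?W"
      by (auto simp: amalgam_words_def)
    obtain z' where z': "[z'] \<in> ?W" "([z', z], []) \<in> ?R"
    proof (cases z)
      case (Inl a)
      then have "a \<in> carrier A" using Cons.hyps by auto
      then have "([Inl (inv\<^bsub>A\<^esub> a), Inl a], []) \<in> ?R"
        using amalgam_rel.mult_left[of "inv\<^bsub>A\<^esub> a" A a] amalgam_rel.one_left
        by (metis A.inv_closed A.l_inv amalgam_rel.trans)
      then show ?thesis
        using that[of "Inl (inv\<^bsub>A\<^esub> a)"] Inl \<open>a \<in> carrier A\<close> by (auto simp: amalgam_words_def)
    next
      case (Inr b)
      then have "b \<in> carrier B" using Cons.hyps by auto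
      then have "([Inr (inv\<^bsub>B\<^esub> b), Inr b], []) \<in> ?R"
        using amalgam_rel.mult_right[of "inv\<^bsub>B\<^esub> b" B b] amalgam_rel.one_right
        by (metis B.inv_closed B.l_inv amalgam_rel.trans)
      then show ?thesis
        using that[of "Inr (inv\<^bsub>B\<^esub> b)"] Inr \<open>b \<in> carrier B\<close> by (auto simp: amalgam_words_def)
    qed
    have "([z', z] @ w, [] @ w) \<in> ?R"
      using amalgam_rel.append[OF z'(2) amalgam_rel.refl[OF w]] .
    then have "(v @ [z', z] @ w, v @ w) \<in> ?R"
      using amalgam_rel.append[OF amalgam_rel.refl[OF v(1)]] by fastforce
    then have "((v @ [z']) @ z # w, []) \<in> ?R"
      using amalgam_rel.trans[OF _ v(2)] by simp
    then show ?case using app[OF v(1) z'(1)] unfolding amalgam_words_def by blast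
  qed
  show ?thesis
  proof (rule groupI)
    show "\<one>\<^bsub>?G\<^esub> \<in> carrier ?G"
      using nil by (simp add: one carr quotientI)
    show "X \<otimes>\<^bsub>?G\<^esub> Y \<in> carrier ?G" if "X \<in> carrier ?G" "Y \<in> carrier ?G" for X Y
      using that unfolding carr by (auto elim!: quotientE simp: mult intro!: quotientI app)
    show "X \<otimes>\<^bsub>?G\<^esub> Y \<otimes>\<^bsub>?G\<^esub> Z = X \<otimes>\<^bsub>?G\<^esub> (Y \<otimes>\<^bsub>?G\<^esub> Z)"
      if "X \<in> carrier ?G" "Y \<in> carrier ?G" "Z \<in> carrier ?G" for X Y Z
      using that unfolding carr by (auto elim!: quotientE simp: mult app)
    show "\<one>\<^bsub>?G\<^esub> \<otimes>\<^bsub>?G\<^esub> X = X" if "X \<in> carrier ?G" for X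
      using that unfolding carr one by (auto elim!: quotientE simp: mult nil)
    show "\<exists>Y\<in>carrier ?G. Y \<otimes>\<^bsub>?G\<^esub> X = \<one>\<^bsub>?G\<^esub>" if X: "X \<in> carrier ?G" for X
    proof -
      obtain w where w: "w \<in> ?W" "X = ?R `` {w}"
        using X unfolding carr quotient_def by blast
      obtain v where v: "v \<in> ?W" "(v @ w, []) \<in> ?R" using inv[OF w(1)] by blast
      have "?R `` {v} \<otimes>\<^bsub>?G\<^esub> X = \<one>\<^bsub>?G\<^esub>"
        using equiv_class_eq[OF equiv_amalgam_rel[OF assms] v(2)] v(1) w by (simp add: mult one)
      then show ?thesis using v(1) by (auto simp: carr intro!: quotientI)
    qed
  qed
qed

lemma amalgam_left_hom:
  assumes "group A" "group B" "C \<subseteq> carrier A" "\<phi> ` C \<subseteq> carrier B"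
  shows "amalgam_left A B C \<phi> \<in> hom A (amalgamated_product A B C \<phi>)"
proof (rule homI)
  fix x y assume "x \<in> carrier A" "y \<in> carrier A"
  then show "amalgam_left A B C \<phi> (x \<otimes>\<^bsub>A\<^esub> y) =
      amalgam_left A B C \<phi> x \<otimes>\<^bsub>amalgamated_product A B C \<phi>\<^esub> amalgam_left A B C \<phi> y"
    using equiv_class_eq[OF equiv_amalgam_rel[OF assms] amalgam_rel.mult_left]
    by (simp add: amalgam_left_def amalgamated_product_mult[OF assms])
qed (auto simp: amalgam_left_def amalgamated_product_def intro!: quotientI)

lemma amalgam_right_hom:
  assumes "group A" "group B" "C \<subseteq> carrier A" "\<phi> ` C \<subseteq> carrier B"
  shows "amalgam_right A B C \<phi> \<in> hom B (amalgamated_product A B C \<phi>)"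
proof (rule homI)
  fix x y assume "x \<in> carrier B" "y \<in> carrier B"
  then show "amalgam_right A B C \<phi> (x \<otimes>\<^bsub>B\<^esub> y) =
      amalgam_right A B C \<phi> x \<otimes>\<^bsub>amalgamated_product A B C \<phi>\<^esub> amalgam_right A B C \<phi> y"
    using equiv_class_eq[OF equiv_amalgam_rel[OF assms] amalgam_rel.mult_right]
    by (simp add: amalgam_right_def amalgamated_product_mult[OF assms])
qed (auto simp: amalgam_right_def amalgamated_product_def intro!: quotientI)

lemma amalgam_left_eq_right:
  assumes "group A" "group B" "C \<subseteq> carrier A" "\<phi> ` C \<subseteq> carrier B" "c \<in> C"
  shows "amalgam_left A B C \<phi> c = amalgam_right A B C \<phi> (\<phi> c)"
  unfolding amalgam_left_def amalgam_right_def
  by (rule equiv_class_eq[OF equiv_amalgam_rel[OF assms(1-4)] amalgam_rel.amalg[OF assms(5)]])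

text \<open>The existence part of the universal property of the pushout.\<close>

lemma amalgamated_product_universal:
  assumes "group A" "group B" "C \<subseteq> carrier A" "\<phi> ` C \<subseteq> carrier B" "group H"
    and f: "f \<in> hom A H" and g: "g \<in> hom B H" and fg: "\<And>c. c \<in> C \<Longrightarrow> f c = g (\<phi> c)"
  shows "\<exists>h\<in>hom (amalgamated_product A B C \<phi>) H.
    (\<forall>a\<in>carrier A. h (amalgam_left A B C \<phi> a) = f a) \<and>
    (\<forall>b\<in>carrier B. h (amalgam_right A B C \<phi> b) = g b)"
proof -
  interpret H: group H by fact
  let ?R = "amalgam_rel A B C \<phi>" and ?W = "amalgam_words A B"
  define ev where "ev w = foldr (\<lambda>z r. case_sum f g z \<otimes>\<^bsub>H\<^esub> r) w \<one>\<^bsub>H\<^esub>" for w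
  have ev_simps: "ev [] = \<one>\<^bsub>H\<^esub>" "ev (z # w) = case_sum f g z \<otimes>\<^bsub>H\<^esub> ev w" for z w
    by (simp_all add: ev_def)
  have letter: "case_sum f g z \<in> carrier H" if "z \<in> carrier A <+> carrier B" for z
    using that f g by (auto simp: hom_def)
  have closed: "ev w \<in> carrier H" if "w \<in> ?W" for w
    using that by (induction w) (auto simp: amalgam_words_def ev_simps intro!: H.m_closed letter)
  have app: "ev (v @ w) = ev v \<otimes>\<^bsub>H\<^esub> ev w" if "v \<in> ?W" "w \<in> ?W" for v w
    using that
  proof (induction v)
    case (Cons z v)
    then have "z \<in> carrier A <+> carrier B" "v \<in> ?W" by (auto simp: amalgam_words_def)
    then show ?case
      using Cons closed letter[of z] by (simp add: ev_simps H.m_assoc)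
  qed (simp add: ev_simps closed)
  have resp: "ev v = ev w" if "(v, w) \<in> ?R" for v w
    using that
  proof (induction rule: amalgam_rel.induct)
    case (append v v' w w')
    then show ?case using app amalgam_rel_words[OF assms(1-4)] by metis
  next
    case one_left
    then show ?case using hom_one[OF f assms(1,5)] by (simp add: ev_simps)
  next
    case one_right
    then show ?case using hom_one[OF g assms(2,5)] by (simp add: ev_simps)
  next
    case (mult_left x y)
    then show ?case using hom_in_carrier[OF f] hom_mult[OF f] by (simp add: ev_simps)
  next
    case (mult_right x y)
    then show ?case using hom_in_carrier[OF g] hom_mult[OF g] by (simp add: ev_simps)
  next
    case (amalg c)
    then show ?case using fg by (simp add: ev_simps)
  qed simp_all
  define h where "h X = ev (SOME w. w \<in> X)" for X
  have h: "h (?R `` {w}) = ev w" if "w \<in> ?W" for w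
  proof -
    have "w \<in> ?R `` {w}" using that by (auto intro: amalgam_rel.refl)
    then have "(SOME v. v \<in> ?R `` {w}) \<in> ?R `` {w}" by (rule someI)
    then show ?thesis using resp unfolding h_def by force
  qed
  have "h \<in> hom (amalgamated_product A B C \<phi>) H"
  proof (rule homI)
    fix X Y assume X: "X \<in> carrier (amalgamated_product A B C \<phi>)"
      and Y: "Y \<in> carrier (amalgamated_product A B C \<phi>)"
    obtain v where v: "v \<in> ?W" "X = ?R `` {v}"
      using X unfolding amalgamated_product_def by (auto simp: quotient_def)
    obtain w where w: "w \<in> ?W" "Y = ?R `` {w}"
      using Y unfolding amalgamated_product_def by (auto simp: quotient_def)
    have "v @ w \<in> ?W" using v(1) w(1) by (auto simp: amalgam_words_def)
    then show "h (X \<otimes>\<^bsub>amalgamated_product A B C \<phi>\<^esub> Y) = h X \<otimes>\<^bsub>H\<^esub> h Y"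
      using v w by (simp add: amalgamated_product_mult[OF assms(1-4)] h app)
    show "h X \<in> carrier H" using v by (simp add: h closed)
  qed
  moreover have "h (amalgam_left A B C \<phi> a) = f a" if "a \<in> carrier A" for a
    using that hom_in_carrier[OF f that]
    by (simp add: amalgam_left_def h ev_simps)
  moreover have "h (amalgam_right A B C \<phi> b) = g b" if "b \<in> carrier B" for b
    using that hom_in_carrier[OF g that]
    by (simp add: amalgam_right_def h ev_simps)
  ultimately show ?thesis by blast
qed

section \<open>Amalgamated products of coset incidence systems\<close>

definition compatible ::
  "('a \<Rightarrow> 'b) \<Rightarrow> ('a, 'i) coset_system \<Rightarrow> ('b, 'i) coset_system \<Rightarrow> bool" where
  "compatible \<phi> \<alpha> \<beta> \<longleftrightarrow> (let L = index \<alpha> \<inter> index \<beta> in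
     \<phi> \<in> iso (grp \<alpha>\<lparr>carrier := parabolic \<alpha> (index \<alpha> - L)\<rparr>)
             (grp \<beta>\<lparr>carrier := parabolic \<beta> (index \<beta> - L)\<rparr>) \<and>
     (\<forall>J\<subseteq>L. \<phi> ` parabolic \<alpha> (index \<alpha> - (L - J)) = parabolic \<beta> (index \<beta> - (L - J))))"

definition amalgam ::
  "('a \<Rightarrow> 'b) \<Rightarrow> ('a, 'i) coset_system \<Rightarrow> ('b, 'i) coset_system \<Rightarrow>
   (('a + 'b) list set, 'i) coset_system" where
  "amalgam \<phi> \<alpha> \<beta> =
     (let L = index \<alpha> \<inter> index \<beta>;
          A = grp \<alpha>; B = grp \<beta>; C = parabolic \<alpha> (index \<alpha> - L);
          G = amalgamated_product A B C \<phi>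
      in \<lparr>grp = G,
          index = index \<alpha> \<union> index \<beta>,
          sub = (\<lambda>i. generate G
            (amalgam_left A B C \<phi> ` parabolic \<alpha> ({i} \<inter> index \<alpha>) \<union>
             amalgam_right A B C \<phi> ` parabolic \<beta> ({i} \<inter> index \<beta>)))\<rparr>)"

end

theory Submission
  imports Defs "HOL-Algebra.Bij"
begin

text \<open>Flags of type \<open>J\<close> are families of pairwise meeting cosets \<open>x\<^sub>j G\<^sub>j\<close>, and those in the orbit of the
  standard flag are the ones with a common point. So flag-transitivity is a Helly property:
  pairwise meeting cosets have a common point. The group \<open>G\<close> is a tree of translates of \<open>A\<close> and \<open>B\<close> glued
  along translates of \<open>C\<close>, and each \<open>G\<^sub>i\<close> meets \<open>A\<close> in \<open>A\<^sub>i\<close> (or \<open>A\<close>) and \<open>B\<close> in \<open>B\<^sub>i\<close> (or \<open>B\<close>). By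
  comparing first syllables of reduced words, a pairwise meeting family of cosets in \<open>G\<close> can be moved
  until all of its members meet one factor; there they still meet pairwise, and the Helly property of the
  factor applies. The same argument shows that the parabolic subgroups of \<open>G\<close> are generated by
  those of \<open>A\<close> and \<open>B\<close>. Conversely, \<open>\<alpha>\<close> is the residue of the standard flag of type
  \<open>I\<^sub>\<beta> - L\<close>, and likewise for \<open>\<beta>\<close>. Residual connectedness means that each
  parabolic of corank at least two is generated by the next smaller ones, and every residue of a flag of corank one is
  already visible in \<open>\<alpha>\<close> or \<open>\<beta>\<close>.\<close>

text \<open>Two cosets with points in one factor may be known to meet only at a distant point of the
  tree, and the Helly property of a factor does not by itself produce points in a prescribed coset
  of \<open>C\<close>, that is, on an edge. Both obstacles are overcome because \<open>C\<close> is
  parabolic in each factor: \<open>u C\<close> is the intersection of the cosets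
  \<open>u (S s i)\<close> with \<open>i\<close> in \<open>M s\<close>, so an edge can be added to a
  family as further cosets. In this way a meeting point is pulled back edge by edge
  (\<open>cosets_meet_C\<close>), and the first syllable is adjusted for several subgroups by one
  common element of \<open>C\<close> (\<open>common_first_syllable\<close>). For the converse, the
  \<open>K i\<close> with \<open>i\<close> in \<open>M (\<not> s)\<close> intersect in
  \<open>V s\<close>, and adding them forces a common point into that factor. Compatibility for a
  single type makes \<open>S True i\<close> and \<open>S False i\<close> agree on \<open>C\<close>,
  so that reducing a word over these subgroups never leaves them.\<close>

section \<open>Amalgamated products and first syllables\<close>

text \<open>Membership of \<open>inv x j \<otimes> g\<close> in \<open>S j\<close> says that
  \<open>g\<close> lies in the left coset of \<open>S j\<close> through \<open>x j\<close>. The set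
  \<open>H\<close> is an argument of its own so that the property of a factor can be expressed with
  the operations of the ambient group.\<close>

definition helly_on ::
  "('g, 'm) monoid_scheme \<Rightarrow> 'g set \<Rightarrow> 'i set \<Rightarrow> ('i \<Rightarrow> 'g set) \<Rightarrow> bool" where
  "helly_on G H I S \<longleftrightarrow> (\<forall>J\<subseteq>I. \<forall>x.
     (\<forall>j\<in>J. x j \<in> H) \<and>
     (\<forall>i\<in>J. \<forall>j\<in>J. \<exists>g\<in>H. inv\<^bsub>G\<^esub> x i \<otimes>\<^bsub>G\<^esub> g \<in> S i \<and> inv\<^bsub>G\<^esub> x j \<otimes>\<^bsub>G\<^esub> g \<in> S j) \<longrightarrow>
     (\<exists>g\<in>H. \<forall>j\<in>J. inv\<^bsub>G\<^esub> x j \<otimes>\<^bsub>G\<^esub> g \<in> S j))"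

lemma helly_onD:
  assumes "helly_on G H I S" and "J \<subseteq> I" and "\<And>j. j \<in> J \<Longrightarrow> x j \<in> H"
    and "\<And>i j. i \<in> J \<Longrightarrow> j \<in> J \<Longrightarrow> i \<noteq> j \<Longrightarrow>
      \<exists>g\<in>H. inv\<^bsub>G\<^esub> x i \<otimes>\<^bsub>G\<^esub> g \<in> S i \<and> inv\<^bsub>G\<^esub> x j \<otimes>\<^bsub>G\<^esub> g \<in> S j"
    and "\<And>i. i \<in> J \<Longrightarrow> \<exists>g\<in>H. inv\<^bsub>G\<^esub> x i \<otimes>\<^bsub>G\<^esub> g \<in> S i"
  obtains g where "g \<in> H" "\<And>j. j \<in> J \<Longrightarrow> inv\<^bsub>G\<^esub> x j \<otimes>\<^bsub>G\<^esub> g \<in> S j"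
proof -
  have "\<exists>g\<in>H. inv\<^bsub>G\<^esub> x i \<otimes>\<^bsub>G\<^esub> g \<in> S i \<and> inv\<^bsub>G\<^esub> x j \<otimes>\<^bsub>G\<^esub> g \<in> S j" if "i \<in> J" "j \<in> J" for i j
    using assms(4,5) that by (cases "i = j") auto
  then have "\<exists>g\<in>H. \<forall>j\<in>J. inv\<^bsub>G\<^esub> x j \<otimes>\<^bsub>G\<^esub> g \<in> S j"
    using assms(1)[unfolded helly_on_def, rule_format, of J x] assms(2,3) by simp
  then show ?thesis
    using that by blast
qed

context group
begin

lemma inv_mult_cancel:
  "x \<in> carrier G \<Longrightarrow> y \<in> carrier G \<Longrightarrow> inv x \<otimes> (x \<otimes> y) = y"
  by (simp flip: m_assoc)

lemma mult_inv_cancel: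
  "x \<in> carrier G \<Longrightarrow> y \<in> carrier G \<Longrightarrow> x \<otimes> (inv x \<otimes> y) = y"
  by (simp flip: m_assoc)

lemmas group_normalize = m_assoc inv_mult_group inv_mult_cancel mult_inv_cancel

text \<open>For subgroups \<open>U True\<close> and \<open>U False\<close> meeting in \<open>C\<close>, \<open>tail C U s\<close> consists of the products
  of reduced words over them that do not begin with a syllable from \<open>U s\<close>.\<close>

inductive tail :: "'a set \<Rightarrow> (bool \<Rightarrow> 'a set) \<Rightarrow> bool \<Rightarrow> 'a \<Rightarrow> bool" for C U where
  core: "c \<in> U s \<Longrightarrow> c \<in> C \<Longrightarrow> tail C U s c"
| syllable: "x \<in> U (\<not> s) \<Longrightarrow> x \<notin> C \<Longrightarrow> tail C U (\<not> s) y \<Longrightarrow> tail C U s (x \<otimes> y)"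

lemma tail_in_carrier:
  assumes "tail C U s y" and "\<And>t. U t \<subseteq> carrier G"
  shows "y \<in> carrier G"
  using assms(1) by induction (use assms(2) in auto)

lemma tail_mono:
  assumes "tail C U s y" and "\<And>t. U t \<subseteq> V t"
  shows "tail C V s y"
  using assms(1) by induction (use assms(2) in \<open>auto intro: tail.intros\<close>)

text \<open>If \<open>x\<close> lies outside \<open>C\<close>, the product is itself a tail for the
  other side and \<open>x'\<close> is \<open>\<one>\<close>. If \<open>x\<close> lies in
  \<open>C\<close>, it belongs to both subgroups and is absorbed into the next syllable of
  \<open>y\<close>, if there is one.\<close>

lemma syllable_tail_other_side:
  assumes U: "\<And>t. subgroup (U t) G" and UC: "U s \<inter> C = U (\<not> s) \<inter> C"
    and x: "x \<in> U s" and y: "tail C U s y"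
  shows "\<exists>x'\<in>U (\<not> s). \<exists>y'. tail C U (\<not> s) y' \<and> x \<otimes> y = x' \<otimes> y'"
proof -
  have sub: "U t \<subseteq> carrier G" for t using U subgroup.subset by blast
  have xc: "x \<in> carrier G" and yc: "y \<in> carrier G"
    using x sub tail_in_carrier[OF y sub] by auto
  show ?thesis
  proof (cases "x \<in> C")
    case False
    then have "tail C U (\<not> s) (x \<otimes> y)" using syllable[of x U "\<not> s"] x y by simp
    then show ?thesis
      using subgroup.one_closed[OF U] xc yc by (metis l_one m_closed)
  next
    case True
    then have x': "x \<in> U (\<not> s)" using x UC by auto
    from y show ?thesis
    proof cases
      case core
      then show ?thesis using x' UC tail.core[of y U "\<not> s"] by blast
    next
      case (syllable p q)
      have "q \<in> carrier G" using tail_in_carrier[OF syllable(4) sub] .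
      moreover have "p \<in> carrier G" using syllable sub by blast
      ultimately have "x \<otimes> y = (x \<otimes> p) \<otimes> q" using xc syllable(1) by (simp add: m_assoc)
      moreover have "x \<otimes> p \<in> U (\<not> s)" using x' syllable subgroup.m_closed[OF U] by blast
      ultimately show ?thesis using syllable(4) by blast
    qed
  qed
qed

text \<open>By the previous lemma the set \<open>R t\<close> of such products is the same for both
  sides. So it is stable under left multiplication by \<open>U True\<close> and by
  \<open>U False\<close>, and it contains \<open>\<one>\<close>.\<close>

lemma generate_first_syllable:
  assumes U: "\<And>t. subgroup (U t) G" and UC: "U True \<inter> C = U False \<inter> C"
    and one: "\<one> \<in> C" and g: "g \<in> generate G (U True \<union> U False)"
  obtains x y where "x \<in> U s" "tail C U s y" "g = x \<otimes> y"
proof -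
  define R where "R t = {x \<otimes> y | x y. x \<in> U t \<and> tail C U t y}" for t
  have sub: "U t \<subseteq> carrier G" for t using U subgroup.subset by blast
  have UC': "U t \<inter> C = U (\<not> t) \<inter> C" for t using UC by (cases t) auto
  have le: "R t \<subseteq> R (\<not> t)" for t
  proof
    fix z assume "z \<in> R t"
    then obtain x y where xy: "x \<in> U t" "tail C U t y" "z = x \<otimes> y"
      unfolding R_def by blast
    show "z \<in> R (\<not> t)"
      using syllable_tail_other_side[of U t C x y, OF U UC' xy(1,2)] xy(3)
      unfolding R_def by blast
  qed
  have R_eq: "R t = R t'" for t t' using le[of True] le[of False] by (cases t; cases t') auto
  have R_carrier: "z \<in> carrier G" if "z \<in> R t" for z t
    using that unfolding R_def using sub tail_in_carrier[of C U t, OF _ sub] by blast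
  have R_mult: "u \<otimes> z \<in> R t" if u: "u \<in> U t'" and z: "z \<in> R t" for u z t t'
  proof -
    obtain x y where xy: "x \<in> U t'" "tail C U t' y" "z = x \<otimes> y"
      using z unfolding R_eq[of t t'] unfolding R_def by blast
    have "u \<in> carrier G" "x \<in> carrier G" "y \<in> carrier G"
      using xy sub u tail_in_carrier[OF xy(2) sub] by blast+
    then have "u \<otimes> z = (u \<otimes> x) \<otimes> y"
      using xy(3) by (simp add: m_assoc)
    then have "u \<otimes> z \<in> R t'"
      unfolding R_def using xy u subgroup.m_closed[OF U] by blast
    then show ?thesis using R_eq by blast
  qed
  \<comment> \<open>Stability of \<open>R s\<close> under \<open>g\<close> composes along products,
    unlike membership of \<open>g\<close> in \<open>R s\<close>, which is the case
    \<open>z = \<one>\<close>.\<close>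
  have "\<forall>z\<in>R s. g \<otimes> z \<in> R s"
    using g
  proof induction
    case one
    then show ?case using R_carrier by auto
  next
    case (incl h)
    then show ?case using R_mult by blast
  next
    case (inv h)
    then have "inv h \<in> U True \<or> inv h \<in> U False" using U by (auto intro: subgroup.m_inv_closed)
    then show ?case using R_mult by blast
  next
    case (eng h1 h2)
    have "U True \<union> U False \<subseteq> carrier G" using sub by blast
    then have "h1 \<in> carrier G" "h2 \<in> carrier G"
      using eng generate_in_carrier by blast+
    then show ?case using eng R_carrier[of _ s] by (auto simp: m_assoc)
  qed
  moreover have "\<one> \<in> R s"
  proof -
    have "\<one> \<in> U s" using subgroup.one_closed[OF U] .
    then show ?thesis unfolding R_def using tail.core[of \<one> U s C] one by force
  qed
  moreover have "g \<in> carrier G"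
    using g generate_in_carrier[of "U True \<union> U False"] sub by blast
  ultimately have "g \<in> R s" by force
  then show ?thesis unfolding R_def using that by blast
qed

end

text \<open>The last assumption is the normal form theorem: no element has reduced words
  beginning on both sides.\<close>

locale amalgamated_group = group G for G (structure) +
  fixes V :: "bool \<Rightarrow> 'a set" and C :: "'a set"
  assumes V_subgroup: "subgroup (V s) G"
    and V_Int: "V True \<inter> V False = C"
    and carrier_generated: "carrier G = generate G (V True \<union> V False)"
    and normal_form: "x \<in> V s \<Longrightarrow> x \<notin> C \<Longrightarrow> tail C V s y \<Longrightarrow> \<not> tail C V s (x \<otimes> y)"
begin

lemma C_subset: "C \<subseteq> V s"
  using V_Int by (cases s) auto

lemma V_carrier: "V s \<subseteq> carrier G"
  using V_subgroup subgroup.subset by blast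

lemma V_inG: "x \<in> V s \<Longrightarrow> x \<in> carrier G"
  using V_carrier by blast

lemma C_subgroup: "subgroup C G"
  using subgroups_Inter_pair[OF V_subgroup V_subgroup, of True False] V_Int by simp

lemma C_inG: "x \<in> C \<Longrightarrow> x \<in> carrier G"
  using C_subgroup subgroup.subset by blast

lemma C_inV: "x \<in> C \<Longrightarrow> x \<in> V s"
  using C_subset by blast

lemmas V_closed [simp] =
  subgroup.one_closed[OF V_subgroup] subgroup.m_closed[OF V_subgroup]
  subgroup.m_inv_closed[OF V_subgroup]

lemmas C_closed [simp] =
  subgroup.one_closed[OF C_subgroup] subgroup.m_closed[OF C_subgroup]
  subgroup.m_inv_closed[OF C_subgroup]

lemma tail_inG: "tail C V s y \<Longrightarrow> y \<in> carrier G"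
  using tail_in_carrier V_carrier by blast

lemma tail_C: "c \<in> C \<Longrightarrow> tail C V s c"
  using C_subset by (auto intro: tail.core)

text \<open>Otherwise \<open>y\<close>, written as \<open>y \<otimes> \<one>\<close>, would begin
  with a syllable of \<open>V s\<close>, contrary to the normal form theorem.\<close>

lemma tail_VD:
  assumes "tail C V s y" and "y \<in> V s"
  shows "y \<in> C"
  using normal_form[OF assms(2) _ tail_C[of \<one>]] assms tail_inG[OF assms(1)] by auto

lemma first_syllable:
  assumes "g \<in> carrier G"
  obtains x y where "x \<in> V s" "tail C V s y" "g = x \<otimes> y"
proof -
  have "V True \<inter> C = V False \<inter> C" using C_subset by blast
  then show ?thesis
    using generate_first_syllable[of V C g s, OF V_subgroup] that assms carrier_generated by auto
qed

text \<open>The tail \<open>y\<close> equals \<open>(inv x \<otimes> x') \<otimes> y'\<close>; with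
  a first factor outside \<open>C\<close> it would begin on side \<open>s\<close>.\<close>

lemma first_syllable_unique:
  assumes x: "x \<in> V s" "x' \<in> V s" and y: "tail C V s y" "tail C V s y'" and eq: "x \<otimes> y = x' \<otimes> y'"
  shows "inv x \<otimes> x' \<in> C"
proof (rule ccontr)
  assume *: "inv x \<otimes> x' \<notin> C"
  have carr: "x \<in> carrier G" "x' \<in> carrier G" "y \<in> carrier G" "y' \<in> carrier G"
    using V_inG[OF x(1)] V_inG[OF x(2)] tail_inG[OF y(1)] tail_inG[OF y(2)] by auto
  then have "y = inv x \<otimes> (x \<otimes> y)" by (simp add: inv_mult_cancel)
  then have "y = inv x \<otimes> x' \<otimes> y'" using carr eq by (simp add: m_assoc)
  then show False
    using normal_form[OF _ * y(2)] x y(1) by simp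
qed

text \<open>A reduced word over the subgroups \<open>U\<close> is also reduced over the factors.
  Hence the rest of \<open>c\<close> after its first syllable in \<open>U s\<close> lies in
  \<open>C\<close>; the normal form theorem excludes further syllables in it, and a rest without
  syllables lies in \<open>U s\<close>.\<close>

lemma generate_Int_V:
  assumes U: "\<And>t. subgroup (U t) G" "\<And>t. U t \<subseteq> V t" "U True \<inter> C = U False \<inter> C"
    and c: "c \<in> generate G (U True \<union> U False)" "c \<in> V s"
  shows "c \<in> U s"
proof -
  obtain x y where xy: "x \<in> U s" "tail C U s y" "c = x \<otimes> y"
    using generate_first_syllable[of U C c s, OF U(1,3) _ c(1)] C_closed by blast
  have yV: "tail C V s y" using tail_mono[OF xy(2) U(2)] .
  have xV: "x \<in> V s" using xy(1) U(2) by blast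
  have "y = inv x \<otimes> c"
    using xy(3) V_inG[OF xV] tail_inG[OF yV] by (simp add: inv_mult_cancel)
  then have "y \<in> C" using tail_VD[OF yV] xV c(2) by simp
  from xy(2) have "y \<in> U s"
  proof cases
    case (syllable p q)
    have "\<not> tail C V (\<not> s) (p \<otimes> q)"
      using normal_form[OF subsetD[OF U(2)[of "\<not> s"] syllable(2)] syllable(3)
        tail_mono[OF syllable(4) U(2)]] .
    then show ?thesis using tail_C[OF \<open>y \<in> C\<close>, of "\<not> s"] syllable(1) by simp
  qed
  then show ?thesis using subgroup.m_closed[OF U(1) xy(1)] xy(3) by simp
qed

end

section \<open>Families of subgroups of an amalgamated product\<close>

text \<open>\<open>S s i\<close> is the whole factor \<open>V s\<close> if \<open>i\<close> is not a type of the system on side \<open>s\<close>, and \<open>M s\<close> is the set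
  of the types occurring on side \<open>s\<close> only.\<close>

locale amalgamated_family = amalgamated_group +
  fixes I :: "'i set" and S :: "bool \<Rightarrow> 'i \<Rightarrow> 'a set" and M :: "bool \<Rightarrow> 'i set"
  assumes S_subgroup: "i \<in> I \<Longrightarrow> subgroup (S s i) G"
    and S_le_V: "i \<in> I \<Longrightarrow> S s i \<subseteq> V s"
    and S_Int_C: "i \<in> I \<Longrightarrow> S True i \<inter> C = S False i \<inter> C"
    and M_subset: "M s \<subseteq> I"
    and M_other_side: "i \<in> M s \<Longrightarrow> S (\<not> s) i = V (\<not> s)"
    and C_eq: "V s \<inter> (\<Inter>i\<in>M s. S s i) = C"
begin

definition K :: "'i \<Rightarrow> 'a set" where
  "K i = generate G (S True i \<union> S False i)"

lemma S_carrier: "i \<in> I \<Longrightarrow> S s i \<subseteq> carrier G"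
  using S_subgroup subgroup.subset by blast

lemma K_subgroup: "i \<in> I \<Longrightarrow> subgroup (K i) G"
  unfolding K_def using S_carrier by (intro generate_is_subgroup) blast

lemma K_inG: "i \<in> I \<Longrightarrow> x \<in> K i \<Longrightarrow> x \<in> carrier G"
  using K_subgroup subgroup.subset by blast

lemma S_le_K: "S s i \<subseteq> K i"
  unfolding K_def by (cases s) (auto intro: generate.incl)

lemmas S_closed =
  subgroup.one_closed[OF S_subgroup] subgroup.m_closed[OF S_subgroup]
  subgroup.m_inv_closed[OF S_subgroup]

lemmas K_closed =
  subgroup.one_closed[OF K_subgroup] subgroup.m_closed[OF K_subgroup]
  subgroup.m_inv_closed[OF K_subgroup]

lemma K_Int_V: "i \<in> I \<Longrightarrow> g \<in> K i \<Longrightarrow> g \<in> V s \<Longrightarrow> g \<in> S s i"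
  using generate_Int_V[of "\<lambda>s. S s i"] S_subgroup S_le_V S_Int_C unfolding K_def by blast

lemma C_le_S: "i \<in> M s \<Longrightarrow> C \<subseteq> S s i"
  using C_eq by blast

lemma V_le_K: "i \<in> M (\<not> s) \<Longrightarrow> V s \<subseteq> K i"
  using M_other_side[of i "\<not> s"] S_le_K[of s i] by simp

text \<open>Elements of \<open>K i\<close> have a first syllable in \<open>S s i\<close>, and first
  syllables are unique up to right multiplication by \<open>C\<close>. This is how membership in
  \<open>K i\<close> is passed down to a factor.\<close>

lemma K_first_syllable:
  assumes i: "i \<in> I" and g: "x \<otimes> y \<in> K i" and x: "x \<in> V s" and y: "tail C V s y"
  obtains c where "c \<in> C" "x \<otimes> c \<in> S s i"
proof -
  obtain x' y' where xy: "x' \<in> S s i" "tail C (\<lambda>s. S s i) s y'" "x \<otimes> y = x' \<otimes> y'"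
    using generate_first_syllable[of "\<lambda>s. S s i" C "x \<otimes> y" s] S_subgroup[OF i] S_Int_C[OF i]
      C_closed(1) g unfolding K_def by blast
  have x': "x' \<in> V s" using xy(1) S_le_V[OF i] by blast
  have "tail C V s y'" using tail_mono[OF xy(2)] S_le_V[OF i] by blast
  then have "inv x \<otimes> x' \<in> C" using first_syllable_unique[OF x x' y _ xy(3)] by blast
  moreover have "x \<otimes> (inv x \<otimes> x') = x'" using V_inG[OF x] V_inG[OF x'] by (simp add: mult_inv_cancel)
  ultimately show ?thesis using that xy(1) by metis
qed

text \<open>Split off the first syllable from \<open>V s\<close>, which lies in every such
  \<open>K i\<close>. A next syllable would lie in \<open>S (\<not> s) i\<close> for all
  \<open>i\<close> in \<open>M (\<not> s)\<close>, because these subgroups contain \<open>C\<close>,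
  and hence in \<open>C\<close> itself.\<close>

lemma Inter_K:
  assumes g: "g \<in> carrier G" and gK: "\<And>i. i \<in> M (\<not> s) \<Longrightarrow> g \<in> K i"
  shows "g \<in> V s"
proof -
  obtain x y where xy: "x \<in> V s" "tail C V s y" "g = x \<otimes> y"
    using first_syllable[OF g] .
  from xy(2) show ?thesis
  proof cases
    case core
    then show ?thesis using xy by simp
  next
    case (syllable p q)
    have "p \<in> S (\<not> s) i" if i: "i \<in> M (\<not> s)" for i
    proof -
      have iI: "i \<in> I" using M_subset i by blast
      have "inv x \<otimes> g \<in> K i"
        using K_closed(2)[OF iI K_closed(3)[OF iI subsetD[OF V_le_K[OF i] xy(1)]] gK[OF i]] .
      then have "p \<otimes> q \<in> K i"
        using xy V_inG[OF xy(1)] tail_inG[OF xy(2)] syllable(1) by (simp add: inv_mult_cancel)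
      then obtain c where c: "c \<in> C" "p \<otimes> c \<in> S (\<not> s) i"
        using K_first_syllable[OF iI _ syllable(2,4)] by blast
      have "(p \<otimes> c) \<otimes> inv c \<in> S (\<not> s) i"
        using S_closed(2)[OF iI c(2) S_closed(3)[OF iI subsetD[OF C_le_S[OF i] c(1)]]] .
      then show ?thesis
        using V_inG[OF syllable(2)] C_inG[OF c(1)] by (simp add: m_assoc)
    qed
    then have "p \<in> C" using C_eq[of "\<not> s"] syllable(2) by blast
    then show ?thesis using syllable(3) by simp
  qed
qed

lemma parabolic_in_factor:
  assumes J: "M (\<not> s) \<subseteq> J" "J \<subseteq> I"
  shows "{g \<in> carrier G. \<forall>j\<in>J. g \<in> K j} = {v \<in> V s. \<forall>j\<in>J. v \<in> S s j}"
proof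
  show "{g \<in> carrier G. \<forall>j\<in>J. g \<in> K j} \<subseteq> {v \<in> V s. \<forall>j\<in>J. v \<in> S s j}"
  proof
    fix g assume g: "g \<in> {g \<in> carrier G. \<forall>j\<in>J. g \<in> K j}"
    then have gV: "g \<in> V s" using Inter_K[of g s] J(1) by blast
    have "g \<in> S s j" if "j \<in> J" for j using K_Int_V[OF _ _ gV, of j] g J(2) that by blast
    then show "g \<in> {v \<in> V s. \<forall>j\<in>J. v \<in> S s j}" using gV by blast
  qed
  show "{v \<in> V s. \<forall>j\<in>J. v \<in> S s j} \<subseteq> {g \<in> carrier G. \<forall>j\<in>J. g \<in> K j}"
    using V_inG S_le_K by blast
qed

text \<open>The family is enlarged by the subgroups \<open>K i\<close> with \<open>i\<close> in
  \<open>M (\<not> s)\<close>. They contain \<open>V s\<close>, so all pairs still meet, and a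
  common point of the enlarged family lies in their intersection \<open>V s\<close>.\<close>

lemma helly_factor:
  assumes H: "helly_on G (carrier G) I K"
  shows "helly_on G (V s) I (S s)"
  unfolding helly_on_def
proof (intro allI impI, elim conjE)
  fix J x
  assume J: "J \<subseteq> I" and x: "\<forall>j\<in>J. x j \<in> V s"
    and meet: "\<forall>i\<in>J. \<forall>j\<in>J. \<exists>g\<in>V s. inv x i \<otimes> g \<in> S s i \<and> inv x j \<otimes> g \<in> S s j"
  let ?N = "M (\<not> s)"
  \<comment> \<open>For types in both \<open>J\<close> and \<open>?N\<close> the given
    representative is overwritten; this is harmless since \<open>S s i\<close> is all of
    \<open>V s\<close> there.\<close>
  define x' where "x' i = (if i \<in> ?N then \<one> else x i)" for i
  have N: "inv y \<otimes> z \<in> K i" if "i \<in> ?N" "y \<in> V s" "z \<in> V s" for i y z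
    using V_le_K[OF that(1)] that(2,3) by auto
  have x': "x' i \<in> V s" if "i \<in> J \<union> ?N" for i
    using that x by (auto simp: x'_def)
  have pair: "\<exists>g\<in>carrier G. inv x' i \<otimes> g \<in> K i \<and> inv x' j \<otimes> g \<in> K j"
    if ij: "i \<in> J \<union> ?N" "j \<in> J \<union> ?N" for i j
  proof -
    have single: "\<exists>g\<in>V s. (i \<in> ?N \<or> inv x i \<otimes> g \<in> S s i) \<and> (j \<in> ?N \<or> inv x j \<otimes> g \<in> S s j)"
      using ij meet V_closed(1) by (metis UnE)
    then obtain g where g: "g \<in> V s" "i \<in> ?N \<or> inv x i \<otimes> g \<in> S s i"
      "j \<in> ?N \<or> inv x j \<otimes> g \<in> S s j" by blast
    have "inv x' k \<otimes> g \<in> K k" if "k \<in> ?N \<or> inv x k \<otimes> g \<in> S s k" for k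
      using that N[of k \<one> g] g(1) S_le_K by (auto simp: x'_def)
    then show ?thesis using g V_inG by blast
  qed
  obtain g where g: "g \<in> carrier G" "\<And>j. j \<in> J \<union> ?N \<Longrightarrow> inv x' j \<otimes> g \<in> K j"
    using helly_onD[OF H, of "J \<union> ?N" x'] J M_subset x' pair V_inG by (metis Un_least)
  have "g \<in> K i" if "i \<in> ?N" for i
    using g(2)[of i] g(1) that by (simp add: x'_def)
  then have gV: "g \<in> V s" using Inter_K g(1) by blast
  have "inv x j \<otimes> g \<in> S s j" if j: "j \<in> J" for j
  proof (cases "j \<in> ?N")
    case True
    then show ?thesis using M_other_side[OF True] x j gV by simp
  next
    case False
    then have "inv x j \<otimes> g \<in> K j" using g(2)[of j] j by (simp add: x'_def)
    then show ?thesis using K_Int_V[of j _ s] J j x gV by auto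
  qed
  then show "\<exists>g\<in>V s. \<forall>j\<in>J. inv x j \<otimes> g \<in> S s j" using gV by blast
qed

end

section \<open>The Helly property passes from the factors to the amalgamated product\<close>

locale helly_amalgamated_family = amalgamated_family +
  assumes helly: "helly_on G (V s) I (S s)"
begin

text \<open>Within \<open>V s\<close> the cosets of \<open>S s i\<close> through \<open>u\<close>,
  for \<open>i\<close> in \<open>M s\<close>, intersect in \<open>u C\<close>. Each given coset
  meets \<open>u C\<close>, so it meets all of them, and the Helly property applies to the enlarged
  family.\<close>

lemma helly_in_coset_of_C:
  assumes J: "J \<subseteq> I" and x: "\<And>j. j \<in> J \<Longrightarrow> x j \<in> V s"
    and meet: "\<And>i j. i \<in> J \<Longrightarrow> j \<in> J \<Longrightarrow> i \<noteq> j \<Longrightarrow>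
      \<exists>g\<in>V s. inv x i \<otimes> g \<in> S s i \<and> inv x j \<otimes> g \<in> S s j"
    and u: "u \<in> V s" and uC: "\<And>j. j \<in> J \<Longrightarrow> \<exists>c\<in>C. inv x j \<otimes> (u \<otimes> c) \<in> S s j"
  obtains c where "c \<in> C" "\<And>j. j \<in> J \<Longrightarrow> inv x j \<otimes> (u \<otimes> c) \<in> S s j"
proof -
  \<comment> \<open>For a type in both \<open>J\<close> and \<open>M s\<close> the coset through
    \<open>x i\<close> is kept; it meets \<open>u C\<close> and its subgroup contains
    \<open>C\<close>, so it is the coset through \<open>u\<close>.\<close>
  define x' where "x' i = (if i \<in> J then x i else u)" for i
  have x': "x' i \<in> V s" for i using x u by (simp add: x'_def)
  have uC': "\<exists>c\<in>C. inv x' j \<otimes> (u \<otimes> c) \<in> S s j" if j: "j \<in> J \<union> M s" for j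
  proof (cases "j \<in> J")
    case True
    then show ?thesis using uC by (simp add: x'_def)
  next
    case False
    then have "\<one> \<in> S s j" using j C_le_S[of j s] C_closed(1) by blast
    then have "inv u \<otimes> (u \<otimes> \<one>) \<in> S s j" using V_inG[OF u] by simp
    then show ?thesis using False C_closed(1) by (auto simp: x'_def)
  qed
  have uC_V: "u \<otimes> c \<in> V s" if "c \<in> C" for c
    using that u C_inV by simp
  have pair: "\<exists>g\<in>V s. inv x' i \<otimes> g \<in> S s i \<and> inv x' j \<otimes> g \<in> S s j"
    if ij: "i \<in> J \<union> M s" "j \<in> J \<union> M s" "i \<noteq> j" for i j
  proof -
    have out: "inv x' k \<otimes> (u \<otimes> c) \<in> S s k" if "k \<notin> J" "k \<in> J \<union> M s" "c \<in> C" for k c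
      using that C_le_S[of k s] V_inG[OF u] C_inG[OF that(3)]
      by (auto simp: x'_def inv_mult_cancel)
    consider "i \<in> J" "j \<in> J" | "i \<notin> J" | "j \<notin> J" by blast
    then show ?thesis
    proof cases
      case 1
      then show ?thesis using meet ij(3) by (simp add: x'_def)
    next
      case 2
      then show ?thesis using uC'[OF ij(2)] out[OF 2 ij(1)] uC_V by blast
    next
      case 3
      then show ?thesis using uC'[OF ij(1)] out[OF 3 ij(2)] uC_V by blast
    qed
  qed
  have "J \<union> M s \<subseteq> I" using J M_subset by blast
  then obtain g where g: "g \<in> V s" "\<And>j. j \<in> J \<union> M s \<Longrightarrow> inv x' j \<otimes> g \<in> S s j"
    using helly_onD[OF helly, of "J \<union> M s" x' s] x' pair uC' uC_V by metis
  have carr: "g \<in> carrier G" "u \<in> carrier G" using g u V_inG by auto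
  have "inv u \<otimes> g \<in> S s i" if i: "i \<in> M s" for i
  proof -
    have iI: "i \<in> I" using M_subset i by blast
    obtain c where c: "c \<in> C" "inv x' i \<otimes> (u \<otimes> c) \<in> S s i" using uC' i by blast
    have "c \<otimes> (inv (inv x' i \<otimes> (u \<otimes> c)) \<otimes> (inv x' i \<otimes> g)) \<in> S s i"
      using S_closed(2)[OF iI subsetD[OF C_le_S[OF i] c(1)]
          S_closed(2)[OF iI S_closed(3)[OF iI c(2)] g(2)]] i by simp
    then show ?thesis
      using carr V_inG[OF x'[of i]] C_inG[OF c(1)] by (simp add: group_normalize)
  qed
  then have "inv u \<otimes> g \<in> C" using C_eq[of s] u g(1) by auto
  moreover have "inv x j \<otimes> (u \<otimes> (inv u \<otimes> g)) \<in> S s j" if "j \<in> J" for j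
    using g(2)[of j] that carr by (simp add: x'_def mult_inv_cancel)
  ultimately show ?thesis using that by blast
qed

text \<open>The argument shared by \<open>cosets_meet_C\<close> and
  \<open>cosets_meet_factor\<close>: the hypothesis \<open>step\<close> replaces the tail
  \<open>v\<close> of a common point \<open>u \<otimes> v\<close> by an element \<open>f\<close> of
  \<open>C\<close>, which leaves the point \<open>u \<otimes> f\<close> of the factor.\<close>

lemma cosets_meet_factor_aux:
  assumes ij: "i \<in> I" "j \<in> I"
    and step: "\<And>c d. \<lbrakk>c \<in> C; d \<in> C; inv c \<otimes> v \<in> K i; inv d \<otimes> v \<in> K j\<rbrakk> \<Longrightarrow>
      \<exists>f\<in>C. inv c \<otimes> f \<in> K i \<and> inv d \<otimes> f \<in> K j"
    and u: "u \<in> V s" and v: "tail C V s v" and x: "x \<in> V s" "x' \<in> V s"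
    and g: "inv x \<otimes> (u \<otimes> v) \<in> K i" "inv x' \<otimes> (u \<otimes> v) \<in> K j"
  shows "\<exists>a\<in>V s. inv x \<otimes> a \<in> S s i \<and> inv x' \<otimes> a \<in> S s j"
proof -
  have carr: "u \<in> carrier G" "v \<in> carrier G" "x \<in> carrier G" "x' \<in> carrier G"
    using u v x V_inG tail_inG by auto
  \<comment> \<open>By comparison of first syllables, the coset of \<open>K k\<close> through
    \<open>y\<close> contains some \<open>u \<otimes> c\<close> with \<open>c\<close> in
    \<open>C\<close>; dividing by \<open>u\<close> leaves the coset through \<open>c\<close>, which
    contains \<open>v\<close>.\<close>
  have push: "\<exists>c\<in>C. inv y \<otimes> (u \<otimes> c) \<in> S s k \<and> inv c \<otimes> v \<in> K k"
    if k: "k \<in> I" and y: "y \<in> V s" "inv y \<otimes> (u \<otimes> v) \<in> K k" for k y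
  proof -
    have yG: "y \<in> carrier G" using y V_inG by blast
    have "(inv y \<otimes> u) \<otimes> v \<in> K k" using y carr yG by (simp add: m_assoc)
    then obtain c where c: "c \<in> C" "inv y \<otimes> u \<otimes> c \<in> S s k"
      using K_first_syllable[OF k _ _ v] y(1) u by (metis V_closed(2,3))
    have "inv (inv y \<otimes> u \<otimes> c) \<otimes> (inv y \<otimes> (u \<otimes> v)) \<in> K k"
      using K_closed(2)[OF k K_closed(3)[OF k subsetD[OF S_le_K c(2)]] y(2)] .
    then have "inv c \<otimes> v \<in> K k"
      using carr yG C_inG[OF c(1)] by (simp add: group_normalize)
    moreover have "inv y \<otimes> (u \<otimes> c) \<in> S s k" using c carr yG C_inG[OF c(1)] by (simp add: m_assoc)
    ultimately show ?thesis using c(1) by blast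
  qed
  obtain c where c: "c \<in> C" "inv x \<otimes> (u \<otimes> c) \<in> S s i" "inv c \<otimes> v \<in> K i"
    using push[OF ij(1) x(1) g(1)] by blast
  obtain d where d: "d \<in> C" "inv x' \<otimes> (u \<otimes> d) \<in> S s j" "inv d \<otimes> v \<in> K j"
    using push[OF ij(2) x(2) g(2)] by blast
  obtain f where f: "f \<in> C" "inv c \<otimes> f \<in> K i" "inv d \<otimes> f \<in> K j"
    using step[OF c(1) d(1) c(3) d(3)] by blast
  have pull: "inv y \<otimes> (u \<otimes> f) \<in> S s k"
    if k: "k \<in> I" and y: "y \<in> V s" "inv y \<otimes> (u \<otimes> e) \<in> S s k" and e: "e \<in> C" "inv e \<otimes> f \<in> K k"
    for k y e
  proof -
    have "(inv y \<otimes> (u \<otimes> e)) \<otimes> (inv e \<otimes> f) \<in> K k"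
      using K_closed(2)[OF k subsetD[OF S_le_K y(2)] e(2)] .
    then have "inv y \<otimes> (u \<otimes> f) \<in> K k"
      using carr V_inG[OF y(1)] C_inG[OF e(1)] C_inG[OF f(1)] by (simp add: group_normalize)
    then show ?thesis using K_Int_V[OF k] y(1) u C_inV[OF f(1)] by simp
  qed
  have "u \<otimes> f \<in> V s" using u C_inV[OF f(1)] by simp
  then show ?thesis
    using pull[OF ij(1) x(1) c(2,1) f(2)] pull[OF ij(2) x(2) d(2,1) f(3)] by blast
qed

text \<open>Induction on the common point \<open>y\<close>, one edge of the tree at a time: the
  induction hypothesis for its tail moves the meeting point into the factor on the other side, and
  the Helly property there, applied relative to \<open>C\<close>, moves it into
  \<open>C\<close>.\<close>

lemma cosets_meet_C:
  assumes "tail C V s y" and ij: "i \<in> I" "j \<in> I"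
    and "c \<in> C" "d \<in> C" "inv c \<otimes> y \<in> K i" "inv d \<otimes> y \<in> K j"
  shows "\<exists>f\<in>C. inv c \<otimes> f \<in> K i \<and> inv d \<otimes> f \<in> K j"
  using assms(1,4-7)
proof (induction arbitrary: c d)
  case (core y s)
  then show ?case by blast
next
  case (syllable u s v)
  let ?t = "\<not> s"
  have cd: "c \<in> V ?t" "d \<in> V ?t" "c \<in> carrier G" "d \<in> carrier G"
    using syllable.prems C_inV C_inG by auto
  have uv: "u \<otimes> v \<in> carrier G" using V_inG[OF syllable(1)] tail_inG[OF syllable(3)] by simp
  show ?case
  \<comment> \<open>A Helly family has one coset for each type, so equal types are treated apart:
    cosets of the same subgroup that meet coincide.\<close>
  proof (cases "i = j")
    case True
    have "inv d \<otimes> (u \<otimes> v) \<otimes> inv (inv c \<otimes> (u \<otimes> v)) \<in> K i"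
      using K_closed(2)[OF ij(2) syllable.prems(4) K_closed(3)[OF ij(2)]] syllable.prems(3) True
      by blast
    then have "inv d \<otimes> c \<in> K i"
      using cd V_inG[OF syllable(1)] tail_inG[OF syllable(3)] by (simp add: group_normalize)
    moreover have "inv c \<otimes> c \<in> K i" using cd K_closed(1)[OF ij(1)] by simp
    ultimately show ?thesis using True syllable.prems(1) by blast
  next
    case False
    obtain a where a: "a \<in> V ?t" "inv c \<otimes> a \<in> S ?t i" "inv d \<otimes> a \<in> S ?t j"
      using cosets_meet_factor_aux[OF ij syllable.IH syllable(1,3) cd(1,2) syllable.prems(3,4)] by blast
    define x where "x k = (if k = i then c else d)" for k
    have x: "x i = c" "x j = d" using False by (auto simp: x_def)
    have "\<exists>f\<in>C. inv x k \<otimes> (\<one> \<otimes> f) \<in> S ?t k" if "k \<in> {i, j}" for k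
    proof -
      have "x k \<in> C" using that x syllable.prems by auto
      moreover have "inv x k \<otimes> (\<one> \<otimes> x k) \<in> S ?t k"
        using C_inG[OF \<open>x k \<in> C\<close>] S_closed(1) that ij by auto
      ultimately show ?thesis by blast
    qed
    then obtain f where f: "f \<in> C" "\<And>k. k \<in> {i, j} \<Longrightarrow> inv x k \<otimes> (\<one> \<otimes> f) \<in> S ?t k"
      using helly_in_coset_of_C[of "{i, j}" x ?t \<one>] ij cd(1,2) a x V_closed(1) by auto
    then have "inv c \<otimes> f \<in> S ?t i" "inv d \<otimes> f \<in> S ?t j"
      using f(2)[of i] f(2)[of j] x C_inG[OF f(1)] by auto
    then show ?thesis using f(1) S_le_K by blast
  qed
qed

text \<open>The meeting point \<open>h\<close> may lie anywhere; \<open>cosets_meet_C\<close> pulls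
  its tail into \<open>C\<close>.\<close>

lemma cosets_meet_factor:
  assumes ij: "i \<in> I" "j \<in> I" and x: "x \<in> V s" "x' \<in> V s" and h: "h \<in> carrier G"
    and g: "inv x \<otimes> h \<in> K i" "inv x' \<otimes> h \<in> K j"
  shows "\<exists>a\<in>V s. inv x \<otimes> a \<in> S s i \<and> inv x' \<otimes> a \<in> S s j"
proof -
  obtain u v where uv: "u \<in> V s" "tail C V s v" "h = u \<otimes> v" using first_syllable[OF h] .
  show ?thesis
    using cosets_meet_factor_aux[OF ij cosets_meet_C[OF uv(2) ij] uv(1,2) x] g uv(3) by blast
qed

text \<open>In terms of the tree of the amalgamated product: the vertices met by \<open>v K\<^sub>k\<close> form a subtree,
  so a coset with points on both sides of the edge \<open>C\<close> meets \<open>C\<close>.\<close>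

lemma coset_meets_C:
  assumes "tail C V s v" and k: "k \<in> I"
    and "b \<in> V s" "b \<notin> C" "tail C V s w" "inv v \<otimes> (b \<otimes> w) \<in> K k"
  shows "\<exists>d\<in>C. inv v \<otimes> d \<in> K k"
  using assms(1,3-)
proof (induction arbitrary: b w)
  case (core v s)
  then have "inv v \<otimes> v \<in> K k" using C_inG[of v] K_closed(1)[OF k] by simp
  then show ?case using core by blast
next
  case (syllable p s q)
  have carr: "p \<in> carrier G" "q \<in> carrier G" "b \<in> carrier G" "w \<in> carrier G"
    using syllable V_inG tail_inG by blast+
  have bw: "tail C V (\<not> s) (b \<otimes> w)"
    using tail.syllable[of b V "\<not> s" C w] syllable.prems by simp
  have p: "inv p \<in> V (\<not> s)" "inv p \<notin> C"
    using syllable(1,2) carr C_closed(3)[of "inv p"] by auto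
  \<comment> \<open>After translation by \<open>inv p\<close> the other point begins with the
    syllable \<open>inv p\<close> outside \<open>C\<close>, so the induction hypothesis applies to
    \<open>q\<close> with the sides exchanged.\<close>
  have "inv q \<otimes> (inv p \<otimes> (b \<otimes> w)) \<in> K k"
    using syllable.prems(4) carr by (simp add: group_normalize)
  then obtain e where e: "e \<in> C" "inv q \<otimes> e \<in> K k"
    using syllable.IH[OF p bw] by blast
  have eG: "e \<in> carrier G" using C_inG[OF e(1)] .
  have "inv (inv q \<otimes> e) \<otimes> (inv (p \<otimes> q) \<otimes> (b \<otimes> w)) \<in> K k"
    using K_closed(2)[OF k K_closed(3)[OF k e(2)] syllable.prems(4)] .
  then have "inv e \<otimes> inv p \<otimes> (b \<otimes> w) \<in> K k"
    using carr eG by (simp add: group_normalize)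
  moreover have "inv e \<otimes> inv p \<in> V (\<not> s)" using p(1) C_inV[OF e(1)] by simp
  ultimately obtain c where c: "c \<in> C" "inv e \<otimes> inv p \<otimes> c \<in> S (\<not> s) k"
    using K_first_syllable[OF k _ _ bw] by blast
  have "(inv q \<otimes> e) \<otimes> (inv e \<otimes> inv p \<otimes> c) \<in> K k"
    using K_closed(2)[OF k e(2) subsetD[OF S_le_K c(2)]] .
  then have "inv (p \<otimes> q) \<otimes> c \<in> K k"
    using carr eG C_inG[OF c(1)] by (simp add: group_normalize)
  then show ?case using c(1) by blast
qed

text \<open>The subgroups \<open>K j\<close> share \<open>\<one>\<close> and meet the coset through
  \<open>z\<close> by hypothesis. By \<open>cosets_meet_factor\<close> the latter meetings can be
  found in \<open>V s\<close>, where the Helly property is available.\<close>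

lemma common_point_factor:
  assumes J: "J \<subseteq> I" and k: "k \<in> I" "k \<notin> J" and z: "z \<in> V s"
    and meet: "\<And>j. j \<in> J \<Longrightarrow> \<exists>h\<in>K j. inv z \<otimes> h \<in> K k"
  shows "\<exists>h\<in>carrier G. inv z \<otimes> h \<in> K k \<and> (\<forall>j\<in>J. h \<in> K j)"
proof -
  define x where "x i = (if i = k then z else \<one>)" for i
  have x: "x k = z" "\<And>j. j \<in> J \<Longrightarrow> x j = \<one>" using k by (auto simp: x_def)
  have zk: "\<exists>a\<in>V s. inv z \<otimes> a \<in> S s k \<and> inv \<one> \<otimes> a \<in> S s j" if j: "j \<in> J" for j
  proof -
    obtain h where h: "h \<in> K j" "inv z \<otimes> h \<in> K k" using meet[OF j] by blast
    have jI: "j \<in> I" using j J by blast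
    have hG: "h \<in> carrier G" using K_inG[OF jI h(1)] .
    show ?thesis
      using cosets_meet_factor[OF k(1) jI z V_closed(1) hG h(2)] h(1) hG by simp
  qed
  have one: "\<exists>a\<in>V s. inv \<one> \<otimes> a \<in> S s i \<and> inv \<one> \<otimes> a \<in> S s j" if "i \<in> I" "j \<in> I" for i j
    using that S_closed(1) V_closed(1)[of s] by (intro bexI[of _ \<one>]) auto
  have pair: "\<exists>a\<in>V s. inv x i \<otimes> a \<in> S s i \<and> inv x j \<otimes> a \<in> S s j"
    if ij: "i \<in> insert k J" "j \<in> insert k J" "i \<noteq> j" for i j
  proof -
    consider "i = k" "j \<in> J" | "i \<in> J" "j = k" | "i \<in> J" "j \<in> J" using ij by blast
    then show ?thesis
    proof cases
      case 1
      then show ?thesis using zk[of j] x by simp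
    next
      case 2
      then show ?thesis using zk[of i] x by auto
    next
      case 3
      then show ?thesis using one[of i j] x J by auto
    qed
  qed
  have self: "\<exists>a\<in>V s. inv x i \<otimes> a \<in> S s i" if "i \<in> insert k J" for i
    using that S_closed(1)[of i s] J k V_inG[OF z] V_closed(1)[of s] z
    by (intro bexI[of _ "x i"]) (auto simp: x_def)
  have xV: "x j \<in> V s" for j using z by (simp add: x_def)
  have sub: "insert k J \<subseteq> I" using J k by blast
  obtain g where g: "g \<in> V s" "\<And>j. j \<in> insert k J \<Longrightarrow> inv x j \<otimes> g \<in> S s j"
    using helly_onD[OF helly, of "insert k J" x s, OF sub xV pair self] by metis
  have "g \<in> S s j" if "j \<in> J" for j using g(2)[of j] that x(2) V_inG[OF g(1)] by simp
  moreover have "inv z \<otimes> g \<in> S s k" using g(2)[of k] x(1) by simp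
  ultimately show ?thesis using V_inG[OF g(1)] S_le_K by blast
qed

text \<open>The subgroups \<open>S s j\<close> share \<open>\<one>\<close> and each of them meets
  \<open>x C\<close>, so the Helly property relative to a coset of \<open>C\<close> applies.\<close>

lemma common_first_syllable:
  assumes J: "J \<subseteq> I" and x: "x \<in> V s" and c: "\<And>j. j \<in> J \<Longrightarrow> \<exists>c\<in>C. x \<otimes> c \<in> S s j"
  obtains c where "c \<in> C" "\<And>j. j \<in> J \<Longrightarrow> x \<otimes> c \<in> S s j"
proof -
  have xc: "inv \<one> \<otimes> (x \<otimes> c) = x \<otimes> c" if "c \<in> C" for c
    using V_inG[OF x] C_inG[OF that] by simp
  have one: "\<exists>a\<in>V s. inv \<one> \<otimes> a \<in> S s i \<and> inv \<one> \<otimes> a \<in> S s j" if "i \<in> J" "j \<in> J" for i j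
    using that S_closed(1) V_closed(1)[of s] J by (intro bexI[of _ \<one>]) auto
  have "\<exists>c\<in>C. inv \<one> \<otimes> (x \<otimes> c) \<in> S s j" if "j \<in> J" for j
    using c[OF that] xc by metis
  then obtain c where "c \<in> C" "\<And>j. j \<in> J \<Longrightarrow> inv \<one> \<otimes> (x \<otimes> c) \<in> S s j"
    using helly_in_coset_of_C[of J "\<lambda>_. \<one>" s x] J x one V_closed(1) by metis
  then show ?thesis using that xc by metis
qed

text \<open>Either the first syllable \<open>x\<close> of \<open>z\<close> can be split off simultaneously from all \<open>K\<^sub>j\<close>,
  or \<open>z K\<^sub>k\<close> meets the factor \<open>V s\<close> itself.\<close>

lemma common_point:
  assumes J: "J \<subseteq> I" and k: "k \<in> I" "k \<notin> J" and "tail C V s y" and "x \<in> V s"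
    and "\<And>j. j \<in> J \<Longrightarrow> \<exists>h\<in>K j. inv (x \<otimes> y) \<otimes> h \<in> K k"
  shows "\<exists>h\<in>carrier G. inv (x \<otimes> y) \<otimes> h \<in> K k \<and> (\<forall>j\<in>J. h \<in> K j)"
  using assms(4-)
proof (induction arbitrary: x)
  case (core y s)
  then have "x \<otimes> y \<in> V s" by simp
  then show ?case using common_point_factor[OF J k _ core(4)] by blast
next
  case (syllable p s q)
  let ?y = "p \<otimes> q"
  have tail_y: "tail C V s ?y" using syllable(1-3) by (rule tail.syllable)
  have carr: "p \<in> carrier G" "q \<in> carrier G" "x \<in> carrier G"
    using syllable V_inG tail_inG by blast+
  show ?case
  proof (cases "\<forall>j\<in>J. \<exists>c\<in>C. x \<otimes> c \<in> S s j")
    case True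
    \<comment> \<open>Translation by \<open>inv (x \<otimes> c)\<close> fixes every
      \<open>K j\<close> and turns \<open>x \<otimes> ?y\<close> into
      \<open>inv c \<otimes> p \<otimes> q\<close>, which has one syllable less.\<close>
    then obtain c where c: "c \<in> C" "\<And>j. j \<in> J \<Longrightarrow> x \<otimes> c \<in> S s j"
      using common_first_syllable[OF J syllable.prems(1)] by blast
    have cG: "c \<in> carrier G" using C_inG[OF c(1)] .
    have xcK: "x \<otimes> c \<in> K j" if "j \<in> J" for j using c(2)[OF that] S_le_K by blast
    have "\<exists>h\<in>K j. inv (inv c \<otimes> p \<otimes> q) \<otimes> h \<in> K k" if j: "j \<in> J" for j
    proof -
      have jI: "j \<in> I" using j J by blast
      obtain h where h: "h \<in> K j" "inv (x \<otimes> ?y) \<otimes> h \<in> K k" using syllable.prems(2)[OF j] by blast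
      have "inv (x \<otimes> c) \<otimes> h \<in> K j" using K_closed(2)[OF jI K_closed(3)[OF jI xcK[OF j]] h(1)] .
      moreover have "inv (inv c \<otimes> p \<otimes> q) \<otimes> (inv (x \<otimes> c) \<otimes> h) = inv (x \<otimes> ?y) \<otimes> h"
        using carr cG K_inG[OF jI h(1)] by (simp add: group_normalize)
      ultimately show ?thesis using h(2) by metis
    qed
    moreover have "inv c \<otimes> p \<in> V (\<not> s)" using syllable(1) C_inV[OF c(1)] by simp
    ultimately obtain h where h: "h \<in> carrier G" "inv (inv c \<otimes> p \<otimes> q) \<otimes> h \<in> K k" "\<And>j. j \<in> J \<Longrightarrow> h \<in> K j"
      using syllable.IH[of "inv c \<otimes> p"] by blast
    have "inv (x \<otimes> ?y) \<otimes> (x \<otimes> c \<otimes> h) = inv (inv c \<otimes> p \<otimes> q) \<otimes> h"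
      using carr cG h(1) by (simp add: group_normalize)
    moreover have "x \<otimes> c \<otimes> h \<in> K j" if "j \<in> J" for j
      using K_closed(2)[OF subsetD[OF J that] xcK[OF that] h(3)[OF that]] .
    ultimately show ?thesis using h(1,2) carr cG by (metis m_closed)
  next
    case False
    \<comment> \<open>For this \<open>j\<close> the point \<open>h\<close> of \<open>K j\<close>
      begins with a syllable \<open>a\<close> outside \<open>x C\<close>. So, after division by
      \<open>x\<close>, the coset of \<open>K k\<close> has points on both sides of the edge
      \<open>C\<close> and contains some \<open>d\<close> in \<open>C\<close>; the original coset
      then has the representative \<open>x \<otimes> d\<close> in the factor.\<close>
    then obtain j where j: "j \<in> J" and none: "\<And>c. c \<in> C \<Longrightarrow> x \<otimes> c \<notin> S s j" by blast
    have jI: "j \<in> I" using j J by blast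
    obtain h where h: "h \<in> K j" "inv (x \<otimes> ?y) \<otimes> h \<in> K k" using syllable.prems(2)[OF j] by blast
    obtain a w where aw: "a \<in> V s" "tail C V s w" "h = a \<otimes> w"
      using first_syllable[OF K_inG[OF jI h(1)]] .
    have awG: "a \<in> carrier G" "w \<in> carrier G" using V_inG[OF aw(1)] tail_inG[OF aw(2)] by auto
    obtain c where c: "c \<in> C" "a \<otimes> c \<in> S s j"
      using K_first_syllable[OF jI _ aw(1,2)] h(1) aw(3) by blast
    have "inv x \<otimes> a \<notin> C"
    proof
      assume "inv x \<otimes> a \<in> C"
      then have "inv x \<otimes> a \<otimes> c \<in> C" using c(1) by simp
      moreover have "x \<otimes> (inv x \<otimes> a \<otimes> c) = a \<otimes> c"
        using carr awG C_inG[OF c(1)] by (simp add: group_normalize)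
      ultimately show False using none c(2) by metis
    qed
    moreover have "inv x \<otimes> a \<in> V s" using aw(1) syllable.prems(1) by simp
    moreover have "inv ?y \<otimes> (inv x \<otimes> a \<otimes> w) \<in> K k"
      using h(2) aw(3) carr awG by (simp add: group_normalize)
    ultimately obtain d where d: "d \<in> C" "inv ?y \<otimes> d \<in> K k"
      using coset_meets_C[OF tail_y k(1)] aw(2) by blast
    have dG: "d \<in> carrier G" using C_inG[OF d(1)] .
    have shift: "inv (x \<otimes> ?y) \<otimes> g \<in> K k \<longleftrightarrow> inv (x \<otimes> d) \<otimes> g \<in> K k" if g: "g \<in> carrier G" for g
    proof -
      have "inv (x \<otimes> ?y) \<otimes> g = (inv ?y \<otimes> d) \<otimes> (inv (x \<otimes> d) \<otimes> g)"
        "inv (x \<otimes> d) \<otimes> g = inv (inv ?y \<otimes> d) \<otimes> (inv (x \<otimes> ?y) \<otimes> g)"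
        using carr dG g by (simp_all add: group_normalize)
      then show ?thesis using K_closed(2)[OF k(1)] K_closed(3)[OF k(1) d(2)] d(2) by metis
    qed
    have "x \<otimes> d \<in> V s" using syllable.prems(1) C_inV[OF d(1)] by simp
    moreover have "\<exists>h\<in>K j. inv (x \<otimes> d) \<otimes> h \<in> K k" if "j \<in> J" for j
      using syllable.prems(2)[OF that] shift K_inG[of j] J that by blast
    ultimately show ?thesis
      using common_point_factor[OF J k] shift by blast
  qed
qed

text \<open>Induction on the number of cosets. Translating a common point \<open>g\<close> of all
  but one of them to \<open>\<one>\<close> turns these into the subgroups \<open>K j\<close>, the
  situation of \<open>common_point\<close>.\<close>

lemma helly_amalgam:
  assumes "finite I"
  shows "helly_on G (carrier G) I K"
proof -
  have "\<exists>g\<in>carrier G. \<forall>j\<in>J. inv x j \<otimes> g \<in> K j"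
    if "finite J" "J \<subseteq> I" "\<And>j. j \<in> J \<Longrightarrow> x j \<in> carrier G"
      "\<And>i j. i \<in> J \<Longrightarrow> j \<in> J \<Longrightarrow>
        \<exists>g\<in>carrier G. inv x i \<otimes> g \<in> K i \<and> inv x j \<otimes> g \<in> K j" for J x
    using that
  proof (induction J rule: finite_induct)
    case empty
    then show ?case by blast
  next
    case (insert k J)
    have J: "J \<subseteq> I" and k: "k \<in> I" and xk: "x k \<in> carrier G"
      and xj: "\<And>j. j \<in> J \<Longrightarrow> x j \<in> carrier G"
      using insert.prems by auto
    obtain g where g: "g \<in> carrier G" "\<And>j. j \<in> J \<Longrightarrow> inv x j \<otimes> g \<in> K j"
      using insert.IH[OF J xj insert.prems(3)] by auto
    have "inv g \<otimes> x k \<in> carrier G" using g(1) xk by simp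
    then obtain u y where uy: "u \<in> V True" "tail C V True y" "inv g \<otimes> x k = u \<otimes> y"
      using first_syllable by blast
    have "\<exists>h\<in>K j. inv (inv g \<otimes> x k) \<otimes> h \<in> K k" if j: "j \<in> J" for j
    proof -
      obtain h where h: "h \<in> carrier G" "inv x j \<otimes> h \<in> K j" "inv x k \<otimes> h \<in> K k"
        using insert.prems(3)[of j k] j by blast
      have "inv (inv x j \<otimes> g) \<otimes> (inv x j \<otimes> h) \<in> K j"
        using K_closed(2)[OF subsetD[OF J j] K_closed(3)[OF subsetD[OF J j] g(2)[OF j]] h(2)] .
      moreover have "inv (inv x j \<otimes> g) \<otimes> (inv x j \<otimes> h) = inv g \<otimes> h"
        "inv (inv g \<otimes> x k) \<otimes> (inv g \<otimes> h) = inv x k \<otimes> h"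
        using g(1) h(1) xj[OF j] xk by (simp_all add: group_normalize)
      ultimately show ?thesis using h(3) by metis
    qed
    then obtain h where h: "h \<in> carrier G" "inv (inv g \<otimes> x k) \<otimes> h \<in> K k"
      "\<And>j. j \<in> J \<Longrightarrow> h \<in> K j"
      using common_point[OF J k insert.hyps(2) uy(2,1)] uy(3) by metis
    have "inv x k \<otimes> (g \<otimes> h) \<in> K k"
      using h(1,2) g(1) xk by (simp add: group_normalize)
    moreover have "inv x j \<otimes> (g \<otimes> h) \<in> K j" if j: "j \<in> J" for j
      using K_closed(2)[OF subsetD[OF J j] g(2)[OF j] h(3)[OF j]] xj[OF j] g(1) h(1)
      by (simp add: m_assoc)
    ultimately show ?case using g(1) h(1) by (intro bexI[of _ "g \<otimes> h"]) auto
  qed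
  then show ?thesis
    using assms finite_subset unfolding helly_on_def by (metis (no_types, lifting))
qed

text \<open>One element of \<open>C\<close> adjusts the first syllable so that it lies in all
  \<open>S s j\<close> at once; what remains lies in the same \<open>K j\<close> and is
  shorter.\<close>

lemma parabolic_generated:
  assumes J: "J \<subseteq> I" and g: "g \<in> carrier G" "\<And>j. j \<in> J \<Longrightarrow> g \<in> K j"
  shows "g \<in> generate G (\<Union>s. {v \<in> V s. \<forall>j\<in>J. v \<in> S s j})" (is "_ \<in> ?N")
proof -
  have "x \<otimes> y \<in> ?N"
    if "tail C V s y" "x \<in> V s" "\<And>j. j \<in> J \<Longrightarrow> x \<otimes> y \<in> K j" for s x y
    using that
  proof (induction arbitrary: x)
    case (core y s)
    then have "x \<otimes> y \<in> V s" by simp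
    moreover have "x \<otimes> y \<in> S s j" if "j \<in> J" for j
      using K_Int_V[OF subsetD[OF J that] core.prems(2)[OF that] \<open>x \<otimes> y \<in> V s\<close>] .
    ultimately show ?case by (intro generate.incl) blast
  next
    case (syllable p s q)
    have tail_y: "tail C V s (p \<otimes> q)" using syllable(1-3) by (rule tail.syllable)
    have carr: "p \<in> carrier G" "q \<in> carrier G" "x \<in> carrier G"
      using syllable V_inG tail_inG by blast+
    have "\<exists>c\<in>C. x \<otimes> c \<in> S s j" if "j \<in> J" for j
      using K_first_syllable[OF subsetD[OF J that] syllable.prems(2)[OF that] syllable.prems(1) tail_y]
      by blast
    then obtain c where c: "c \<in> C" "\<And>j. j \<in> J \<Longrightarrow> x \<otimes> c \<in> S s j"
      using common_first_syllable[OF J syllable.prems(1)] by blast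
    have cG: "c \<in> carrier G" using C_inG[OF c(1)] .
    have eq: "inv c \<otimes> p \<otimes> q = inv (x \<otimes> c) \<otimes> (x \<otimes> (p \<otimes> q))"
      using carr cG by (simp add: group_normalize)
    have "inv c \<otimes> p \<otimes> q \<in> K j" if "j \<in> J" for j
      unfolding eq
      using K_closed(2)[OF subsetD[OF J that]
          K_closed(3)[OF subsetD[OF J that] subsetD[OF S_le_K c(2)[OF that]]] syllable.prems(2)[OF that]] .
    moreover have "inv c \<otimes> p \<in> V (\<not> s)" using syllable(1) C_inV[OF c(1)] by simp
    ultimately have "inv c \<otimes> p \<otimes> q \<in> ?N" using syllable.IH by blast
    moreover have "x \<otimes> c \<in> ?N"
      using c(2) V_closed(2)[OF syllable.prems(1) C_inV[OF c(1)]] by (intro generate.incl) blast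
    ultimately have "(x \<otimes> c) \<otimes> (inv c \<otimes> p \<otimes> q) \<in> ?N" by (rule generate.eng[rotated])
    then show ?case using carr cG by (simp add: group_normalize)
  qed
  moreover obtain x y where "x \<in> V True" "tail C V True y" "g = x \<otimes> y"
    using first_syllable[OF g(1)] .
  ultimately show ?thesis using g(2) by blast
qed

end

section \<open>Coset geometries\<close>

text \<open>Results of the locale \<open>coset_family\<close> speak of a record assembled from
  components; this rule returns to the original system.\<close>

lemma coset_system_collapse [simp]: "\<lparr>grp = grp \<gamma>, index = index \<gamma>, sub = sub \<gamma>\<rparr> = (\<gamma> :: ('g, 'i) coset_system)"
  by (cases \<gamma>) simp

lemma mem_parabolic: "h \<in> parabolic \<gamma> J \<longleftrightarrow> h \<in> carrier (grp \<gamma>) \<and> (\<forall>j\<in>J. h \<in> sub \<gamma> j)"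
  by (auto simp: parabolic_def)

text \<open>Firm, thin and thick differ in the condition \<open>Q\<close> alone. Finiteness is a
  separate argument of \<open>Q\<close> because \<open>card\<close> is 0 on infinite sets.\<close>

definition corank_one_residues ::
  "(bool \<Rightarrow> nat \<Rightarrow> bool) \<Rightarrow> ('x, 'i) incidence_system \<Rightarrow> bool" where
  "corank_one_residues Q X \<longleftrightarrow> (\<forall>F. flag X F \<and> corank X F = 1 \<longrightarrow>
     Q (finite (elements (residue X F))) (card (elements (residue X F))))"

lemma firm_iff: "firm X \<longleftrightarrow> corank_one_residues (\<lambda>f n. \<not> f \<or> 2 \<le> n) X"
  by (simp add: firm_def corank_one_residues_def)

lemma thin_iff: "thin X \<longleftrightarrow> corank_one_residues (\<lambda>f n. n = 2) X"
  by (simp add: thin_def corank_one_residues_def)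

lemma thick_iff: "thick X \<longleftrightarrow> corank_one_residues (\<lambda>f n. \<not> f \<or> 2 < n) X"
  by (simp add: thick_def corank_one_residues_def)

locale coset_family = group G for G :: "'g monoid" (structure) +
  fixes I :: "'i set" and S :: "'i \<Rightarrow> 'g set"
  assumes subgroup_S: "i \<in> I \<Longrightarrow> subgroup (S i) G"
begin

abbreviation system :: "('g, 'i) coset_system" where
  "system \<equiv> \<lparr>grp = G, index = I, sub = S\<rparr>"

abbreviation X :: "('i \<times> 'g set, 'i) incidence_system" where
  "X \<equiv> incidence system"

abbreviation P :: "'i set \<Rightarrow> 'g set" where
  "P \<equiv> parabolic system"

lemma coset_incidence_system_family: "coset_incidence_system system"
  by (simp add: coset_incidence_system_def subgroup_S is_group)

lemma mem_P: "h \<in> P J \<longleftrightarrow> h \<in> carrier G \<and> (\<forall>j\<in>J. h \<in> S j)"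
  by (auto simp: parabolic_def)

lemma S_inG: "i \<in> I \<Longrightarrow> x \<in> S i \<Longrightarrow> x \<in> carrier G"
  using subgroup_S subgroup.subset by blast

lemmas S_closed =
  subgroup.one_closed[OF subgroup_S] subgroup.m_closed[OF subgroup_S]
  subgroup.m_inv_closed[OF subgroup_S]

lemma subgroup_P:
  assumes "J \<subseteq> I"
  shows "subgroup (P J) G"
  using assms S_closed by unfold_locales (auto simp: mem_P)

lemmas P_closed =
  subgroup.one_closed[OF subgroup_P] subgroup.m_closed[OF subgroup_P]
  subgroup.m_inv_closed[OF subgroup_P]

lemma mem_coset:
  assumes "i \<in> I" "x \<in> carrier G"
  shows "y \<in> x <# S i \<longleftrightarrow> y \<in> carrier G \<and> inv x \<otimes> y \<in> S i"
proof
  assume "y \<in> x <# S i"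
  then obtain h where h: "h \<in> S i" "y = x \<otimes> h" by (auto simp: l_coset_def)
  then show "y \<in> carrier G \<and> inv x \<otimes> y \<in> S i"
    using assms S_inG[OF assms(1) h(1)] by (simp add: inv_mult_cancel)
next
  assume "y \<in> carrier G \<and> inv x \<otimes> y \<in> S i"
  moreover from this have "y = x \<otimes> (inv x \<otimes> y)" using assms by (simp add: mult_inv_cancel)
  ultimately show "y \<in> x <# S i" unfolding l_coset_def by blast
qed

lemma coset_eq_iff:
  assumes i: "i \<in> I" and xy: "x \<in> carrier G" "y \<in> carrier G"
  shows "x <# S i = y <# S i \<longleftrightarrow> inv x \<otimes> y \<in> S i"
proof
  assume "x <# S i = y <# S i"
  moreover have "y \<in> y <# S i" using mem_coset[OF i xy(2)] xy S_closed(1)[OF i] by simp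
  ultimately show "inv x \<otimes> y \<in> S i" using mem_coset[OF i xy(1)] by blast
next
  assume xyS: "inv x \<otimes> y \<in> S i"
  have "inv x \<otimes> z \<in> S i \<longleftrightarrow> inv y \<otimes> z \<in> S i" if z: "z \<in> carrier G" for z
  proof -
    have "inv x \<otimes> z = (inv x \<otimes> y) \<otimes> (inv y \<otimes> z)" "inv y \<otimes> z = inv (inv x \<otimes> y) \<otimes> (inv x \<otimes> z)"
      using xy z by (simp_all add: group_normalize)
    then show ?thesis
      using S_closed(2)[OF i xyS] S_closed(2)[OF i S_closed(3)[OF i xyS]] by metis
  qed
  then show "x <# S i = y <# S i" using mem_coset[OF i] xy by blast
qed

lemma mem_elements: "(i, Y) \<in> elements X \<longleftrightarrow> i \<in> I \<and> (\<exists>x\<in>carrier G. Y = x <# S i)"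
  by (auto simp: incidence_def LCOSETS_def)

lemma incident_iff:
  assumes "i \<in> I" "j \<in> I" "x \<in> carrier G" "y \<in> carrier G"
  shows "incident X (i, x <# S i) (j, y <# S j) \<longleftrightarrow>
    (\<exists>g\<in>carrier G. inv x \<otimes> g \<in> S i \<and> inv y \<otimes> g \<in> S j)"
  using mem_coset assms by (auto simp: incidence_def disjoint_iff)

lemma incident_same_type:
  assumes "i \<in> I" "x \<in> carrier G" "y \<in> carrier G"
    and "incident X (i, x <# S i) (i, y <# S i)"
  shows "x <# S i = y <# S i"
proof -
  obtain g where "g \<in> carrier G" "inv x \<otimes> g \<in> S i" "inv y \<otimes> g \<in> S i"
    using assms incident_iff by blast
  then show ?thesis using coset_eq_iff[OF assms(1)] assms(2,3) by metis
qed

text \<open>For a constant function with value \<open>g\<close> this is the translate by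
  \<open>g\<close> of the standard flag of type \<open>J\<close>, and \<open>g\<close> is a common
  point of its members.\<close>

definition coset_flag :: "('i \<Rightarrow> 'g) \<Rightarrow> 'i set \<Rightarrow> ('i \<times> 'g set) set" where
  "coset_flag x J = (\<lambda>j. (j, x j <# S j)) ` J"

lemma flag_type_coset_flag: "flag_type X (coset_flag x J) = J"
  by (auto simp: flag_type_def coset_flag_def incidence_def image_image)

lemma card_coset_flag: "card (coset_flag x J) = card J"
  unfolding coset_flag_def by (rule card_image) (auto intro: inj_onI)

lemma flag_coset_flag:
  assumes J: "J \<subseteq> I" and x: "\<And>j. j \<in> J \<Longrightarrow> x j \<in> carrier G"
  shows "flag X (coset_flag x J) \<longleftrightarrow>
    (\<forall>i\<in>J. \<forall>j\<in>J. \<exists>g\<in>carrier G. inv x i \<otimes> g \<in> S i \<and> inv x j \<otimes> g \<in> S j)"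
proof -
  have inc: "incident X (i, x i <# S i) (j, x j <# S j) \<longleftrightarrow>
      (\<exists>g\<in>carrier G. inv x i \<otimes> g \<in> S i \<and> inv x j \<otimes> g \<in> S j)" if "i \<in> J" "j \<in> J" for i j
    using incident_iff that J x by blast
  have self: "\<exists>g\<in>carrier G. inv x i \<otimes> g \<in> S i" if "i \<in> J" for i
    using x[OF that] S_closed(1)[OF subsetD[OF J that]] by (intro bexI[of _ "x i"]) auto
  have "coset_flag x J \<subseteq> elements X"
    using J x unfolding coset_flag_def by (auto simp only: mem_elements) blast+
  moreover have "pairwise (incident X) (coset_flag x J) \<longleftrightarrow>
      (\<forall>i\<in>J. \<forall>j\<in>J. i \<noteq> j \<longrightarrow> incident X (i, x i <# S i) (j, x j <# S j))"
    unfolding coset_flag_def pairwise_def by auto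
  moreover have "\<dots> \<longleftrightarrow>
      (\<forall>i\<in>J. \<forall>j\<in>J. \<exists>g\<in>carrier G. inv x i \<otimes> g \<in> S i \<and> inv x j \<otimes> g \<in> S j)"
    using inc self by metis
  ultimately show ?thesis unfolding flag_def by simp
qed

text \<open>Incident cosets of one type are equal, so a flag has exactly one element of each of its
  types.\<close>

lemma flagE:
  assumes F: "flag X F"
  obtains J x where "J \<subseteq> I" "\<forall>j\<in>J. x j \<in> carrier G" "F = coset_flag x J"
proof -
  let ?J = "flag_type X F"
  have type: "?J = fst ` F" by (simp add: flag_type_def incidence_def)
  have el: "F \<subseteq> elements X" and pw: "pairwise (incident X) F"
    using F by (auto simp: flag_def)
  have J: "?J \<subseteq> I" using el unfolding type by (auto simp: mem_elements)
  have "\<exists>x\<in>carrier G. (j, x <# S j) \<in> F" if "j \<in> ?J" for j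
    using that el unfolding type by (force simp: mem_elements)
  then obtain x where x: "\<And>j. j \<in> ?J \<Longrightarrow> x j \<in> carrier G"
    "\<And>j. j \<in> ?J \<Longrightarrow> (j, x j <# S j) \<in> F" by metis
  have "F = coset_flag x ?J"
  proof
    show "coset_flag x ?J \<subseteq> F" using x(2) by (auto simp: coset_flag_def)
    show "F \<subseteq> coset_flag x ?J"
    proof
      fix z assume z: "z \<in> F"
      then obtain j y where y: "z = (j, y <# S j)" "j \<in> I" "y \<in> carrier G"
        using el mem_elements by (metis prod.exhaust subsetD)
      have j: "j \<in> ?J" using z y(1) unfolding type by force
      have "y <# S j = x j <# S j"
      proof (rule ccontr)
        assume ne: "y <# S j \<noteq> x j <# S j"
        then have "incident X (j, y <# S j) (j, x j <# S j)"
          using pairwiseD[OF pw] z x(2)[OF j] y(1) by blast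
        then show False using incident_same_type y x(1)[OF j] ne by blast
      qed
      then show "z \<in> coset_flag x ?J" using j y(1) by (auto simp: coset_flag_def)
    qed
  qed
  then show ?thesis using that[where x = x and J = ?J] J x(1) by blast
qed

lemma left_mult_coset_flag:
  assumes "g \<in> carrier G" "J \<subseteq> I" "\<And>j. j \<in> J \<Longrightarrow> x j \<in> carrier G"
  shows "left_mult system g ` coset_flag x J = coset_flag (\<lambda>j. g \<otimes> x j) J"
proof -
  have "left_mult system g (j, x j <# S j) = (j, (g \<otimes> x j) <# S j)" if "j \<in> J" for j
    using lcos_m_assoc[of "S j" g "x j"] S_inG[of j] assms that
    by (auto simp: left_mult_def)
  then show ?thesis unfolding coset_flag_def image_image by simp
qed

lemma coset_flag_eqI:
  assumes "J \<subseteq> I" "\<And>j. j \<in> J \<Longrightarrow> x j \<in> carrier G" "g \<in> carrier G"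
    and "\<And>j. j \<in> J \<Longrightarrow> inv x j \<otimes> g \<in> S j"
  shows "coset_flag x J = coset_flag (\<lambda>_. g) J"
proof -
  have "x j <# S j = g <# S j" if "j \<in> J" for j
    using coset_eq_iff[OF subsetD[OF assms(1) that] assms(2)[OF that] assms(3)] assms(4)[OF that]
    by blast
  then show ?thesis unfolding coset_flag_def by (intro image_cong) auto
qed

lemma flag_std:
  assumes "J \<subseteq> I" "g \<in> carrier G"
  shows "flag X (coset_flag (\<lambda>_. g) J)"
  using flag_coset_flag[of J "\<lambda>_. g"] assms S_closed(1) by force

lemma helly_imp_std_flag:
  assumes helly: "helly_on G (carrier G) I S" and F: "flag X F"
  obtains g J where "g \<in> carrier G" "J \<subseteq> I" "F = coset_flag (\<lambda>_. g) J"
proof -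
  obtain J x where x: "J \<subseteq> I" "\<forall>j\<in>J. x j \<in> carrier G" "F = coset_flag x J"
    using flagE[OF F] .
  note xG = x(2)[rule_format]
  have "\<forall>i\<in>J. \<forall>j\<in>J. \<exists>g\<in>carrier G. inv x i \<otimes> g \<in> S i \<and> inv x j \<otimes> g \<in> S j"
    using flag_coset_flag[OF x(1) xG] F unfolding x(3) by simp
  then have "\<exists>g\<in>carrier G. \<forall>j\<in>J. inv x j \<otimes> g \<in> S j"
    using helly[unfolded helly_on_def, rule_format, OF x(1), of x] x(2) by simp
  then obtain g where g: "g \<in> carrier G" "\<And>j. j \<in> J \<Longrightarrow> inv x j \<otimes> g \<in> S j" by blast
  have "F = coset_flag (\<lambda>_. g) J"
    unfolding x(3) using coset_flag_eqI[OF x(1) xG g] .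
  then show ?thesis using that[OF g(1) x(1)] by simp
qed

lemma flag_transitive_iff_helly: "flag_transitive system \<longleftrightarrow> helly_on G (carrier G) I S"
proof
  assume ft: "flag_transitive system"
  show "helly_on G (carrier G) I S"
    unfolding helly_on_def
  proof (intro allI impI, elim conjE)
    fix J x
    assume J: "J \<subseteq> I" and x: "\<forall>j\<in>J. x j \<in> carrier G"
      and meet: "\<forall>i\<in>J. \<forall>j\<in>J. \<exists>g\<in>carrier G. inv x i \<otimes> g \<in> S i \<and> inv x j \<otimes> g \<in> S j"
    have "flag X (coset_flag x J)" using flag_coset_flag[OF J] x meet by blast
    moreover have "flag X (coset_flag (\<lambda>_. \<one>) J)" using flag_std[OF J one_closed] .
    ultimately obtain g where g: "g \<in> carrier G"
      "left_mult system g ` coset_flag (\<lambda>_. \<one>) J = coset_flag x J"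
      using ft[unfolded flag_transitive_def, rule_format, of J "coset_flag (\<lambda>_. \<one>) J" "coset_flag x J"]
        J flag_type_coset_flag by auto
    then have eq: "coset_flag (\<lambda>_. g) J = coset_flag x J"
      using left_mult_coset_flag[OF g(1) J, of "\<lambda>_. \<one>"] by simp
    have "x j <# S j = g <# S j" if "j \<in> J" for j
    proof -
      have "(j, g <# S j) \<in> coset_flag x J"
        using that unfolding eq[symmetric] by (auto simp: coset_flag_def)
      then show ?thesis by (auto simp: coset_flag_def)
    qed
    then have "inv x j \<otimes> g \<in> S j" if "j \<in> J" for j
      using coset_eq_iff[of j "x j" g] that J x g(1) by auto
    then show "\<exists>g\<in>carrier G. \<forall>j\<in>J. inv x j \<otimes> g \<in> S j" using g(1) by blast
  qed
next
  assume helly: "helly_on G (carrier G) I S"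
  show "flag_transitive system"
    unfolding flag_transitive_def
  proof (intro allI impI, elim conjE)
    fix J F F'
    assume J: "J \<subseteq> index system" and F: "flag X F" "flag_type X F = J"
      and F': "flag X F'" "flag_type X F' = J"
    obtain g g' where g: "g \<in> carrier G" "F = coset_flag (\<lambda>_. g) J"
      "g' \<in> carrier G" "F' = coset_flag (\<lambda>_. g') J"
      using helly_imp_std_flag[OF helly F(1)] helly_imp_std_flag[OF helly F'(1)] F(2) F'(2)
        flag_type_coset_flag by metis
    then have "left_mult system (g' \<otimes> inv g) ` F = F'"
      using left_mult_coset_flag[of "g' \<otimes> inv g" J "\<lambda>_. g"] J by (simp add: m_assoc)
    then show "\<exists>g\<in>carrier (grp system). left_mult system g ` F = F'"
      using g by auto
  qed
qed

end

section \<open>Residues, connectedness and corank one in a flag-transitive system\<close>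

locale helly_coset_family = coset_family +
  assumes finite_I: "finite I" and helly: "helly_on G (carrier G) I S"
begin

lemma std_flagE:
  assumes F: "flag X F"
  obtains g J where "g \<in> carrier G" "J \<subseteq> I" "F = coset_flag (\<lambda>_. g) J"
  using helly_imp_std_flag[OF helly F] .

text \<open>A flag has a common point \<open>g\<close>, and the chamber of all cosets through
  \<open>g\<close> contains it.\<close>

lemma geometry_X: "geometry X"
  unfolding geometry_def
proof (intro allI impI)
  fix F assume max: "maximal_flag X F"
  then obtain g J where g: "g \<in> carrier G" "J \<subseteq> I" "F = coset_flag (\<lambda>_. g) J"
    using std_flagE unfolding maximal_flag_def by metis
  have "F \<subseteq> coset_flag (\<lambda>_. g) I" using g(2,3) by (auto simp: coset_flag_def)
  then have "F = coset_flag (\<lambda>_. g) I"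
    using max flag_std[OF order_refl g(1)] unfolding maximal_flag_def by blast
  then show "chamber X F"
    using flag_std[OF order_refl g(1)] flag_type_coset_flag
    by (simp add: chamber_def incidence_def)
qed

text \<open>An element of the residue forms a larger flag together with the given one. That flag has
  a common point \<open>p\<close>, and \<open>inv g \<otimes> p\<close> is the required element of
  \<open>P J\<close>.\<close>

lemma elements_residue:
  assumes J: "J \<subseteq> I" and g: "g \<in> carrier G"
  shows "elements (residue X (coset_flag (\<lambda>_. g) J)) =
    (\<Union>i\<in>I - J. (\<lambda>h. (i, (g \<otimes> h) <# S i)) ` P J)" (is "?L = ?R")
proof
  have mem: "z \<in> ?L \<longleftrightarrow> z \<in> elements X \<and> z \<notin> coset_flag (\<lambda>_. g) J \<and>
      (\<forall>j\<in>J. incident X z (j, g <# S j))" for z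
    by (auto simp: residue_def coset_flag_def)
  show "?R \<subseteq> ?L"
  proof
    fix z assume "z \<in> ?R"
    then obtain i h where z: "z = (i, (g \<otimes> h) <# S i)" "i \<in> I" "i \<notin> J" "h \<in> P J" by blast
    have h: "h \<in> carrier G" "\<And>j. j \<in> J \<Longrightarrow> h \<in> S j" using z(4) mem_P by auto
    have "incident X z (j, g <# S j)" if j: "j \<in> J" for j
    proof -
      have "inv (g \<otimes> h) \<otimes> (g \<otimes> h) \<in> S i" using g h S_closed(1)[OF z(2)] by simp
      moreover have "inv g \<otimes> (g \<otimes> h) \<in> S j" using g h j by (simp add: inv_mult_cancel)
      ultimately show ?thesis
        unfolding z(1) using incident_iff[of i j "g \<otimes> h" g] z(2) J j g h(1) by blast
    qed
    then show "z \<in> ?L"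
      unfolding mem using z g h(1) by (auto simp: mem_elements coset_flag_def)
  qed
  show "?L \<subseteq> ?R"
  proof
    fix z assume "z \<in> ?L"
    then have z: "z \<in> elements X" "z \<notin> coset_flag (\<lambda>_. g) J"
      and inc: "\<And>j. j \<in> J \<Longrightarrow> incident X z (j, g <# S j)" unfolding mem by auto
    obtain i x where ix: "z = (i, x <# S i)" "i \<in> I" "x \<in> carrier G"
      using z(1) mem_elements by (metis prod.exhaust)
    have iJ: "i \<notin> J"
    proof
      assume "i \<in> J"
      then have "x <# S i = g <# S i"
        using incident_same_type[OF ix(2,3) g] inc[of i] ix(1) by blast
      then show False using z(2) ix(1) \<open>i \<in> J\<close> by (auto simp: coset_flag_def)
    qed
    define x' where "x' j = (if j = i then x else g)" for j
    have x': "x' i = x" "\<And>j. j \<in> J \<Longrightarrow> x' j = g" "\<And>j. x' j \<in> carrier G"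
      using iJ ix g by (auto simp: x'_def)
    have "coset_flag x' (insert i J) = insert z (coset_flag (\<lambda>_. g) J)"
      using x' ix(1) by (auto simp: coset_flag_def)
    moreover have "flag X (insert z (coset_flag (\<lambda>_. g) J))"
    proof -
      have "incident X w v \<longleftrightarrow> incident X v w" for w v
        by (auto simp: incidence_def)
      then show ?thesis
        using flag_std[OF J g] z(1) inc
        by (auto simp: flag_def pairwise_insert coset_flag_def)
    qed
    ultimately obtain p where p: "p \<in> carrier G" "\<And>j. j \<in> insert i J \<Longrightarrow> inv x' j \<otimes> p \<in> S j"
      using flag_coset_flag[of "insert i J" x'] helly J ix(2) x'(3)
      unfolding helly_on_def by (metis insert_subset)
    have "inv g \<otimes> p \<in> P J" using p x'(2) g by (force simp: mem_P)
    moreover have "x <# S i = (g \<otimes> (inv g \<otimes> p)) <# S i"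
      using coset_eq_iff[OF ix(2,3) p(1)] p(2)[of i] x'(1) g p(1) by (simp add: mult_inv_cancel)
    ultimately show "z \<in> ?R" using ix(1,2) iJ by blast
  qed
qed

lemma residue_rank:
  "rank (residue X (coset_flag x J)) = card (I - J)"
  by (simp add: rank_def residue_def flag_type_coset_flag) (simp add: incidence_def)

text \<open>Up to translation, a residue consists of the cosets of \<open>S i\<close> through
  elements of \<open>P J\<close>. Cosets through the same element are incident, and leaving a coset
  of type \<open>j\<close> can multiply the representative by an element of
  \<open>P (insert j J)\<close>. So walks in the residue correspond to products of such
  elements.\<close>

lemma residually_connected_iff:
  "residually_connected X \<longleftrightarrow>
    (\<forall>J\<subseteq>I. 2 \<le> card (I - J) \<longrightarrow> P J \<subseteq> generate G (\<Union>i\<in>I - J. P (insert i J)))"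
proof
  assume rc: "residually_connected X"
  show "\<forall>J\<subseteq>I. 2 \<le> card (I - J) \<longrightarrow> P J \<subseteq> generate G (\<Union>i\<in>I - J. P (insert i J))"
  proof (intro allI impI subsetI)
    fix J g assume J: "J \<subseteq> I" and two: "2 \<le> card (I - J)" and g: "g \<in> P J"
    let ?N = "generate G (\<Union>i\<in>I - J. P (insert i J))"
    let ?Y = "residue X (coset_flag (\<lambda>_. \<one>) J)"
    let ?r = "{(u, v). u \<in> elements ?Y \<and> v \<in> elements ?Y \<and> incident ?Y u v}"
    have N_sub: "subgroup ?N G" by (rule generate_is_subgroup) (auto simp: mem_P)
    have PN: "P (insert i J) \<subseteq> ?N" if "i \<in> I - J" for i
      using that by (blast intro: generate.incl)
    have NP: "?N \<subseteq> P J"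
      by (rule generate_subgroup_incl[OF _ subgroup_P[OF J]]) (auto simp: mem_P)
    have "connected_incidence_graph ?Y"
      using rc flag_std[OF J, of \<one>] two residue_rank unfolding residually_connected_def by auto
    have el: "elements ?Y = (\<Union>i\<in>I - J. (\<lambda>h. (i, h <# S i)) ` P J)"
      using elements_residue[OF J one_closed] by (simp add: mem_P image_def)
    have "I - J \<noteq> {}" using two by (metis card.empty not_numeral_le_zero)
    then obtain i where i: "i \<in> I - J" by blast
    have "(i, \<one> <# S i) \<in> elements ?Y" "(i, g <# S i) \<in> elements ?Y"
      unfolding el using i g P_closed(1)[OF J] by blast+
    then have "((i, \<one> <# S i), (i, g <# S i)) \<in> ?r\<^sup>*"
      using \<open>connected_incidence_graph ?Y\<close> unfolding connected_incidence_graph_def by blast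
    \<comment> \<open>Invariant of the walk: each coset reached contains an element of the generated
      subgroup.\<close>
    then have "\<exists>n\<in>?N. n \<in> snd (i, g <# S i)"
    proof (induction rule: rtrancl_induct)
      case base
      have "\<one> \<in> \<one> <# S i" using mem_coset[of i \<one> \<one>] i S_closed(1) by auto
      then show ?case using generate.one by force
    next
      case (step u v)
      then obtain n where n: "n \<in> ?N" "n \<in> snd u" by blast
      obtain j x where u: "u = (j, x <# S j)" "j \<in> I" "j \<notin> J" "x \<in> P J"
        using step.hyps(2) unfolding el by blast
      obtain k y where v: "v = (k, y <# S k)" "k \<in> I" "k \<notin> J" "y \<in> P J"
        using step.hyps(2) unfolding el by blast
      have nP: "n \<in> P J" using n(1) NP by blast
      have carr: "n \<in> carrier G" "x \<in> carrier G" "y \<in> carrier G" using nP u(4) v(4) mem_P by auto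
      have eq: "x <# S j = n <# S j"
        using n(2) mem_coset[OF u(2)] coset_eq_iff[OF u(2)] carr u(1) by simp
      have "incident X u v" using step.hyps(2) by (simp add: residue_def)
      then have inc: "incident X (j, n <# S j) (k, y <# S k)" using u(1) v(1) eq by simp
      show ?case
      proof (cases "j = k")
        case True
        then have "n <# S k = y <# S k"
          using incident_same_type[OF v(2) carr(1,3)] inc by simp
        then show ?thesis using n eq u(1) v(1) True by auto
      next
        case False
        \<comment> \<open>Regarded as an element of the residue of the larger flag through
          \<open>n\<close>, of type \<open>insert j J\<close>, the coset \<open>v\<close> has a
          representative \<open>n \<otimes> h\<close> with \<open>h\<close> in
          \<open>P (insert j J)\<close>.\<close>
        have "v \<in> elements (residue X (coset_flag (\<lambda>_. n) (insert j J)))"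
        proof -
          have "incident X v (i, n <# S i)" if "i \<in> J" for i
          proof -
            have iI: "i \<in> I" using that J by blast
            have "inv y \<otimes> y \<in> S k" using carr S_closed(1)[OF v(2)] by simp
            moreover have "inv n \<otimes> y \<in> S i"
              using that nP v(4) S_closed(2)[OF iI S_closed(3)[OF iI]] mem_P by blast
            ultimately show ?thesis
              unfolding v(1) using incident_iff[OF v(2) iI carr(3,1)] carr(3) by blast
          qed
          moreover have "incident X v (j, n <# S j)"
            using inc unfolding v(1) by (auto simp: incidence_def)
          moreover have "v \<in> elements X" using v carr by (auto simp: mem_elements)
          moreover have "v \<notin> coset_flag (\<lambda>_. n) (insert j J)"
            using v False by (auto simp: coset_flag_def)
          ultimately show ?thesis by (auto simp: residue_def coset_flag_def)
        qed
        then obtain h where h: "h \<in> P (insert j J)" "v = (k, (n \<otimes> h) <# S k)"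
          using elements_residue[of "insert j J" n] J u(2) carr(1) v(1) by auto
        have hN: "h \<in> ?N" using h(1) PN[of j] u(2,3) by blast
        have "h \<in> carrier G" using h(1) mem_P by blast
        then have "n \<otimes> h \<in> snd v"
          using mem_coset[OF v(2), of "n \<otimes> h"] S_closed(1)[OF v(2)] carr h(2) by simp
        then show ?thesis using subgroup.m_closed[OF N_sub n(1) hN] by blast
      qed
    qed
    then obtain n where n: "n \<in> ?N" "n \<in> g <# S i" by auto
    have carr: "n \<in> carrier G" "g \<in> carrier G" using n(1) NP g mem_P by blast+
    have "inv g \<otimes> n \<in> S i" using n(2) mem_coset carr i by blast
    moreover have "inv g \<otimes> n \<in> P J"
      using P_closed(2)[OF J P_closed(3)[OF J g]] n(1) NP by blast
    ultimately have "inv g \<otimes> n \<in> ?N" using PN[OF i] mem_P by blast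
    then have "n \<otimes> inv (inv g \<otimes> n) \<in> ?N"
      using subgroup.m_closed[OF N_sub n(1) subgroup.m_inv_closed[OF N_sub]] by blast
    then show "g \<in> ?N" using carr by (simp add: group_normalize)
  qed
next
  assume gen: "\<forall>J\<subseteq>I. 2 \<le> card (I - J) \<longrightarrow> P J \<subseteq> generate G (\<Union>i\<in>I - J. P (insert i J))"
  show "residually_connected X"
    unfolding residually_connected_def
  proof (intro allI impI, elim conjE)
    fix F assume F: "flag X F" and two: "2 \<le> rank (residue X F)"
    obtain g J where g: "g \<in> carrier G" and J: "J \<subseteq> I" and FJ: "F = coset_flag (\<lambda>_. g) J"
      using std_flagE[OF F] .
    let ?Y = "residue X F"
    let ?r = "{(u, v). u \<in> elements ?Y \<and> v \<in> elements ?Y \<and> incident ?Y u v}"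
    let ?e = "\<lambda>i h. (i, (g \<otimes> h) <# S i)"
    have gen': "P J \<subseteq> generate G (\<Union>i\<in>I - J. P (insert i J))"
      using gen J two residue_rank FJ by metis
    have el: "elements ?Y = (\<Union>i\<in>I - J. ?e i ` P J)"
      using elements_residue[OF J g] FJ by simp
    have link: "(?e i h, ?e k h) \<in> ?r\<^sup>*" if "i \<in> I - J" "k \<in> I - J" "h \<in> P J" for i k h
    proof -
      have "h \<in> carrier G" using that(3) mem_P by blast
      then have "g \<otimes> h \<in> (g \<otimes> h) <# S j" if "j \<in> I" for j
        using mem_coset[OF that, of "g \<otimes> h"] S_closed(1)[OF that] g by simp
      then have "incident ?Y (?e i h) (?e k h)"
        using that(1,2) by (auto simp: residue_def incidence_def)
      moreover have "?e i h \<in> elements ?Y" "?e k h \<in> elements ?Y"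
        unfolding el using that by blast+
      ultimately show ?thesis by blast
    qed
    have gen_P: "generate G (\<Union>i\<in>I - J. P (insert i J)) \<subseteq> P J"
      by (rule generate_subgroup_incl[OF _ subgroup_P[OF J]]) (auto simp: mem_P)
    \<comment> \<open>Pass to type \<open>k\<close>, where multiplying by \<open>h\<close> in
      \<open>S k\<close> does not change the coset, and then back to type \<open>i\<close>.\<close>
    have move_P: "(?e i x, ?e i (x \<otimes> h)) \<in> ?r\<^sup>*"
      if i: "i \<in> I - J" and x: "x \<in> P J" and k: "k \<in> I - J" and h: "h \<in> P (insert k J)"
      for i x k h
    proof -
      have xh: "x \<otimes> h \<in> P J" using P_closed(2)[OF J x, of h] h mem_P by auto
      have carr: "x \<in> carrier G" "h \<in> carrier G" using x h mem_P by auto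
      have "inv (g \<otimes> x) \<otimes> (g \<otimes> (x \<otimes> h)) = h" using carr g by (simp add: group_normalize)
      then have eq: "?e k x = ?e k (x \<otimes> h)"
        using coset_eq_iff[of k "g \<otimes> x" "g \<otimes> (x \<otimes> h)"] carr g k h mem_P by auto
      show ?thesis
        using link[OF i k x, unfolded eq] link[OF k i xh] by (rule rtrancl_trans)
    qed
    have move: "\<forall>i\<in>I - J. \<forall>x\<in>P J. (?e i x, ?e i (x \<otimes> h)) \<in> ?r\<^sup>*"
      if "h \<in> generate G (\<Union>i\<in>I - J. P (insert i J))" for h
      using that
    proof induction
      case one
      then show ?case by (auto simp: mem_P)
    next
      case (incl h)
      then show ?case using move_P by blast
    next
      case (inv h)
      then obtain k where k: "k \<in> I - J" "h \<in> P (insert k J)" by blast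
      then have "inv h \<in> P (insert k J)" using P_closed(3)[of "insert k J"] J by blast
      then show ?case using move_P k(1) by blast
    next
      case (eng h1 h2)
      have h: "h1 \<in> P J" "h2 \<in> P J" using eng.hyps gen_P by blast+
      show ?case
      proof (intro ballI)
        fix i x assume i: "i \<in> I - J" and x: "x \<in> P J"
        have "(?e i x, ?e i (x \<otimes> h1)) \<in> ?r\<^sup>*" using eng.IH(1) i x by blast
        moreover have "(?e i (x \<otimes> h1), ?e i (x \<otimes> h1 \<otimes> h2)) \<in> ?r\<^sup>*"
          using eng.IH(2) i P_closed(2)[OF J x h(1)] by blast
        moreover have "x \<otimes> h1 \<otimes> h2 = x \<otimes> (h1 \<otimes> h2)" using x h mem_P by (simp add: m_assoc)
        ultimately show "(?e i x, ?e i (x \<otimes> (h1 \<otimes> h2))) \<in> ?r\<^sup>*"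
          by (simp only:)
      qed
    qed
    show "connected_incidence_graph ?Y"
      unfolding connected_incidence_graph_def
    proof (intro ballI)
      fix u v assume "u \<in> elements ?Y" "v \<in> elements ?Y"
      then obtain i h k h' where u: "u = ?e i h" "i \<in> I - J" "h \<in> P J"
        and v: "v = ?e k h'" "k \<in> I - J" "h' \<in> P J"
        unfolding el by blast
      have "inv h \<otimes> h' \<in> P J" using P_closed(2)[OF J P_closed(3)[OF J u(3)] v(3)] .
      then have "(?e i h, ?e i (h \<otimes> (inv h \<otimes> h'))) \<in> ?r\<^sup>*" using move gen' u(2,3) by blast
      moreover have "h \<otimes> (inv h \<otimes> h') = h'" using u(3) v(3) mem_P by (simp add: mult_inv_cancel)
      ultimately have "(?e i h, ?e i h') \<in> ?r\<^sup>*" by (simp only:)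
      then have "(?e i h, ?e k h') \<in> ?r\<^sup>*"
        using link[OF u(2) v(2,3)] by (rule rtrancl_trans)
      then show "(u, v) \<in> ?r\<^sup>*" using u(1) v(1) by simp
    qed
  qed
qed

text \<open>Left multiplication by \<open>g\<close> maps \<open>D i\<close> bijectively onto the
  residue of the flag of type \<open>I - {i}\<close> through \<open>g\<close>, so one residue for
  each type decides.\<close>

lemma corank_one_residues_iff:
  defines "D \<equiv> \<lambda>i. (\<lambda>h. h <# S i) ` P (I - {i})"
  shows "corank_one_residues Q X \<longleftrightarrow> (\<forall>i\<in>I. Q (finite (D i)) (card (D i)))" (is "?L \<longleftrightarrow> ?R")
proof -
  have corank: "corank X (coset_flag x J) = card I - card J" for x J
    by (simp add: corank_def rank_def card_coset_flag) (simp add: incidence_def)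
  have residue: "finite (elements (residue X (coset_flag (\<lambda>_. g) (I - {i})))) = finite (D i)"
    "card (elements (residue X (coset_flag (\<lambda>_. g) (I - {i})))) = card (D i)"
    if i: "i \<in> I" and g: "g \<in> carrier G" for i g
  proof -
    let ?E = "elements (residue X (coset_flag (\<lambda>_. g) (I - {i})))"
    define f where "f Y = (i, g <# Y)" for Y
    have S_sub: "S i \<subseteq> carrier G" using S_inG[OF i] by blast
    have "?E = (\<lambda>h. (i, (g \<otimes> h) <# S i)) ` P (I - {i})"
      using elements_residue[of "I - {i}" g] i g by (simp add: double_diff)
    also have "\<dots> = f ` D i"
      unfolding D_def f_def image_image using lcos_m_assoc[OF S_sub g] mem_P
      by (intro image_cong) auto
    finally have E: "?E = f ` D i" .
    have "Y \<subseteq> carrier G" if "Y \<in> D i" for Y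
      using that l_coset_subset_G[OF S_sub] mem_P unfolding D_def by blast
    then have cancel: "inv g <# (g <# Y) = Y" if "Y \<in> D i" for Y
      using that lcos_m_assoc[of Y "inv g" g] lcos_mult_one[of Y] g by simp
    have "inj_on f (D i)"
      by (rule inj_on_inverseI[where g = "\<lambda>z. inv g <# snd z"]) (simp add: f_def cancel)
    then show "finite ?E = finite (D i)" "card ?E = card (D i)"
      unfolding E by (auto simp: finite_image_iff card_image)
  qed
  show ?thesis
  proof
    assume L: ?L
    show ?R
    proof
      fix i assume i: "i \<in> I"
      have "card I = Suc (card (I - {i}))" using card.remove[OF finite_I i] .
      then have "corank X (coset_flag (\<lambda>_. \<one>) (I - {i})) = 1" unfolding corank by simp
      then show "Q (finite (D i)) (card (D i))"
        using L[unfolded corank_one_residues_def, rule_format, of "coset_flag (\<lambda>_. \<one>) (I - {i})"] flag_std[of "I - {i}" \<one>]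
        unfolding residue[OF i one_closed] by auto
    qed
  next
    assume R: ?R
    show ?L
      unfolding corank_one_residues_def
    proof (intro allI impI, elim conjE)
      fix F assume F: "flag X F" "corank X F = 1"
      obtain g J where g: "g \<in> carrier G" "J \<subseteq> I" "F = coset_flag (\<lambda>_. g) J"
        using std_flagE[OF F(1)] .
      have "card (I - J) = 1"
        using F(2) corank g finite_I finite_subset by (metis card_Diff_subset)
      then obtain i where i: "I - J = {i}" by (rule card_1_singletonE)
      then have J: "J = I - {i}" "i \<in> I" using g(2) by auto
      show "Q (finite (elements (residue X F))) (card (elements (residue X F)))"
        using R residue[OF J(2) g(1)] J g(3) by simp
    qed
  qed
qed

end

section \<open>The normal form theorem\<close>

text \<open>The choice is made from the coset as a set, so the representative depends on the right
  coset alone; \<open>D\<close> itself is represented by the identity.\<close>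

definition coset_rep :: "'h monoid \<Rightarrow> 'h set \<Rightarrow> 'h \<Rightarrow> 'h" where
  "coset_rep H D h = (if h \<in> D then \<one>\<^bsub>H\<^esub> else (SOME x. x \<in> D #>\<^bsub>H\<^esub> h))"

text \<open>An element \<open>c t\<^sub>1 \<dots> t\<^sub>n\<close> in normal form is encoded as the pair \<open>(c, [t\<^sub>1, \<dots>, t\<^sub>n])\<close> with \<open>c\<close> in the
  amalgamated subgroup \<open>K\<close> and coset representatives \<open>t\<^sub>i\<close>, which the injection \<open>e\<close> marks with their factor.
  Splitting off the part in the factor \<open>H\<close> identifies the set of normal forms with a free left
  \<open>H\<close>-set.\<close>

locale amalgam_factor = K: group K + H: group H
  for K :: "'c monoid" and H :: "'h monoid" (structure) +
  fixes \<kappa> :: "'c \<Rightarrow> 'h" and e :: "'h \<Rightarrow> 'l" and W :: "'l list set"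
  assumes \<kappa>_hom: "\<kappa> \<in> hom K H" and \<kappa>_inj: "inj_on \<kappa> (carrier K)" and e_inj: "inj e"
    and W_Cons: "e t # w \<in> W \<longleftrightarrow> t \<in> carrier H \<and> t \<notin> \<kappa> ` carrier K \<and>
      coset_rep H (\<kappa> ` carrier K) t = t \<and> w \<in> W \<and> (w \<noteq> [] \<longrightarrow> hd w \<notin> range e)"
begin

abbreviation D :: "'h set" where
  "D \<equiv> \<kappa> ` carrier K"

abbreviation rep :: "'h \<Rightarrow> 'h" where
  "rep \<equiv> coset_rep H D"

abbreviation starts :: "'l list \<Rightarrow> bool" where
  "starts w \<equiv> w \<noteq> [] \<and> hd w \<in> range e"

definition split :: "'c \<times> 'l list \<Rightarrow> 'h \<times> 'l list" where
  "split = (\<lambda>(c, w). if starts w then (\<kappa> c \<otimes> inv_into UNIV e (hd w), tl w) else (\<kappa> c, w))"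

text \<open>An element \<open>h\<close> outside \<open>D\<close> factors as
  \<open>d \<otimes> rep h\<close> with \<open>d = h \<otimes> inv (rep h)\<close> in
  \<open>D\<close>. The preimage of \<open>d\<close> becomes the component in \<open>K\<close>, and
  \<open>rep h\<close> the new first syllable.\<close>

definition join :: "'h \<times> 'l list \<Rightarrow> 'c \<times> 'l list" where
  "join = (\<lambda>(h, w). if h \<in> D then (inv_into (carrier K) \<kappa> h, w)
     else (inv_into (carrier K) \<kappa> (h \<otimes> inv (rep h)), e (rep h) # w))"

definition act :: "'h \<Rightarrow> 'c \<times> 'l list \<Rightarrow> 'c \<times> 'l list" where
  "act h \<omega> = join (h \<otimes> fst (split \<omega>), snd (split \<omega>))"

lemma \<kappa>_group_hom: "group_hom K H \<kappa>"
  by unfold_locales (rule \<kappa>_hom)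

lemma \<kappa>_closed: "c \<in> carrier K \<Longrightarrow> \<kappa> c \<in> carrier H"
  using \<kappa>_hom by (auto simp: hom_def)

lemma \<kappa>_mult: "c \<in> carrier K \<Longrightarrow> d \<in> carrier K \<Longrightarrow> \<kappa> (c \<otimes>\<^bsub>K\<^esub> d) = \<kappa> c \<otimes> \<kappa> d"
  using \<kappa>_hom by (auto simp: hom_def)

lemma subgroup_D: "subgroup D H"
  using group_hom.img_is_subgroup[OF \<kappa>_group_hom] .

lemma D_inH: "d \<in> D \<Longrightarrow> d \<in> carrier H"
  using \<kappa>_closed by blast

lemma inv_\<kappa>: "c \<in> carrier K \<Longrightarrow> inv_into (carrier K) \<kappa> (\<kappa> c) = c"
  using \<kappa>_inj by simp

lemma \<kappa>_inv: "d \<in> D \<Longrightarrow> \<kappa> (inv_into (carrier K) \<kappa> d) = d"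
  by (rule f_inv_into_f)

lemma inv_\<kappa>_closed: "d \<in> D \<Longrightarrow> inv_into (carrier K) \<kappa> d \<in> carrier K"
  by (rule inv_into_into)

lemma D_mult_iff:
  assumes "d \<in> D" "h \<in> carrier H"
  shows "d \<otimes> h \<in> D \<longleftrightarrow> h \<in> D"
proof
  assume "d \<otimes> h \<in> D"
  then have "inv d \<otimes> (d \<otimes> h) \<in> D"
    using subgroup.m_closed[OF subgroup_D subgroup.m_inv_closed[OF subgroup_D assms(1)]] by blast
  then show "h \<in> D" using assms D_inH by (simp add: H.inv_mult_cancel)
next
  assume "h \<in> D"
  then show "d \<otimes> h \<in> D" using subgroup.m_closed[OF subgroup_D assms(1)] by blast
qed

lemma rep_in_coset:
  assumes h: "h \<in> carrier H"
  obtains d where "d \<in> D" "rep h = d \<otimes> h"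
proof (cases "h \<in> D")
  case True
  then show ?thesis
    using that[of "inv h"] subgroup.m_inv_closed[OF subgroup_D True] h by (simp add: coset_rep_def)
next
  case False
  have "h \<in> D #> h" using H.rcos_self[OF h subgroup_D] .
  then have "(SOME x. x \<in> D #> h) \<in> D #> h" by (rule someI)
  then have "rep h \<in> D #> h" using False by (simp add: coset_rep_def)
  then show ?thesis using that unfolding r_coset_def by blast
qed

lemma rep_closed: "h \<in> carrier H \<Longrightarrow> rep h \<in> carrier H"
  using rep_in_coset[of h] D_inH by (metis H.m_closed)

lemma rep_in_D_iff: "h \<in> carrier H \<Longrightarrow> rep h \<in> D \<longleftrightarrow> h \<in> D"
  using rep_in_coset[of h] D_mult_iff by metis

lemma mult_inv_rep:
  assumes h: "h \<in> carrier H"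
  shows "h \<otimes> inv (rep h) \<in> D"
proof -
  obtain d where d: "d \<in> D" "rep h = d \<otimes> h" using rep_in_coset[OF h] .
  then have "h \<otimes> inv (rep h) = inv d"
    using h D_inH[OF d(1)] by (simp add: H.inv_mult_group H.mult_inv_cancel)
  then show ?thesis using subgroup.m_inv_closed[OF subgroup_D d(1)] by simp
qed

lemma rep_mult:
  assumes d: "d \<in> D" and h: "h \<in> carrier H"
  shows "rep (d \<otimes> h) = rep h"
proof -
  have "D #> (d \<otimes> h) = D #> h"
    using H.coset_mult_assoc[of D d h] subgroup.subset[OF subgroup_D] D_inH[OF d] h
      H.coset_join2[OF D_inH[OF d] subgroup_D d] by simp
  then show ?thesis using D_mult_iff[OF d h] by (simp add: coset_rep_def)
qed

lemma rep_rep: "h \<in> carrier H \<Longrightarrow> rep (rep h) = rep h"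
  using rep_in_coset[of h] rep_mult by metis

lemma join_closed:
  assumes "h \<in> carrier H" "w \<in> W" "\<not> starts w"
  shows "join (h, w) \<in> carrier K \<times> W"
  using assms inv_\<kappa>_closed mult_inv_rep rep_closed rep_rep rep_in_D_iff
  by (auto simp: join_def W_Cons)

lemma split_join:
  assumes "h \<in> carrier H" "\<not> starts w"
  shows "split (join (h, w)) = (h, w)"
proof (cases "h \<in> D")
  case True
  then show ?thesis using assms \<kappa>_inv by (auto simp: join_def split_def)
next
  case False
  then show ?thesis
    using assms \<kappa>_inv[OF mult_inv_rep[OF assms(1)]] e_inj rep_closed
    by (auto simp: join_def split_def H.m_assoc)
qed

lemma split_closed:
  assumes "\<omega> \<in> carrier K \<times> W"
  shows "fst (split \<omega>) \<in> carrier H" "snd (split \<omega>) \<in> W" "\<not> starts (snd (split \<omega>))"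
proof -
  obtain c w where \<omega>: "\<omega> = (c, w)" "c \<in> carrier K" "w \<in> W" using assms by blast
  have "fst (split \<omega>) \<in> carrier H \<and> snd (split \<omega>) \<in> W \<and> \<not> starts (snd (split \<omega>))"
  proof (cases "starts w")
    case True
    then obtain t w' where w: "w = e t # w'" by (cases w) auto
    then show ?thesis using \<omega> W_Cons[of t w'] \<kappa>_closed e_inj by (auto simp: split_def)
  next
    case False
    then show ?thesis using \<omega> \<kappa>_closed by (auto simp: split_def)
  qed
  then show "fst (split \<omega>) \<in> carrier H" "snd (split \<omega>) \<in> W" "\<not> starts (snd (split \<omega>))" by auto
qed

text \<open>Left multiplication by an element of \<open>D\<close> preserves membership in
  \<open>D\<close> and the coset representative, so the word is untouched. The result does not
  mention the factor, which is why the two actions agree on the amalgamated subgroup; for the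
  identity \<open>c\<close> it says that \<open>join\<close> undoes \<open>split\<close>.\<close>

lemma join_\<kappa>_split:
  assumes c: "c \<in> carrier K" and \<omega>: "(c', w) \<in> carrier K \<times> W"
  shows "join (\<kappa> c \<otimes> fst (split (c', w)), snd (split (c', w))) = (c \<otimes>\<^bsub>K\<^esub> c', w)"
proof -
  have c': "c' \<in> carrier K" "w \<in> W" using \<omega> by auto
  have cc: "\<kappa> c \<in> carrier H" "\<kappa> c' \<in> carrier H" using c c' \<kappa>_closed by auto
  show ?thesis
  proof (cases "starts w")
    case True
    then obtain t w' where w: "w = e t # w'" by (cases w) auto
    then have t: "t \<in> carrier H" "t \<notin> D" "rep t = t" using W_Cons[of t w'] c'(2) by auto
    have "\<kappa> (c \<otimes>\<^bsub>K\<^esub> c') \<in> D" using c c' by auto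
    then have "\<kappa> (c \<otimes>\<^bsub>K\<^esub> c') \<otimes> t \<notin> D" "rep (\<kappa> (c \<otimes>\<^bsub>K\<^esub> c') \<otimes> t) = t"
      using D_mult_iff rep_mult t by auto
    moreover have "\<kappa> c \<otimes> (\<kappa> c' \<otimes> t) = \<kappa> (c \<otimes>\<^bsub>K\<^esub> c') \<otimes> t"
      "\<kappa> (c \<otimes>\<^bsub>K\<^esub> c') \<otimes> t \<otimes> inv t = \<kappa> (c \<otimes>\<^bsub>K\<^esub> c')"
      using c c' cc t by (simp_all add: \<kappa>_mult H.m_assoc)
    ultimately show ?thesis
      using w e_inj c c' by (simp add: split_def join_def inv_\<kappa>)
  next
    case False
    have "\<kappa> c \<otimes> \<kappa> c' = \<kappa> (c \<otimes>\<^bsub>K\<^esub> c')" using c c' \<kappa>_mult by simp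
    then show ?thesis using False c c' by (auto simp: split_def join_def inv_\<kappa>)
  qed
qed

lemma act_\<kappa>:
  assumes "c \<in> carrier K" "c' \<in> carrier K" "w \<in> W"
  shows "act (\<kappa> c) (c', w) = (c \<otimes>\<^bsub>K\<^esub> c', w)"
  using join_\<kappa>_split assms by (simp add: act_def)

lemma act_closed: "h \<in> carrier H \<Longrightarrow> \<omega> \<in> carrier K \<times> W \<Longrightarrow> act h \<omega> \<in> carrier K \<times> W"
  unfolding act_def using split_closed by (intro join_closed) auto

lemma act_one:
  assumes \<omega>: "\<omega> \<in> carrier K \<times> W"
  shows "act \<one> \<omega> = \<omega>"
proof -
  have "\<kappa> \<one>\<^bsub>K\<^esub> = \<one>" using group_hom.hom_one[OF \<kappa>_group_hom] .
  then show ?thesis using act_\<kappa>[OF K.one_closed] \<omega> by (metis K.l_one SigmaE)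
qed

lemma act_mult:
  assumes "h \<in> carrier H" "k \<in> carrier H" "\<omega> \<in> carrier K \<times> W"
  shows "act (h \<otimes> k) \<omega> = act h (act k \<omega>)"
  using split_closed[OF assms(3)] assms(1,2) by (simp add: act_def split_join H.m_assoc)

lemma act_Bij: "h \<in> carrier H \<Longrightarrow> restrict (act h) (carrier K \<times> W) \<in> Bij (carrier K \<times> W)"
proof -
  assume h: "h \<in> carrier H"
  have inverse: "act k (act k' \<omega>) = \<omega>"
    if "k \<in> carrier H" "k' \<in> carrier H" "k \<otimes> k' = \<one>" "\<omega> \<in> carrier K \<times> W" for k k' \<omega>
    using act_mult[OF that(1,2,4)] act_one[OF that(4)] that(3) by simp
  have "bij_betw (act h) (carrier K \<times> W) (carrier K \<times> W)"
  proof (rule bij_betw_byWitness[where f' = "act (inv h)"])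
    show "\<forall>\<omega>\<in>carrier K \<times> W. act (inv h) (act h \<omega>) = \<omega>"
      "\<forall>\<omega>\<in>carrier K \<times> W. act h (act (inv h) \<omega>) = \<omega>"
      using inverse[OF H.inv_closed[OF h] h H.l_inv[OF h]]
        inverse[OF h H.inv_closed[OF h] H.r_inv[OF h]] by blast+
    show "act h ` (carrier K \<times> W) \<subseteq> carrier K \<times> W" "act (inv h) ` (carrier K \<times> W) \<subseteq> carrier K \<times> W"
      using act_closed[OF h] act_closed[OF H.inv_closed[OF h]] by blast+
  qed
  then show ?thesis by (simp add: Bij_def bij_betw_restrict_eq)
qed

lemma act_hom: "(\<lambda>h. restrict (act h) (carrier K \<times> W)) \<in> hom H (BijGroup (carrier K \<times> W))"
proof (rule homI)
  fix h k assume hk: "h \<in> carrier H" "k \<in> carrier H"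
  show "restrict (act (h \<otimes> k)) (carrier K \<times> W) =
      restrict (act h) (carrier K \<times> W) \<otimes>\<^bsub>BijGroup (carrier K \<times> W)\<^esub> restrict (act k) (carrier K \<times> W)"
    using hk act_Bij act_closed act_mult
    by (auto simp: BijGroup_def compose_def fun_eq_iff)
qed (simp add: BijGroup_def act_Bij)

text \<open>If the word does not start on this side, the part of \<open>\<omega>\<close> in
  \<open>H\<close> is an element of \<open>D\<close>. Multiplying it by \<open>h\<close> leads
  outside \<open>D\<close>, where \<open>join\<close> puts a new syllable in front.\<close>

lemma starts_act:
  assumes h: "h \<in> carrier H" "h \<notin> D" and \<omega>: "\<omega> \<in> carrier K \<times> W" "\<not> starts (snd \<omega>)"
  shows "starts (snd (act h \<omega>))"
proof -
  obtain c w where "\<omega> = (c, w)" by (cases \<omega>)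
  with \<omega> have cw: "\<omega> = (c, w)" "c \<in> carrier K" "\<not> starts w" by simp_all
  have "h \<otimes> \<kappa> c \<notin> D"
  proof
    assume "h \<otimes> \<kappa> c \<in> D"
    then have "h \<otimes> \<kappa> c \<otimes> inv (\<kappa> c) \<in> D"
      using subgroup.m_closed[OF subgroup_D _ subgroup.m_inv_closed[OF subgroup_D imageI[OF cw(2)]]]
      by blast
    then show False using h cw(2) \<kappa>_closed by (simp add: H.m_assoc)
  qed
  moreover have "split \<omega> = (\<kappa> c, w)" unfolding cw(1) split_def prod.case if_not_P[OF cw(3)] ..
  ultimately show ?thesis unfolding act_def join_def by simp
qed

text \<open>\<open>split\<close> recovers the group element from its effect on the normal form of
  the identity; hence the factor maps are injective.\<close>

lemma act_start_inj:
  assumes "h \<in> carrier H" "k \<in> carrier H"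
    and "act h (\<one>\<^bsub>K\<^esub>, []) = act k (\<one>\<^bsub>K\<^esub>, [])"
  shows "h = k"
proof -
  have "split (act h (\<one>\<^bsub>K\<^esub>, [])) = (h, [])" if "h \<in> carrier H" for h
    using that group_hom.hom_one[OF \<kappa>_group_hom] split_join[of h "[]"]
    by (simp add: act_def split_def)
  then show ?thesis using assms by (metis prod.inject)
qed

end

section \<open>The amalgamated product acting on normal forms\<close>

locale amalgamation = A: group A + B: group B
  for A :: "'a monoid" and B :: "'b monoid" +
  fixes C :: "'a set" and \<phi> :: "'a \<Rightarrow> 'b"
  assumes C_subgroup: "subgroup C A"
    and \<phi>_hom: "\<phi> \<in> hom (A\<lparr>carrier := C\<rparr>) B" and \<phi>_inj: "inj_on \<phi> C"
begin

abbreviation G :: "('a + 'b) list set monoid" where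
  "G \<equiv> amalgamated_product A B C \<phi>"

abbreviation \<iota>\<^sub>A :: "'a \<Rightarrow> ('a + 'b) list set" where
  "\<iota>\<^sub>A \<equiv> amalgam_left A B C \<phi>"

abbreviation \<iota>\<^sub>B :: "'b \<Rightarrow> ('a + 'b) list set" where
  "\<iota>\<^sub>B \<equiv> amalgam_right A B C \<phi>"

lemma C_le: "C \<subseteq> carrier A"
  using C_subgroup subgroup.subset by blast

lemma \<phi>_le: "\<phi> ` C \<subseteq> carrier B"
  using \<phi>_hom by (auto simp: hom_def)

lemmas amalgam_groups = A.is_group B.is_group C_le \<phi>_le

lemma group_G: "group G"
  by (rule group_amalgamated_product[OF amalgam_groups])

lemma group_hom_\<iota>\<^sub>A: "group_hom A G \<iota>\<^sub>A"
  by (intro group_hom.intro group_hom_axioms.intro A.is_group group_G amalgam_left_hom[OF amalgam_groups])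

lemma group_hom_\<iota>\<^sub>B: "group_hom B G \<iota>\<^sub>B"
  by (intro group_hom.intro group_hom_axioms.intro B.is_group group_G amalgam_right_hom[OF amalgam_groups])

lemmas \<iota>_eq = amalgam_left_eq_right[OF amalgam_groups]

definition factor :: "bool \<Rightarrow> ('a + 'b) list set set" where
  "factor s = (if s then \<iota>\<^sub>A ` carrier A else \<iota>\<^sub>B ` carrier B)"

text \<open>One set of words, with \<open>Inl\<close> and \<open>Inr\<close> as marks, serves for
  both factors, so that both act on the same set \<open>\<Omega>\<close>.\<close>

primrec reduced :: "('a + 'b) list \<Rightarrow> bool" where
  "reduced [] \<longleftrightarrow> True"
| "reduced (z # w) \<longleftrightarrow>
    (case z of
      Inl t \<Rightarrow> t \<in> carrier A \<and> t \<notin> C \<and> coset_rep A C t = t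
    | Inr t \<Rightarrow> t \<in> carrier B \<and> t \<notin> \<phi> ` C \<and> coset_rep B (\<phi> ` C) t = t) \<and>
    reduced w \<and> (w \<noteq> [] \<longrightarrow> isl (hd w) \<noteq> isl z)"

lemma range_Inl_iff: "z \<in> range Inl \<longleftrightarrow> isl z"
  by (cases z) auto

lemma range_Inr_iff: "z \<in> range Inr \<longleftrightarrow> \<not> isl z"
  by (cases z) auto

sublocale L: amalgam_factor "A\<lparr>carrier := C\<rparr>" A id Inl "Collect reduced"
proof (intro amalgam_factor.intro amalgam_factor_axioms.intro)
  show "group (A\<lparr>carrier := C\<rparr>)" using subgroup.subgroup_is_group[OF C_subgroup A.is_group] .
  show "id \<in> hom (A\<lparr>carrier := C\<rparr>) A" using C_le by (auto simp: hom_def)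
qed (auto simp: A.is_group range_Inl_iff)

sublocale R: amalgam_factor "A\<lparr>carrier := C\<rparr>" B \<phi> Inr "Collect reduced"
  using \<phi>_hom \<phi>_inj
  by (intro amalgam_factor.intro amalgam_factor_axioms.intro)
    (auto simp: B.is_group L.K.is_group range_Inr_iff)

abbreviation \<Omega> :: "('a \<times> ('a + 'b) list) set" where
  "\<Omega> \<equiv> C \<times> Collect reduced"

text \<open>The two actions agree on the amalgamated subgroup, so the universal property combines
  them into a homomorphism from \<open>G\<close> to the permutations of \<open>\<Omega>\<close>.
  Only its equations on \<open>\<Omega>\<close> are kept, free of the restrictions that
  \<open>BijGroup\<close> requires.\<close>

lemma ex_act:
  obtains h where "\<forall>x\<in>carrier G. \<forall>y\<in>carrier G. \<forall>\<omega>\<in>\<Omega>. h (x \<otimes>\<^bsub>G\<^esub> y) \<omega> = h x (h y \<omega>)"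
    "\<forall>a\<in>carrier A. \<forall>\<omega>\<in>\<Omega>. h (\<iota>\<^sub>A a) \<omega> = L.act a \<omega>"
    "\<forall>b\<in>carrier B. \<forall>\<omega>\<in>\<Omega>. h (\<iota>\<^sub>B b) \<omega> = R.act b \<omega>"
proof -
  have "restrict (L.act c) \<Omega> = restrict (R.act (\<phi> c)) \<Omega>" if "c \<in> C" for c
    using L.act_\<kappa> R.act_\<kappa> that by (intro restrict_ext) auto
  then obtain h where h: "h \<in> hom G (BijGroup \<Omega>)"
    "\<And>a. a \<in> carrier A \<Longrightarrow> h (\<iota>\<^sub>A a) = restrict (L.act a) \<Omega>"
    "\<And>b. b \<in> carrier B \<Longrightarrow> h (\<iota>\<^sub>B b) = restrict (R.act b) \<Omega>"
    using amalgamated_product_universal[OF amalgam_groups group_BijGroup[of \<Omega>]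
        L.act_hom[simplified] R.act_hom[simplified]] by auto
  have "h (x \<otimes>\<^bsub>G\<^esub> y) \<omega> = h x (h y \<omega>)" if "x \<in> carrier G" "y \<in> carrier G" "\<omega> \<in> \<Omega>" for x y \<omega>
  proof -
    have "h x \<in> Bij \<Omega>" "h y \<in> Bij \<Omega>" using that hom_in_carrier[OF h(1)] by (auto simp: BijGroup_def)
    then have "h (x \<otimes>\<^bsub>G\<^esub> y) = compose \<Omega> (h x) (h y)"
      using hom_mult[OF h(1) that(1,2)] by (simp add: BijGroup_def)
    then show ?thesis using that(3) by (simp add: compose_def)
  qed
  moreover have "h (\<iota>\<^sub>A a) \<omega> = L.act a \<omega>" if "a \<in> carrier A" "\<omega> \<in> \<Omega>" for a \<omega>
    using h(2)[OF that(1)] that(2) by simp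
  moreover have "h (\<iota>\<^sub>B b) \<omega> = R.act b \<omega>" if "b \<in> carrier B" "\<omega> \<in> \<Omega>" for b \<omega>
    using h(3)[OF that(1)] that(2) by simp
  ultimately show ?thesis using that[of h] by simp
qed

lemma generated: "carrier G = generate G (factor True \<union> factor False)"
proof
  interpret G: group G by (rule group_G)
  let ?R = "amalgam_rel A B C \<phi>"
  have sub: "factor True \<union> factor False \<subseteq> carrier G"
    using group_hom.hom_closed[OF group_hom_\<iota>\<^sub>A] group_hom.hom_closed[OF group_hom_\<iota>\<^sub>B]
    by (auto simp: factor_def)
  then show "generate G (factor True \<union> factor False) \<subseteq> carrier G"
    by (rule G.generate_incl)
  show "carrier G \<subseteq> generate G (factor True \<union> factor False)"
  proof
    fix X assume "X \<in> carrier G"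
    then obtain w where w: "w \<in> amalgam_words A B" "X = ?R `` {w}"
      unfolding amalgamated_product_def by (auto simp: quotient_def)
    have "?R `` {w} \<in> generate G (factor True \<union> factor False)"
      using w(1)
    proof (induction w)
      case Nil
      show ?case using generate.one[of G] by (simp add: amalgamated_product_def)
    next
      case (Cons z w)
      have zw: "[z] \<in> amalgam_words A B" "w \<in> amalgam_words A B"
        using Cons.prems by (cases z; simp)+
      have "?R `` {[z]} \<in> factor True \<union> factor False"
        using zw(1) by (cases z) (auto simp: factor_def amalgam_left_def amalgam_right_def)
      then have "?R `` {[z]} \<otimes>\<^bsub>G\<^esub> ?R `` {w} \<in> generate G (factor True \<union> factor False)"
        by (rule generate.eng[OF generate.incl Cons.IH[OF zw(2)]])
      then show ?case using amalgamated_product_mult[OF amalgam_groups zw] by simp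
    qed
    then show "X \<in> generate G (factor True \<union> factor False)" using w(2) by simp
  qed
qed

lemma inj_\<iota>: "inj_on \<iota>\<^sub>A (carrier A)" "inj_on \<iota>\<^sub>B (carrier B)"
proof -
  obtain h where h: "\<forall>x\<in>carrier G. \<forall>y\<in>carrier G. \<forall>\<omega>\<in>\<Omega>. h (x \<otimes>\<^bsub>G\<^esub> y) \<omega> = h x (h y \<omega>)"
    "\<forall>a\<in>carrier A. \<forall>\<omega>\<in>\<Omega>. h (\<iota>\<^sub>A a) \<omega> = L.act a \<omega>"
    "\<forall>b\<in>carrier B. \<forall>\<omega>\<in>\<Omega>. h (\<iota>\<^sub>B b) \<omega> = R.act b \<omega>"
    using ex_act .
  note h = h[rule_format]
  have \<omega>: "(\<one>\<^bsub>A\<^esub>, []) \<in> \<Omega>" using subgroup.one_closed[OF C_subgroup] by simp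
  show "inj_on \<iota>\<^sub>A (carrier A)"
  proof (rule inj_onI)
    fix a b assume ab: "a \<in> carrier A" "b \<in> carrier A" "\<iota>\<^sub>A a = \<iota>\<^sub>A b"
    then have "L.act a (\<one>\<^bsub>A\<^esub>, []) = L.act b (\<one>\<^bsub>A\<^esub>, [])"
      using h(2)[OF ab(1) \<omega>] h(2)[OF ab(2) \<omega>] by simp
    then show "a = b" using L.act_start_inj[OF ab(1,2)] by simp
  qed
  show "inj_on \<iota>\<^sub>B (carrier B)"
  proof (rule inj_onI)
    fix a b assume ab: "a \<in> carrier B" "b \<in> carrier B" "\<iota>\<^sub>B a = \<iota>\<^sub>B b"
    then have "R.act a (\<one>\<^bsub>A\<^esub>, []) = R.act b (\<one>\<^bsub>A\<^esub>, [])"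
      using h(3)[OF ab(1) \<omega>] h(3)[OF ab(2) \<omega>] by simp
    then show "a = b" using R.act_start_inj[OF ab(1,2)] by simp
  qed
qed

text \<open>The side of the first syllable is visible in the action on the normal form
  \<open>\<omega>\<^sub>0\<close> of the identity: a tail for side \<open>s\<close> gives a normal
  form not beginning on side \<open>s\<close>, and a syllable of \<open>factor s\<close> outside the
  image of \<open>C\<close> is put in front of it. The same test shows that elements of both factors
  lie in the image of \<open>C\<close>.\<close>

sublocale amalgamated_group G factor "\<iota>\<^sub>A ` C"
proof -
  interpret G: group G by (rule group_G)
  obtain h where h: "\<forall>x\<in>carrier G. \<forall>y\<in>carrier G. \<forall>\<omega>\<in>\<Omega>. h (x \<otimes>\<^bsub>G\<^esub> y) \<omega> = h x (h y \<omega>)"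
    "\<forall>a\<in>carrier A. \<forall>\<omega>\<in>\<Omega>. h (\<iota>\<^sub>A a) \<omega> = L.act a \<omega>"
    "\<forall>b\<in>carrier B. \<forall>\<omega>\<in>\<Omega>. h (\<iota>\<^sub>B b) \<omega> = R.act b \<omega>"
    using ex_act .
  note h = h[rule_format]
  define \<omega>\<^sub>0 :: "'a \<times> ('a + 'b) list" where "\<omega>\<^sub>0 = (\<one>\<^bsub>A\<^esub>, [])"
  define starts where "starts s w \<longleftrightarrow> w \<noteq> [] \<and> isl (hd w) = s" for s and w :: "('a + 'b) list"
  have \<omega>\<^sub>0: "\<omega>\<^sub>0 \<in> \<Omega>" using subgroup.one_closed[OF C_subgroup] by (simp add: \<omega>\<^sub>0_def)
  have sub: "subgroup (factor s) G" for s
    using group_hom.img_is_subgroup[OF group_hom_\<iota>\<^sub>A] group_hom.img_is_subgroup[OF group_hom_\<iota>\<^sub>B]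
    by (simp add: factor_def)
  have factor_carrier: "factor s \<subseteq> carrier G" for s using subgroup.subset[OF sub] .
  have core: "h x \<omega>\<^sub>0 \<in> \<Omega> \<and> snd (h x \<omega>\<^sub>0) = []" if "x \<in> \<iota>\<^sub>A ` C" for x
  proof -
    obtain c where c: "c \<in> C" "x = \<iota>\<^sub>A c" using \<open>x \<in> \<iota>\<^sub>A ` C\<close> by blast
    have "L.act c \<omega>\<^sub>0 = (c \<otimes>\<^bsub>A\<^esub> \<one>\<^bsub>A\<^esub>, [])"
      using L.act_\<kappa>[of c "\<one>\<^bsub>A\<^esub>" "[]"] c(1) subgroup.one_closed[OF C_subgroup] by (simp add: \<omega>\<^sub>0_def)
    then have "h x \<omega>\<^sub>0 = (c, [])" using h(2)[of c, OF _ \<omega>\<^sub>0] c C_le by auto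
    then show ?thesis using c(1) by simp
  qed
  have step: "h x \<omega> \<in> \<Omega> \<and> starts s (snd (h x \<omega>))"
    if x: "x \<in> factor s" "x \<notin> \<iota>\<^sub>A ` C" and \<omega>: "\<omega> \<in> \<Omega>" "\<not> starts s (snd \<omega>)" for x s \<omega>
  proof (cases s)
    case True
    then obtain a where a: "a \<in> carrier A" "x = \<iota>\<^sub>A a" using x(1) by (auto simp: factor_def)
    then have "a \<notin> C" using x(2) by blast
    then show ?thesis
      using L.starts_act[of a \<omega>] L.act_closed[of a \<omega>] a \<omega> True h(2)[OF a(1) \<omega>(1)]
      by (simp add: starts_def range_Inl_iff)
  next
    case False
    then obtain b where b: "b \<in> carrier B" "x = \<iota>\<^sub>B b" using x(1) by (auto simp: factor_def)
    then have "b \<notin> \<phi> ` C" using x(2) \<iota>_eq by force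
    then show ?thesis
      using R.starts_act[of b \<omega>] R.act_closed[of b \<omega>] b \<omega> False h(3)[OF b(1) \<omega>(1)]
      by (simp add: starts_def range_Inr_iff)
  qed
  have tail: "h y \<omega>\<^sub>0 \<in> \<Omega> \<and> \<not> starts s (snd (h y \<omega>\<^sub>0))" if "G.tail (\<iota>\<^sub>A ` C) factor s y" for s y
    using that
  proof induction
    case (core c s)
    then show ?case using \<open>\<And>x. x \<in> \<iota>\<^sub>A ` C \<Longrightarrow> h x \<omega>\<^sub>0 \<in> \<Omega> \<and> snd (h x \<omega>\<^sub>0) = []\<close>[of c]
      by (simp add: starts_def)
  next
    case (syllable x s y)
    have "x \<in> carrier G" "y \<in> carrier G"
      using syllable(1) factor_carrier G.tail_in_carrier[OF syllable(3) factor_carrier] by auto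
    then have "h (x \<otimes>\<^bsub>G\<^esub> y) \<omega>\<^sub>0 = h x (h y \<omega>\<^sub>0)" using h(1) \<omega>\<^sub>0 by blast
    then show ?case using step[OF syllable(1,2)] syllable.IH by (auto simp: starts_def)
  qed
  have start: "starts s (snd (h x \<omega>\<^sub>0))" if "x \<in> factor s" "x \<notin> \<iota>\<^sub>A ` C" for x s
    using step[OF that \<omega>\<^sub>0] by (simp add: starts_def \<omega>\<^sub>0_def)
  show "amalgamated_group G factor (\<iota>\<^sub>A ` C)"
  proof (intro amalgamated_group.intro amalgamated_group_axioms.intro group_G sub generated)
    show "factor True \<inter> factor False = \<iota>\<^sub>A ` C"
    proof
      show "\<iota>\<^sub>A ` C \<subseteq> factor True \<inter> factor False"
      proof (rule image_subsetI)
        fix c assume c: "c \<in> C"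
        then have "\<iota>\<^sub>A c \<in> \<iota>\<^sub>A ` carrier A" "\<iota>\<^sub>B (\<phi> c) \<in> \<iota>\<^sub>B ` carrier B"
          using C_le \<phi>_le by blast+
        then show "\<iota>\<^sub>A c \<in> factor True \<inter> factor False" using \<iota>_eq[OF c] by (simp add: factor_def)
      qed
      show "factor True \<inter> factor False \<subseteq> \<iota>\<^sub>A ` C"
        using start[of _ True] start[of _ False] by (force simp: starts_def)
    qed
  next
    fix x s y assume x: "x \<in> factor s" "x \<notin> \<iota>\<^sub>A ` C" and y: "G.tail (\<iota>\<^sub>A ` C) factor s y"
    have "x \<in> carrier G" "y \<in> carrier G"
      using x(1) factor_carrier G.tail_in_carrier[OF y factor_carrier] by auto
    then have "h (x \<otimes>\<^bsub>G\<^esub> y) \<omega>\<^sub>0 = h x (h y \<omega>\<^sub>0)" using h(1) \<omega>\<^sub>0 by blast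
    then show "\<not> G.tail (\<iota>\<^sub>A ` C) factor s (x \<otimes>\<^bsub>G\<^esub> y)"
      using step[OF x] tail[OF y] tail[of s "x \<otimes>\<^bsub>G\<^esub> y"] by auto
  qed
qed

end

section \<open>Residues\<close>

text \<open>Injectivity transports the conditions for types in \<open>I\<^sub>0\<close>; for the
  other types \<open>T i\<close> is the whole image and imposes no condition.\<close>

lemma helly_on_image:
  assumes \<iota>: "group_hom A G \<iota>" "inj_on \<iota> (carrier A)" and I: "I\<^sub>0 \<subseteq> I"
    and S: "\<And>i. i \<in> I\<^sub>0 \<Longrightarrow> S i \<subseteq> carrier A"
    and T: "\<And>i. i \<in> I\<^sub>0 \<Longrightarrow> T i = \<iota> ` S i" "\<And>i. i \<in> I \<Longrightarrow> i \<notin> I\<^sub>0 \<Longrightarrow> T i = \<iota> ` carrier A"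
  shows "helly_on G (\<iota> ` carrier A) I T \<longleftrightarrow> helly_on A (carrier A) I\<^sub>0 S"
proof -
  interpret \<iota>: group_hom A G \<iota> by fact
  have eq: "inv\<^bsub>G\<^esub> \<iota> a \<otimes>\<^bsub>G\<^esub> \<iota> b = \<iota> (inv\<^bsub>A\<^esub> a \<otimes>\<^bsub>A\<^esub> b)" if "a \<in> carrier A" "b \<in> carrier A" for a b
    using that by simp
  have mem: "inv\<^bsub>G\<^esub> \<iota> a \<otimes>\<^bsub>G\<^esub> \<iota> b \<in> T i \<longleftrightarrow> inv\<^bsub>A\<^esub> a \<otimes>\<^bsub>A\<^esub> b \<in> S i"
    if "a \<in> carrier A" "b \<in> carrier A" "i \<in> I\<^sub>0" for a b i
    unfolding eq[OF that(1,2)] T(1)[OF that(3)]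
    by (rule inj_on_image_mem_iff[OF \<iota>(2) _ S[OF that(3)]]) (simp add: that)
  have mem': "inv\<^bsub>G\<^esub> \<iota> a \<otimes>\<^bsub>G\<^esub> \<iota> b \<in> T i"
    if "a \<in> carrier A" "b \<in> carrier A" "i \<in> I" "i \<notin> I\<^sub>0" for a b i
    unfolding eq[OF that(1,2)] T(2)[OF that(3,4)] by (rule imageI) (simp add: that)
  show ?thesis
  proof
    assume H: "helly_on G (\<iota> ` carrier A) I T"
    show "helly_on A (carrier A) I\<^sub>0 S"
      unfolding helly_on_def
    proof (intro allI impI, elim conjE)
      fix J x
      assume J: "J \<subseteq> I\<^sub>0" and x: "\<forall>j\<in>J. x j \<in> carrier A"
        and meet: "\<forall>i\<in>J. \<forall>j\<in>J. \<exists>g\<in>carrier A. inv\<^bsub>A\<^esub> x i \<otimes>\<^bsub>A\<^esub> g \<in> S i \<and> inv\<^bsub>A\<^esub> x j \<otimes>\<^bsub>A\<^esub> g \<in> S j"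
      have pair: "\<forall>i\<in>J. \<forall>j\<in>J. \<exists>g\<in>\<iota> ` carrier A.
          inv\<^bsub>G\<^esub> \<iota> (x i) \<otimes>\<^bsub>G\<^esub> g \<in> T i \<and> inv\<^bsub>G\<^esub> \<iota> (x j) \<otimes>\<^bsub>G\<^esub> g \<in> T j"
      proof (intro ballI)
        fix i j assume ij: "i \<in> J" "j \<in> J"
        then obtain a where a: "a \<in> carrier A" "inv\<^bsub>A\<^esub> x i \<otimes>\<^bsub>A\<^esub> a \<in> S i" "inv\<^bsub>A\<^esub> x j \<otimes>\<^bsub>A\<^esub> a \<in> S j"
          using meet by blast
        then have "inv\<^bsub>G\<^esub> \<iota> (x i) \<otimes>\<^bsub>G\<^esub> \<iota> a \<in> T i \<and> inv\<^bsub>G\<^esub> \<iota> (x j) \<otimes>\<^bsub>G\<^esub> \<iota> a \<in> T j"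
          using mem[of "x i" a i] mem[of "x j" a j] x J ij by auto
        then show "\<exists>g\<in>\<iota> ` carrier A. inv\<^bsub>G\<^esub> \<iota> (x i) \<otimes>\<^bsub>G\<^esub> g \<in> T i \<and> inv\<^bsub>G\<^esub> \<iota> (x j) \<otimes>\<^bsub>G\<^esub> g \<in> T j"
          using a(1) by blast
      qed
      have "J \<subseteq> I" using J I by blast
      then obtain g where g: "g \<in> \<iota> ` carrier A" "\<forall>j\<in>J. inv\<^bsub>G\<^esub> \<iota> (x j) \<otimes>\<^bsub>G\<^esub> g \<in> T j"
        using H[unfolded helly_on_def, rule_format, of J "\<lambda>j. \<iota> (x j)"] x pair by auto
      then obtain a where a: "a \<in> carrier A" "g = \<iota> a" by blast
      have "inv\<^bsub>A\<^esub> x j \<otimes>\<^bsub>A\<^esub> a \<in> S j" if "j \<in> J" for j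
        using g(2) mem[of "x j" a j] a x J that by auto
      then show "\<exists>g\<in>carrier A. \<forall>j\<in>J. inv\<^bsub>A\<^esub> x j \<otimes>\<^bsub>A\<^esub> g \<in> S j" using a(1) by blast
    qed
  next
    assume H: "helly_on A (carrier A) I\<^sub>0 S"
    show "helly_on G (\<iota> ` carrier A) I T"
      unfolding helly_on_def
    proof (intro allI impI, elim conjE)
      fix J x
      assume J: "J \<subseteq> I" and x: "\<forall>j\<in>J. x j \<in> \<iota> ` carrier A"
        and meet: "\<forall>i\<in>J. \<forall>j\<in>J. \<exists>g\<in>\<iota> ` carrier A.
          inv\<^bsub>G\<^esub> x i \<otimes>\<^bsub>G\<^esub> g \<in> T i \<and> inv\<^bsub>G\<^esub> x j \<otimes>\<^bsub>G\<^esub> g \<in> T j"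
      have "\<forall>j\<in>J. \<exists>a\<in>carrier A. x j = \<iota> a" using x by blast
      then obtain y where y: "\<And>j. j \<in> J \<Longrightarrow> y j \<in> carrier A" "\<And>j. j \<in> J \<Longrightarrow> x j = \<iota> (y j)"
        by metis
      have pair: "\<exists>a\<in>carrier A. inv\<^bsub>A\<^esub> y i \<otimes>\<^bsub>A\<^esub> a \<in> S i \<and> inv\<^bsub>A\<^esub> y j \<otimes>\<^bsub>A\<^esub> a \<in> S j"
        if ij: "i \<in> J" "j \<in> J" "i \<in> I\<^sub>0" "j \<in> I\<^sub>0" for i j
      proof -
        obtain a where a: "a \<in> carrier A" "inv\<^bsub>G\<^esub> x i \<otimes>\<^bsub>G\<^esub> \<iota> a \<in> T i" "inv\<^bsub>G\<^esub> x j \<otimes>\<^bsub>G\<^esub> \<iota> a \<in> T j"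
          using meet ij(1,2) by blast
        then show ?thesis using mem[of "y i" a i] mem[of "y j" a j] y ij by auto
      qed
      then obtain a where a: "a \<in> carrier A" "\<forall>j\<in>J \<inter> I\<^sub>0. inv\<^bsub>A\<^esub> y j \<otimes>\<^bsub>A\<^esub> a \<in> S j"
        using H[unfolded helly_on_def, rule_format, of "J \<inter> I\<^sub>0" y] y(1) by auto
      have "inv\<^bsub>G\<^esub> x j \<otimes>\<^bsub>G\<^esub> \<iota> a \<in> T j" if j: "j \<in> J" for j
      proof (cases "j \<in> I\<^sub>0")
        case True
        then show ?thesis using a mem[of "y j" a j] y j by auto
      next
        case False
        then show ?thesis using mem'[of "y j" a j] y J j a(1) by auto
      qed
      then show "\<exists>g\<in>\<iota> ` carrier A. \<forall>j\<in>J. inv\<^bsub>G\<^esub> x j \<otimes>\<^bsub>G\<^esub> g \<in> T j" using a(1) by blast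
    qed
  qed
qed

text \<open>The two maps have the same fibres on \<open>P\<close>, so sending \<open>f x\<close> to
  \<open>g x\<close> is a bijection between the images.\<close>

lemma image_eq_card:
  assumes "\<And>x y. x \<in> P \<Longrightarrow> y \<in> P \<Longrightarrow> f x = f y \<longleftrightarrow> g x = g y"
  shows "finite (f ` P) = finite (g ` P)" "card (f ` P) = card (g ` P)"
proof -
  let ?r = "\<lambda>z. g (inv_into P f z)"
  have r: "?r (f x) = g x" if "x \<in> P" for x
    using assms[of "inv_into P f (f x)" x] that
    by (simp add: f_inv_into_f inv_into_into)
  have "?r ` f ` P = g ` P"
    unfolding image_image using r by (intro image_cong) auto
  moreover have "inj_on ?r (f ` P)"
    using r assms by (auto intro!: inj_onI)
  ultimately have "bij_betw ?r (f ` P) (g ` P)" by (simp add: bij_betw_def)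
  then show "finite (f ` P) = finite (g ` P)" "card (f ` P) = card (g ` P)"
    by (rule bij_betw_finite, rule bij_betw_same_card)
qed

lemma eq_imageI:
  assumes "\<And>a. a \<in> D \<Longrightarrow> f a \<in> Y \<longleftrightarrow> a \<in> P" and "Y \<subseteq> f ` D" and "P \<subseteq> D"
  shows "Y = f ` P"
  using assms by blast

text \<open>The smaller family is the residue of the flag of type \<open>I - I\<^sub>0\<close> consisting of the subgroups
  of the larger one.\<close>

locale residue_embedding =
  big: helly_coset_family G I K + small: helly_coset_family A I\<^sub>0 S + group_hom A G \<iota>
  for G :: "'g monoid" and I :: "'i set" and K :: "'i \<Rightarrow> 'g set"
    and A :: "'a monoid" and I\<^sub>0 :: "'i set" and S :: "'i \<Rightarrow> 'a set" and \<iota> :: "'a \<Rightarrow> 'g" +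
  assumes inj: "inj_on \<iota> (carrier A)" and I\<^sub>0: "I\<^sub>0 \<subseteq> I"
    and parabolic_image: "J \<subseteq> I\<^sub>0 \<Longrightarrow> big.P (J \<union> (I - I\<^sub>0)) = \<iota> ` small.P J"
begin

lemma small_P_subset: "small.P J \<subseteq> carrier A"
  by (auto simp: small.mem_P)

text \<open>The image of \<iota> lies in the parabolic of the types outside
  \<open>I\<^sub>0\<close>, so membership in \<open>K i\<close> is decided by
  \<open>parabolic_image\<close> for the single type \<open>i\<close>.\<close>

lemma mem_K_iff:
  assumes i: "i \<in> I\<^sub>0" and a: "a \<in> carrier A"
  shows "\<iota> a \<in> K i \<longleftrightarrow> a \<in> S i"
proof -
  have "\<iota> a \<in> big.P (I - I\<^sub>0)" using parabolic_image[of "{}"] a small.mem_P[of a "{}"] by auto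
  then have "\<iota> a \<in> K i \<longleftrightarrow> \<iota> a \<in> big.P ({i} \<union> (I - I\<^sub>0))" by (auto simp: big.mem_P)
  also have "\<dots> \<longleftrightarrow> a \<in> small.P {i}"
    using parabolic_image[of "{i}"] i inj_on_image_mem_iff[OF inj a small_P_subset] by simp
  finally show ?thesis using a by (simp add: small.mem_P)
qed

lemma image_P_subset:
  assumes "J \<subseteq> I"
  shows "\<iota> ` small.P (J \<inter> I\<^sub>0) \<subseteq> big.P J"
proof -
  have "\<iota> ` small.P (J \<inter> I\<^sub>0) = big.P (J \<inter> I\<^sub>0 \<union> (I - I\<^sub>0))" using parabolic_image[of "J \<inter> I\<^sub>0"] by simp
  also have "\<dots> \<subseteq> big.P J" unfolding parabolic_def using assms by (intro Int_mono INF_superset_mono) auto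
  finally show ?thesis .
qed

text \<open>The types outside \<open>I\<^sub>0\<close> complete \<open>I\<^sub>0 - {i}\<close> to
  \<open>I - {i}\<close>, so both coset sets come from the same parabolic up to \<iota>, and by
  \<open>mem_K_iff\<close> the same pairs of cosets coincide.\<close>

lemma corank_one_cosets:
  assumes i: "i \<in> I\<^sub>0"
  defines "D \<equiv> (\<lambda>h. h <#\<^bsub>G\<^esub> K i) ` big.P (I - {i})"
    and "D\<^sub>0 \<equiv> (\<lambda>a. a <#\<^bsub>A\<^esub> S i) ` small.P (I\<^sub>0 - {i})"
  shows "finite D = finite D\<^sub>0" "card D = card D\<^sub>0"
proof -
  have iI: "i \<in> I" using i I\<^sub>0 by blast
  have "I\<^sub>0 - {i} \<union> (I - I\<^sub>0) = I - {i}" using i I\<^sub>0 by blast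
  then have "big.P (I - {i}) = \<iota> ` small.P (I\<^sub>0 - {i})" using parabolic_image[of "I\<^sub>0 - {i}"] by auto
  then have D: "D = (\<lambda>a. \<iota> a <#\<^bsub>G\<^esub> K i) ` small.P (I\<^sub>0 - {i})" unfolding D_def by (simp add: image_image)
  have iff: "\<iota> a <#\<^bsub>G\<^esub> K i = \<iota> b <#\<^bsub>G\<^esub> K i \<longleftrightarrow> a <#\<^bsub>A\<^esub> S i = b <#\<^bsub>A\<^esub> S i"
    if "a \<in> small.P (I\<^sub>0 - {i})" "b \<in> small.P (I\<^sub>0 - {i})" for a b
  proof -
    have ab: "a \<in> carrier A" "b \<in> carrier A" using that small_P_subset by auto
    have "\<iota> a <#\<^bsub>G\<^esub> K i = \<iota> b <#\<^bsub>G\<^esub> K i \<longleftrightarrow> \<iota> (inv\<^bsub>A\<^esub> a \<otimes>\<^bsub>A\<^esub> b) \<in> K i"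
      using big.coset_eq_iff[OF iI, of "\<iota> a" "\<iota> b"] ab by simp
    then show ?thesis using mem_K_iff[OF i, of "inv\<^bsub>A\<^esub> a \<otimes>\<^bsub>A\<^esub> b"] small.coset_eq_iff[OF i ab] ab by simp
  qed
  show "finite D = finite D\<^sub>0"
    unfolding D D\<^sub>0_def by (rule image_eq_card(1)) (rule iff)
  show "card D = card D\<^sub>0"
    unfolding D D\<^sub>0_def by (rule image_eq_card(2)) (rule iff)
qed

lemma image_generate:
  "\<iota> ` generate A (\<Union>i\<in>N. small.P (Q i)) = generate G (\<Union>i\<in>N. \<iota> ` small.P (Q i))"
  using generate_img[of "\<Union>i\<in>N. small.P (Q i)"] small_P_subset by (simp add: image_UN UN_least)

text \<open>The criterion for the larger family is applied to \<open>J\<close> together with all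
  types outside \<open>I\<^sub>0\<close>; each parabolic in it is then the image of a parabolic of
  the smaller family.\<close>

lemma residually_connected_small:
  assumes "residually_connected big.X"
  shows "residually_connected small.X"
  unfolding small.residually_connected_iff
proof (intro allI impI)
  fix J assume J: "J \<subseteq> I\<^sub>0" and two: "2 \<le> card (I\<^sub>0 - J)"
  let ?J = "J \<union> (I - I\<^sub>0)"
  have diff: "I - ?J = I\<^sub>0 - J" and JI: "?J \<subseteq> I" using J I\<^sub>0 by auto
  have ins: "big.P (insert i ?J) = \<iota> ` small.P (insert i J)" if "i \<in> I\<^sub>0 - J" for i
    using parabolic_image[of "insert i J"] that J by simp
  have "big.P ?J \<subseteq> generate G (\<Union>i\<in>I - ?J. big.P (insert i ?J))"
    using assms two JI diff unfolding big.residually_connected_iff by metis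
  also have "\<dots> = generate G (\<Union>i\<in>I\<^sub>0 - J. \<iota> ` small.P (insert i J))"
    unfolding diff using ins by simp
  finally have image: "\<iota> ` small.P J \<subseteq> \<iota> ` generate A (\<Union>i\<in>I\<^sub>0 - J. small.P (insert i J))"
    unfolding image_generate parabolic_image[OF J] .
  have sub: "generate A (\<Union>i\<in>I\<^sub>0 - J. small.P (insert i J)) \<subseteq> carrier A"
    using small_P_subset by (intro small.generate_incl) blast
  show "small.P J \<subseteq> generate A (\<Union>i\<in>I\<^sub>0 - J. small.P (insert i J))"
  proof
    fix a assume a: "a \<in> small.P J"
    then have "\<iota> a \<in> \<iota> ` generate A (\<Union>i\<in>I\<^sub>0 - J. small.P (insert i J))" using image by blast
    then show "a \<in> generate A (\<Union>i\<in>I\<^sub>0 - J. small.P (insert i J))"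
      using inj_on_image_mem_iff[OF inj subsetD[OF small_P_subset a] sub] by blast
  qed
qed

text \<open>If all types missing from \<open>J\<close> belong to \<open>I\<^sub>0\<close>, the
  criterion of the smaller family applies. Otherwise a missing type \<open>i\<close> outside
  \<open>I\<^sub>0\<close> imposes no condition on the image of \<iota>, and the left-hand side
  already lies in the single parabolic \<open>P (insert i J)\<close>.\<close>

lemma image_P_generated:
  assumes rc: "residually_connected small.X" and J: "J \<subseteq> I" and two: "2 \<le> card (I - J)"
  shows "\<iota> ` small.P (J \<inter> I\<^sub>0) \<subseteq> generate G (\<Union>i\<in>I - J. big.P (insert i J))"
proof (cases "I - J \<subseteq> I\<^sub>0")
  case True
  then have diff: "I\<^sub>0 - J \<inter> I\<^sub>0 = I - J" using I\<^sub>0 by blast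
  have "small.P (J \<inter> I\<^sub>0) \<subseteq> generate A (\<Union>i\<in>I - J. small.P (insert i (J \<inter> I\<^sub>0)))"
    using rc two diff unfolding small.residually_connected_iff by (metis inf_le2)
  then have "\<iota> ` small.P (J \<inter> I\<^sub>0) \<subseteq> generate G (\<Union>i\<in>I - J. \<iota> ` small.P (insert i (J \<inter> I\<^sub>0)))"
    unfolding image_generate[symmetric] by blast
  also have "\<dots> \<subseteq> generate G (\<Union>i\<in>I - J. big.P (insert i J))"
  proof (intro big.mono_generate UN_mono order_refl)
    fix i assume i: "i \<in> I - J"
    then have "insert i (J \<inter> I\<^sub>0) = insert i J \<inter> I\<^sub>0" using True by blast
    then show "\<iota> ` small.P (insert i (J \<inter> I\<^sub>0)) \<subseteq> big.P (insert i J)"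
      using image_P_subset[of "insert i J"] i J by simp
  qed
  finally show ?thesis .
next
  case False
  then obtain i where i: "i \<in> I - J" "i \<notin> I\<^sub>0" by blast
  then have "\<iota> ` small.P (J \<inter> I\<^sub>0) \<subseteq> big.P (insert i J)"
    using image_P_subset[of "insert i J"] J by simp
  then show ?thesis using i(1) by (blast intro: generate.incl)
qed

end

section \<open>Amalgamated coset systems\<close>

lemma coset_incidence_system_iff_coset_family:
  "coset_incidence_system \<gamma> \<longleftrightarrow> coset_family (grp \<gamma>) (index \<gamma>) (sub \<gamma>)"
  by (auto simp: coset_incidence_system_def coset_family_def coset_family_axioms_def)

locale compatible_systems =
  fixes \<alpha> :: "('a, 'i) coset_system" and \<beta> :: "('b, 'i) coset_system" and \<phi> :: "'a \<Rightarrow> 'b"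
  assumes system_\<alpha>: "coset_incidence_system \<alpha>" and finite_\<alpha>: "finite (index \<alpha>)"
    and system_\<beta>: "coset_incidence_system \<beta>" and finite_\<beta>: "finite (index \<beta>)"
    and comp: "compatible \<phi> \<alpha> \<beta>"
begin

abbreviation C :: "'a set" where
  "C \<equiv> parabolic \<alpha> (index \<alpha> - index \<beta>)"

abbreviation I :: "'i set" where
  "I \<equiv> index \<alpha> \<union> index \<beta>"

sublocale fam_\<alpha>: coset_family "grp \<alpha>" "index \<alpha>" "sub \<alpha>"
  using system_\<alpha> by (simp add: coset_incidence_system_iff_coset_family)

sublocale fam_\<beta>: coset_family "grp \<beta>" "index \<beta>" "sub \<beta>"
  using system_\<beta> by (simp add: coset_incidence_system_iff_coset_family)

lemma Diff_Int_index: "index \<alpha> - index \<alpha> \<inter> index \<beta> = index \<alpha> - index \<beta>"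
  "index \<beta> - index \<alpha> \<inter> index \<beta> = index \<beta> - index \<alpha>"
  by blast+

lemma \<phi>_iso: "\<phi> \<in> iso (grp \<alpha>\<lparr>carrier := C\<rparr>)
    (grp \<beta>\<lparr>carrier := parabolic \<beta> (index \<beta> - index \<alpha>)\<rparr>)"
  using comp unfolding compatible_def Let_def Diff_Int_index by blast

lemma \<phi>_image_C: "\<phi> ` C = parabolic \<beta> (index \<beta> - index \<alpha>)"
  using \<phi>_iso by (auto simp: iso_def bij_betw_def)

lemma \<phi>_image:
  assumes "J \<subseteq> index \<alpha> \<inter> index \<beta>"
  shows "\<phi> ` parabolic \<alpha> (index \<alpha> - index \<beta> \<union> J) = parabolic \<beta> (index \<beta> - index \<alpha> \<union> J)"
proof -
  have "index \<alpha> - (index \<alpha> \<inter> index \<beta> - J) = index \<alpha> - index \<beta> \<union> J"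
    "index \<beta> - (index \<alpha> \<inter> index \<beta> - J) = index \<beta> - index \<alpha> \<union> J"
    using assms by blast+
  then show ?thesis using comp assms unfolding compatible_def Let_def by metis
qed

sublocale amalgamation "grp \<alpha>" "grp \<beta>" C \<phi>
proof (intro amalgamation.intro amalgamation_axioms.intro fam_\<alpha>.is_group fam_\<beta>.is_group)
  show "subgroup C (grp \<alpha>)" using fam_\<alpha>.subgroup_P[of "index \<alpha> - index \<beta>"] by simp
  show "inj_on \<phi> C" using \<phi>_iso by (auto simp: iso_def bij_betw_def)
  have "\<phi> ` C \<subseteq> carrier (grp \<beta>)" unfolding \<phi>_image_C by (auto simp: parabolic_def)
  then show "\<phi> \<in> hom (grp \<alpha>\<lparr>carrier := C\<rparr>) (grp \<beta>)"
    using \<phi>_iso by (auto simp: iso_def hom_def)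
qed

definition T :: "bool \<Rightarrow> 'i \<Rightarrow> ('a + 'b) list set set" where
  "T s i = (if s then \<iota>\<^sub>A ` parabolic \<alpha> ({i} \<inter> index \<alpha>) else \<iota>\<^sub>B ` parabolic \<beta> ({i} \<inter> index \<beta>))"

abbreviation M :: "bool \<Rightarrow> 'i set" where
  "M s \<equiv> if s then index \<alpha> - index \<beta> else index \<beta> - index \<alpha>"

lemma parabolic_carrier: "parabolic \<alpha> J \<subseteq> carrier (grp \<alpha>)" "parabolic \<beta> J \<subseteq> carrier (grp \<beta>)"
  by (auto simp: parabolic_def)

lemma mem_T_left:
  assumes a: "a \<in> carrier (grp \<alpha>)"
  shows "\<iota>\<^sub>A a \<in> T True i \<longleftrightarrow> (i \<in> index \<alpha> \<longrightarrow> a \<in> sub \<alpha> i)"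
proof -
  have "\<iota>\<^sub>A a \<in> T True i \<longleftrightarrow> a \<in> parabolic \<alpha> ({i} \<inter> index \<alpha>)"
    unfolding T_def using inj_on_image_mem_iff[OF inj_\<iota>(1) a parabolic_carrier(1)] by simp
  then show ?thesis using a by (auto simp: parabolic_def)
qed

lemma mem_T_right:
  assumes b: "b \<in> carrier (grp \<beta>)"
  shows "\<iota>\<^sub>B b \<in> T False i \<longleftrightarrow> (i \<in> index \<beta> \<longrightarrow> b \<in> sub \<beta> i)"
proof -
  have "\<iota>\<^sub>B b \<in> T False i \<longleftrightarrow> b \<in> parabolic \<beta> ({i} \<inter> index \<beta>)"
    unfolding T_def using inj_on_image_mem_iff[OF inj_\<iota>(2) b parabolic_carrier(2)] by simp
  then show ?thesis using b by (auto simp: parabolic_def)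
qed

lemma T_le_factor: "T s i \<subseteq> factor s"
  unfolding T_def factor_def using parabolic_carrier by (simp add: image_mono)

lemma T_eq:
  "i \<in> index \<alpha> \<Longrightarrow> T True i = \<iota>\<^sub>A ` sub \<alpha> i" "i \<notin> index \<alpha> \<Longrightarrow> T True i = factor True"
  "i \<in> index \<beta> \<Longrightarrow> T False i = \<iota>\<^sub>B ` sub \<beta> i" "i \<notin> index \<beta> \<Longrightarrow> T False i = factor False"
proof -
  have "parabolic \<alpha> {} = carrier (grp \<alpha>)" "parabolic \<beta> {} = carrier (grp \<beta>)"
    by (simp_all add: parabolic_def)
  moreover have "parabolic \<alpha> {i} = sub \<alpha> i" if "i \<in> index \<alpha>"
    using fam_\<alpha>.S_inG[OF that] by (auto simp: parabolic_def)
  moreover have "parabolic \<beta> {i} = sub \<beta> i" if "i \<in> index \<beta>"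
    using fam_\<beta>.S_inG[OF that] by (auto simp: parabolic_def)
  ultimately show "i \<in> index \<alpha> \<Longrightarrow> T True i = \<iota>\<^sub>A ` sub \<alpha> i" "i \<notin> index \<alpha> \<Longrightarrow> T True i = factor True"
    "i \<in> index \<beta> \<Longrightarrow> T False i = \<iota>\<^sub>B ` sub \<beta> i" "i \<notin> index \<beta> \<Longrightarrow> T False i = factor False"
    by (simp_all add: T_def factor_def)
qed

lemma T_left_Int_C:
  "T True i \<inter> \<iota>\<^sub>A ` C = \<iota>\<^sub>A ` parabolic \<alpha> (index \<alpha> - index \<beta> \<union> {i} \<inter> index \<alpha>)"
proof -
  have "T True i \<inter> \<iota>\<^sub>A ` C = \<iota>\<^sub>A ` (parabolic \<alpha> ({i} \<inter> index \<alpha>) \<inter> C)"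
    unfolding T_def using inj_on_image_Int[OF inj_\<iota>(1) parabolic_carrier(1) parabolic_carrier(1)] by simp
  also have "parabolic \<alpha> ({i} \<inter> index \<alpha>) \<inter> C = parabolic \<alpha> (index \<alpha> - index \<beta> \<union> {i} \<inter> index \<alpha>)"
    by (auto simp: parabolic_def)
  finally show ?thesis .
qed

lemma \<iota>_image_C: "\<iota>\<^sub>B ` parabolic \<beta> (index \<beta> - index \<alpha>) = \<iota>\<^sub>A ` C"
  unfolding \<phi>_image_C[symmetric] image_image using \<iota>_eq by (intro image_cong) auto

lemma T_right_Int_C:
  "T False i \<inter> \<iota>\<^sub>A ` C = \<iota>\<^sub>B ` parabolic \<beta> (index \<beta> - index \<alpha> \<union> {i} \<inter> index \<beta>)"
proof -
  have "T False i \<inter> \<iota>\<^sub>A ` C = \<iota>\<^sub>B ` (parabolic \<beta> ({i} \<inter> index \<beta>) \<inter> parabolic \<beta> (index \<beta> - index \<alpha>))"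
    unfolding T_def \<iota>_image_C[symmetric]
    using inj_on_image_Int[OF inj_\<iota>(2) parabolic_carrier(2) parabolic_carrier(2)] by simp
  also have "parabolic \<beta> ({i} \<inter> index \<beta>) \<inter> parabolic \<beta> (index \<beta> - index \<alpha>) =
      parabolic \<beta> (index \<beta> - index \<alpha> \<union> {i} \<inter> index \<beta>)"
    by (auto simp: parabolic_def)
  finally show ?thesis .
qed

text \<open>Compatibility is used for the set of types \<open>?J\<close>. If \<open>i\<close>
  belongs to one system only, this set is empty and both intersections are the image of
  \<open>C\<close>.\<close>

lemma T_Int_C:
  assumes "i \<in> I"
  shows "T True i \<inter> \<iota>\<^sub>A ` C = T False i \<inter> \<iota>\<^sub>A ` C"
proof -
  let ?J = "{i} \<inter> (index \<alpha> \<inter> index \<beta>)"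
  have "parabolic \<alpha> (index \<alpha> - index \<beta> \<union> ?J) \<subseteq> C" by (auto simp: parabolic_def)
  then have "\<iota>\<^sub>A ` parabolic \<alpha> (index \<alpha> - index \<beta> \<union> ?J) =
      \<iota>\<^sub>B ` \<phi> ` parabolic \<alpha> (index \<alpha> - index \<beta> \<union> ?J)"
    unfolding image_image using \<iota>_eq by (intro image_cong) auto
  also have "\<phi> ` parabolic \<alpha> (index \<alpha> - index \<beta> \<union> ?J) = parabolic \<beta> (index \<beta> - index \<alpha> \<union> ?J)"
    using \<phi>_image[of ?J] by blast
  finally have "\<iota>\<^sub>A ` parabolic \<alpha> (index \<alpha> - index \<beta> \<union> ?J) =
      \<iota>\<^sub>B ` parabolic \<beta> (index \<beta> - index \<alpha> \<union> ?J)" .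
  moreover have "index \<alpha> - index \<beta> \<union> ?J = index \<alpha> - index \<beta> \<union> {i} \<inter> index \<alpha>"
    "index \<beta> - index \<alpha> \<union> ?J = index \<beta> - index \<alpha> \<union> {i} \<inter> index \<beta>"
    by blast+
  ultimately show ?thesis unfolding T_left_Int_C T_right_Int_C by simp
qed

lemma factor_Int_T: "factor s \<inter> (\<Inter>i\<in>M s. T s i) = \<iota>\<^sub>A ` C"
proof (cases s)
  case True
  let ?Y = "factor True \<inter> (\<Inter>i\<in>index \<alpha> - index \<beta>. T True i)"
  have "\<iota>\<^sub>A a \<in> ?Y \<longleftrightarrow> a \<in> C" if "a \<in> carrier (grp \<alpha>)" for a
    using that mem_T_left[OF that] by (auto simp: mem_parabolic factor_def)
  moreover have "?Y \<subseteq> \<iota>\<^sub>A ` carrier (grp \<alpha>)" by (simp add: factor_def le_infI1)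
  ultimately have "?Y = \<iota>\<^sub>A ` C" using parabolic_carrier(1) by (rule eq_imageI)
  then show ?thesis using True by simp
next
  case False
  let ?Y = "factor False \<inter> (\<Inter>i\<in>index \<beta> - index \<alpha>. T False i)"
  have "\<iota>\<^sub>B b \<in> ?Y \<longleftrightarrow> b \<in> parabolic \<beta> (index \<beta> - index \<alpha>)" if "b \<in> carrier (grp \<beta>)" for b
    using that mem_T_right[OF that] by (auto simp: mem_parabolic factor_def)
  moreover have "?Y \<subseteq> \<iota>\<^sub>B ` carrier (grp \<beta>)" by (simp add: factor_def le_infI1)
  ultimately have "?Y = \<iota>\<^sub>B ` parabolic \<beta> (index \<beta> - index \<alpha>)"
    using parabolic_carrier(2) by (rule eq_imageI)
  then show ?thesis using False \<iota>_image_C by simp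
qed

sublocale amalgamated_family G factor "\<iota>\<^sub>A ` C" I T M
proof (intro amalgamated_family.intro amalgamated_family_axioms.intro amalgamated_group_axioms)
  fix i s assume i: "i \<in> I"
  have "subgroup (parabolic \<alpha> ({i} \<inter> index \<alpha>)) (grp \<alpha>)" "subgroup (parabolic \<beta> ({i} \<inter> index \<beta>)) (grp \<beta>)"
    using fam_\<alpha>.subgroup_P[of "{i} \<inter> index \<alpha>"] fam_\<beta>.subgroup_P[of "{i} \<inter> index \<beta>"] by auto
  then show "subgroup (T s i) G"
    using group_hom.subgroup_img_is_subgroup[OF group_hom_\<iota>\<^sub>A]
      group_hom.subgroup_img_is_subgroup[OF group_hom_\<iota>\<^sub>B] by (simp add: T_def)
next
  fix i s assume "i \<in> M s"
  then show "T (\<not> s) i = factor (\<not> s)"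
    by (cases s) (auto simp: T_eq)
qed (auto simp: T_le_factor T_Int_C factor_Int_T)

lemma amalgam_eq: "amalgam \<phi> \<alpha> \<beta> = \<lparr>grp = G, index = I, sub = K\<rparr>"
  unfolding amalgam_def Let_def Diff_Int_index by (simp add: K_def[abs_def] T_def)

sublocale fam: coset_family G I K
  using K_subgroup by (intro coset_family.intro coset_family_axioms.intro group_G)

lemma helly_factor_True:
  "helly_on G (factor True) I (T True) \<longleftrightarrow> helly_on (grp \<alpha>) (carrier (grp \<alpha>)) (index \<alpha>) (sub \<alpha>)"
  using helly_on_image[OF group_hom_\<iota>\<^sub>A inj_\<iota>(1), of "index \<alpha>" I "sub \<alpha>" "T True"] fam_\<alpha>.S_inG
  by (auto simp: T_eq factor_def)

lemma helly_factor_False: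
  "helly_on G (factor False) I (T False) \<longleftrightarrow> helly_on (grp \<beta>) (carrier (grp \<beta>)) (index \<beta>) (sub \<beta>)"
  using helly_on_image[OF group_hom_\<iota>\<^sub>B inj_\<iota>(2), of "index \<beta>" I "sub \<beta>" "T False"] fam_\<beta>.S_inG
  by (auto simp: T_eq factor_def)

lemma flag_transitive_\<alpha>_iff: "flag_transitive \<alpha> \<longleftrightarrow> helly_on G (factor True) I (T True)"
  using fam_\<alpha>.flag_transitive_iff_helly unfolding helly_factor_True by simp

lemma flag_transitive_\<beta>_iff: "flag_transitive \<beta> \<longleftrightarrow> helly_on G (factor False) I (T False)"
  using fam_\<beta>.flag_transitive_iff_helly unfolding helly_factor_False by simp

lemma helly_family:
  assumes "flag_transitive \<alpha>" "flag_transitive \<beta>"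
  shows "helly_amalgamated_family G factor (\<iota>\<^sub>A ` C) I T M"
proof unfold_locales
  fix s show "helly_on G (factor s) I (T s)"
    using assms flag_transitive_\<alpha>_iff flag_transitive_\<beta>_iff by (cases s) auto
qed

lemma flag_transitive_amalgam_iff:
  "flag_transitive (amalgam \<phi> \<alpha> \<beta>) \<longleftrightarrow> flag_transitive \<alpha> \<and> flag_transitive \<beta>"
proof
  assume "flag_transitive (amalgam \<phi> \<alpha> \<beta>)"
  then have "helly_on G (carrier G) I K"
    unfolding amalgam_eq by (simp add: fam.flag_transitive_iff_helly)
  then show "flag_transitive \<alpha> \<and> flag_transitive \<beta>"
    using helly_factor flag_transitive_\<alpha>_iff flag_transitive_\<beta>_iff by blast
next
  assume "flag_transitive \<alpha> \<and> flag_transitive \<beta>"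
  then interpret helly_amalgamated_family G factor "\<iota>\<^sub>A ` C" I T M using helly_family by blast
  show "flag_transitive (amalgam \<phi> \<alpha> \<beta>)"
    unfolding amalgam_eq fam.flag_transitive_iff_helly
    using helly_amalgam finite_\<alpha> finite_\<beta> by blast
qed

end

section \<open>Geometric properties of the flag-transitive amalgam\<close>

locale flag_transitive_compatible_systems = compatible_systems +
  assumes ft: "flag_transitive (amalgam \<phi> \<alpha> \<beta>)"
begin

sublocale helly_amalgamated_family G factor "\<iota>\<^sub>A ` C" I T M
  using helly_family ft flag_transitive_amalgam_iff by blast

sublocale helly_fam: helly_coset_family G I K
  using finite_\<alpha> finite_\<beta> helly_amalgam by unfold_locales auto

sublocale helly_\<alpha>: helly_coset_family "grp \<alpha>" "index \<alpha>" "sub \<alpha>"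
  using finite_\<alpha> helly[of True] by unfold_locales (auto simp: helly_factor_True)

sublocale helly_\<beta>: helly_coset_family "grp \<beta>" "index \<beta>" "sub \<beta>"
  using finite_\<beta> helly[of False] by unfold_locales (auto simp: helly_factor_False)

text \<open>The types outside the index set of \<alpha> are those occurring in \<beta> only, so
  \<open>parabolic_in_factor\<close> places the required parabolics inside
  \<open>factor True\<close>, where \<open>T True j\<close> replaces \<open>K j\<close>.\<close>

sublocale emb_\<alpha>: residue_embedding G I K "grp \<alpha>" "index \<alpha>" "sub \<alpha>" \<iota>\<^sub>A
proof (intro residue_embedding.intro residue_embedding_axioms.intro
    helly_fam.helly_coset_family_axioms helly_\<alpha>.helly_coset_family_axioms group_hom_\<iota>\<^sub>A inj_\<iota>(1))
  fix J assume J: "J \<subseteq> index \<alpha>"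
  let ?J = "J \<union> (I - index \<alpha>)"
  have "M (\<not> True) \<subseteq> ?J" "?J \<subseteq> I" using J by auto
  have "fam.P ?J = {g \<in> carrier G. \<forall>j\<in>?J. g \<in> K j}"
    by (rule Set.set_eqI) (simp add: mem_parabolic)
  also have "\<dots> = {v \<in> factor True. \<forall>j\<in>?J. v \<in> T True j}"
    by (rule parabolic_in_factor) fact+
  also have "\<dots> = \<iota>\<^sub>A ` fam_\<alpha>.P J"
  proof (rule eq_imageI)
    show "\<iota>\<^sub>A a \<in> {v \<in> factor True. \<forall>j\<in>?J. v \<in> T True j} \<longleftrightarrow> a \<in> fam_\<alpha>.P J" if "a \<in> carrier (grp \<alpha>)" for a
      using that J mem_T_left[OF that] by (auto simp: mem_parabolic factor_def)
  qed (auto simp: factor_def mem_parabolic)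
  finally show "fam.P ?J = \<iota>\<^sub>A ` fam_\<alpha>.P J" .
qed auto

sublocale emb_\<beta>: residue_embedding G I K "grp \<beta>" "index \<beta>" "sub \<beta>" \<iota>\<^sub>B
proof (intro residue_embedding.intro residue_embedding_axioms.intro
    helly_fam.helly_coset_family_axioms helly_\<beta>.helly_coset_family_axioms group_hom_\<iota>\<^sub>B inj_\<iota>(2))
  fix J assume J: "J \<subseteq> index \<beta>"
  let ?J = "J \<union> (I - index \<beta>)"
  have "M (\<not> False) \<subseteq> ?J" "?J \<subseteq> I" using J by auto
  have "fam.P ?J = {g \<in> carrier G. \<forall>j\<in>?J. g \<in> K j}"
    by (rule Set.set_eqI) (simp add: mem_parabolic)
  also have "\<dots> = {v \<in> factor False. \<forall>j\<in>?J. v \<in> T False j}"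
    by (rule parabolic_in_factor) fact+
  also have "\<dots> = \<iota>\<^sub>B ` fam_\<beta>.P J"
  proof (rule eq_imageI)
    show "\<iota>\<^sub>B a \<in> {v \<in> factor False. \<forall>j\<in>?J. v \<in> T False j} \<longleftrightarrow> a \<in> fam_\<beta>.P J" if "a \<in> carrier (grp \<beta>)" for a
      using that J mem_T_right[OF that] by (auto simp: mem_parabolic factor_def)
  qed (auto simp: factor_def mem_parabolic)
  finally show "fam.P ?J = \<iota>\<^sub>B ` fam_\<beta>.P J" .
qed auto

lemma coset_geometry_amalgam: "coset_geometry (amalgam \<phi> \<alpha> \<beta>)"
  unfolding amalgam_eq coset_geometry_def
  using fam.coset_incidence_system_family helly_fam.geometry_X by blast

text \<open>From the factors to the product: \<open>parabolic_generated\<close> reduces a parabolic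
  of \<open>G\<close> to parabolics of the two factors, and \<open>image_P_generated\<close> puts
  each of these into the subgroup generated by the next smaller parabolics of
  \<open>G\<close>.\<close>

lemma residually_connected_amalgam_iff:
  "residually_connected (incidence (amalgam \<phi> \<alpha> \<beta>)) \<longleftrightarrow>
    residually_connected (incidence \<alpha>) \<and> residually_connected (incidence \<beta>)"
proof
  assume "residually_connected (incidence (amalgam \<phi> \<alpha> \<beta>))"
  then show "residually_connected (incidence \<alpha>) \<and> residually_connected (incidence \<beta>)"
    unfolding amalgam_eq
    using emb_\<alpha>.residually_connected_small emb_\<beta>.residually_connected_small by simp
next
  assume rc: "residually_connected (incidence \<alpha>) \<and> residually_connected (incidence \<beta>)"
  show "residually_connected (incidence (amalgam \<phi> \<alpha> \<beta>))"
    unfolding amalgam_eq helly_fam.residually_connected_iff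
  proof (intro allI impI subsetI)
    fix J g assume J: "J \<subseteq> I" and two: "2 \<le> card (I - J)" and g: "g \<in> fam.P J"
    let ?N = "generate G (\<Union>i\<in>I - J. fam.P (insert i J))"
    have N: "subgroup ?N G" by (rule generate_is_subgroup) (auto simp: mem_parabolic)
    have gens: "\<iota>\<^sub>A ` fam_\<alpha>.P (J \<inter> index \<alpha>) \<subseteq> ?N" "\<iota>\<^sub>B ` fam_\<beta>.P (J \<inter> index \<beta>) \<subseteq> ?N"
      using emb_\<alpha>.image_P_generated[OF _ J two] emb_\<beta>.image_P_generated[OF _ J two] rc by simp_all
    have "{v \<in> factor s. \<forall>j\<in>J. v \<in> T s j} \<subseteq>
        \<iota>\<^sub>A ` fam_\<alpha>.P (J \<inter> index \<alpha>) \<union> \<iota>\<^sub>B ` fam_\<beta>.P (J \<inter> index \<beta>)" for s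
      by (cases s) (auto simp: factor_def mem_T_left mem_T_right mem_parabolic mem_parabolic)
    then have "(\<Union>s. {v \<in> factor s. \<forall>j\<in>J. v \<in> T s j}) \<subseteq> ?N"
      by (intro UN_least order_trans[OF _ Un_least[OF gens]])
    then have "generate G (\<Union>s. {v \<in> factor s. \<forall>j\<in>J. v \<in> T s j}) \<subseteq> ?N"
      by (rule generate_subgroup_incl[OF _ N])
    moreover have "g \<in> generate G (\<Union>s. {v \<in> factor s. \<forall>j\<in>J. v \<in> T s j})"
      using g by (intro parabolic_generated[OF J]) (auto simp: fam.mem_P)
    ultimately show "g \<in> ?N" by blast
  qed
qed

text \<open>Residues of corank one are governed by a single type, and the types of \<alpha> and
  \<beta> together cover \<open>I\<close>. For each type the coset sets in \<open>G\<close> and in a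
  system containing that type have the same size.\<close>

lemma corank_one_residues_amalgam_iff:
  "corank_one_residues Q (incidence (amalgam \<phi> \<alpha> \<beta>)) \<longleftrightarrow>
    corank_one_residues Q (incidence \<alpha>) \<and> corank_one_residues Q (incidence \<beta>)"
proof -
  have "corank_one_residues Q (incidence \<alpha>) \<longleftrightarrow>
      (\<forall>i\<in>index \<alpha>. Q (finite ((\<lambda>h. h <#\<^bsub>G\<^esub> K i) ` fam.P (I - {i})))
        (card ((\<lambda>h. h <#\<^bsub>G\<^esub> K i) ` fam.P (I - {i}))))"
    using helly_\<alpha>.corank_one_residues_iff[of Q] emb_\<alpha>.corank_one_cosets by simp
  moreover have "corank_one_residues Q (incidence \<beta>) \<longleftrightarrow>
      (\<forall>i\<in>index \<beta>. Q (finite ((\<lambda>h. h <#\<^bsub>G\<^esub> K i) ` fam.P (I - {i})))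
        (card ((\<lambda>h. h <#\<^bsub>G\<^esub> K i) ` fam.P (I - {i}))))"
    using helly_\<beta>.corank_one_residues_iff[of Q] emb_\<beta>.corank_one_cosets by simp
  ultimately show ?thesis
    unfolding amalgam_eq helly_fam.corank_one_residues_iff by auto
qed

end

theorem theorem3p23:
  fixes \<alpha> :: "('a, 'i) coset_system" and \<beta> :: "('b, 'i) coset_system" and \<phi> :: "'a \<Rightarrow> 'b"
  assumes "coset_incidence_system \<alpha>" and "finite (index \<alpha>)"
    and "coset_incidence_system \<beta>" and "finite (index \<beta>)"
    and "compatible \<phi> \<alpha> \<beta>"
  shows "(flag_transitive (amalgam \<phi> \<alpha> \<beta>) \<longleftrightarrow> flag_transitive \<alpha> \<and> flag_transitive \<beta>) \<and>
    (flag_transitive (amalgam \<phi> \<alpha> \<beta>) \<longrightarrow>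
      coset_geometry (amalgam \<phi> \<alpha> \<beta>) \<and>
      (residually_connected (incidence (amalgam \<phi> \<alpha> \<beta>)) \<longleftrightarrow>
         residually_connected (incidence \<alpha>) \<and> residually_connected (incidence \<beta>)) \<and>
      (firm (incidence (amalgam \<phi> \<alpha> \<beta>)) \<longleftrightarrow> firm (incidence \<alpha>) \<and> firm (incidence \<beta>)) \<and>
      (thin (incidence (amalgam \<phi> \<alpha> \<beta>)) \<longleftrightarrow> thin (incidence \<alpha>) \<and> thin (incidence \<beta>)) \<and>
      (thick (incidence (amalgam \<phi> \<alpha> \<beta>)) \<longleftrightarrow> thick (incidence \<alpha>) \<and> thick (incidence \<beta>)))"
proof -
  interpret compatible_systems \<alpha> \<beta> \<phi> using assms by unfold_locales
  have "coset_geometry (amalgam \<phi> \<alpha> \<beta>) \<and>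
      (residually_connected (incidence (amalgam \<phi> \<alpha> \<beta>)) \<longleftrightarrow>
         residually_connected (incidence \<alpha>) \<and> residually_connected (incidence \<beta>)) \<and>
      (firm (incidence (amalgam \<phi> \<alpha> \<beta>)) \<longleftrightarrow> firm (incidence \<alpha>) \<and> firm (incidence \<beta>)) \<and>
      (thin (incidence (amalgam \<phi> \<alpha> \<beta>)) \<longleftrightarrow> thin (incidence \<alpha>) \<and> thin (incidence \<beta>)) \<and>
      (thick (incidence (amalgam \<phi> \<alpha> \<beta>)) \<longleftrightarrow> thick (incidence \<alpha>) \<and> thick (incidence \<beta>))"
    if "flag_transitive (amalgam \<phi> \<alpha> \<beta>)"
  proof -
    interpret flag_transitive_compatible_systems \<alpha> \<beta> \<phi> using that by unfold_locales
    show ?thesis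
      unfolding firm_iff thin_iff thick_iff
      using coset_geometry_amalgam residually_connected_amalgam_iff corank_one_residues_amalgam_iff
      by blast
  qed
  then show ?thesis using flag_transitive_amalgam_iff by blast
qed

end
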